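(* For a very general Wehler surface $X\subset \mathbb{P}^1\times\mathbb{P}^1\times\mathbb{P}^1$, every orbit of $\mathrm{Aut}(X)$ in $X$ is Zariski dense in $X$. In particular there is no finite orbit under the action of $\mathrm{Aut}(X)$.
   Context: We work over $\mathbf{C}$. A Wehler surface is a smooth surface $X\subset \mathbb{P}^1\times\mathbb{P}^1\times\mathbb{P}^1$ defined by a polynomial equation of multidegree $(2,2,2)$. The surfaces of degree $(2,2,2)$ are parametrized by the projective space $|L|\simeq \mathbb{P}^{26}(\mathbf{C})$, where $L=\pi_1^*\mathcal{O}(2)\otimes\pi_2^*\mathcal{O}(2)\otimes\pi_3^*\mathcal{O}(2)$. "Very general" means that the property holds for all $X$ in the complement of a countable union of hypersurfaces of $|L|$. $\mathrm{Aut}(X)$ is the group of automorphisms of the algebraic variety $X$. *)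

theory Defs
  imports "HOL-Analysis.Analysis" "HOL-Library.Poly_Mapping" "HOL-Algebra.Group_Action"
begin

text \<open>Monomials are finitely supported exponent functions, polynomials are finitely supported
  coefficient functions on monomials; \<^typ>\<open>('v \<Rightarrow>\<^sub>0 nat) \<Rightarrow>\<^sub>0 complex\<close> carries the usual
  (convolution) ring structure.\<close>

type_synonym 'v cpoly = "('v \<Rightarrow>\<^sub>0 nat) \<Rightarrow>\<^sub>0 complex"

definition monom_eval :: "('v \<Rightarrow> complex) \<Rightarrow> ('v \<Rightarrow>\<^sub>0 nat) \<Rightarrow> complex" where
  "monom_eval a m = (\<Prod>v\<in>Poly_Mapping.keys m. a v ^ Poly_Mapping.lookup m v)"

definition poly_eval :: "('v \<Rightarrow> complex) \<Rightarrow> 'v cpoly \<Rightarrow> complex" where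
  "poly_eval a p = (\<Sum>m\<in>Poly_Mapping.keys p. Poly_Mapping.lookup p m * monom_eval a m)"

definition homogeneous :: "nat \<Rightarrow> 'v cpoly \<Rightarrow> bool" where
  "homogeneous d p \<longleftrightarrow>
    (\<forall>m\<in>Poly_Mapping.keys p. (\<Sum>v\<in>Poly_Mapping.keys m. Poly_Mapping.lookup m v) = d)"

lemma monom_eval_superset:
  assumes "finite S" "Poly_Mapping.keys m \<subseteq> S"
  shows "monom_eval a m = (\<Prod>v\<in>S. a v ^ Poly_Mapping.lookup m v)"
  unfolding monom_eval_def using assms
  by (intro prod.mono_neutral_left) (auto simp: in_keys_iff)

lemma monom_eval_add: "monom_eval a (m + n) = monom_eval a m * monom_eval a n"
proof -
  let ?S = "Poly_Mapping.keys m \<union> Poly_Mapping.keys n"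
  have "Poly_Mapping.keys (m + n) \<subseteq> ?S" by (rule keys_add)
  then show ?thesis
    by (simp add: monom_eval_superset[of ?S] lookup_add power_add prod.distrib)
qed

lemma poly_eval_superset:
  assumes "finite S" "Poly_Mapping.keys p \<subseteq> S"
  shows "poly_eval a p = (\<Sum>m\<in>S. Poly_Mapping.lookup p m * monom_eval a m)"
  unfolding poly_eval_def using assms
  by (intro sum.mono_neutral_left) (auto simp: in_keys_iff)

lemma poly_eval_zero [simp]: "poly_eval a 0 = 0"
  by (simp add: poly_eval_def)

lemma poly_eval_add: "poly_eval a (p + q) = poly_eval a p + poly_eval a q"
proof -
  let ?S = "Poly_Mapping.keys p \<union> Poly_Mapping.keys q"
  have "Poly_Mapping.keys (p + q) \<subseteq> ?S" by (rule keys_add)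
  then show ?thesis
    by (simp add: poly_eval_superset[of ?S] lookup_add distrib_right sum.distrib)
qed

lemma poly_eval_single: "poly_eval a (Poly_Mapping.single m c) = c * monom_eval a m"
  by (subst poly_eval_superset[of "{m}"]) auto

lemma poly_eval_sum: "poly_eval a (sum f A) = (\<Sum>i\<in>A. poly_eval a (f i))"
  by (induction A rule: infinite_finite_induct) (auto simp: poly_eval_add)

lemma cpoly_expand:
  fixes p :: "'v cpoly"
  shows "p = (\<Sum>m\<in>Poly_Mapping.keys p. Poly_Mapping.single m (Poly_Mapping.lookup p m))"
  apply (rule poly_mapping_eqI)
  apply (simp add: lookup_sum lookup_single)
  apply (simp add: when_def in_keys_iff)
  done

lemma poly_eval_mult: "poly_eval a (p * q) = poly_eval a p * poly_eval a q"
proof -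
  have "p * q = (\<Sum>m\<in>Poly_Mapping.keys p. \<Sum>n\<in>Poly_Mapping.keys q.
      Poly_Mapping.single (m + n) (Poly_Mapping.lookup p m * Poly_Mapping.lookup q n))"
    by (subst cpoly_expand[of p], subst cpoly_expand[of q])
      (simp only: sum_product mult_single)
  then have "poly_eval a (p * q) = (\<Sum>m\<in>Poly_Mapping.keys p. \<Sum>n\<in>Poly_Mapping.keys q.
      Poly_Mapping.lookup p m * Poly_Mapping.lookup q n * (monom_eval a m * monom_eval a n))"
    by (simp only: poly_eval_sum poly_eval_single monom_eval_add)
  also have "\<dots> = poly_eval a p * poly_eval a q"
    by (simp add: poly_eval_def sum_product algebra_simps)
  finally show ?thesis .
qed

quotient_type p1 = "complex ^ 2" /
  partial: "\<lambda>u v. u \<noteq> 0 \<and> v \<noteq> 0 \<and> (\<exists>c. c \<noteq> 0 \<and> v = c *s u)"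
proof (rule part_equivpI)
  show "\<exists>u :: complex ^ 2. u \<noteq> 0 \<and> u \<noteq> 0 \<and> (\<exists>c. c \<noteq> 0 \<and> u = c *s u)"
    by (rule exI[of _ 1], auto simp: vec_eq_iff intro!: exI[of _ 1])
  show "symp (\<lambda>u v :: complex ^ 2. u \<noteq> 0 \<and> v \<noteq> 0 \<and> (\<exists>c. c \<noteq> 0 \<and> v = c *s u))"
  proof (rule sympI, elim conjE exE, intro conjI)
    fix u v :: "complex ^ 2" and c :: complex
    assume "c \<noteq> 0" "v = c *s u"
    then show "\<exists>c. c \<noteq> 0 \<and> u = c *s v"
      by (intro exI[of _ "inverse c"]) (simp add: vec_eq_iff)
  qed
  show "transp (\<lambda>u v :: complex ^ 2. u \<noteq> 0 \<and> v \<noteq> 0 \<and> (\<exists>c. c \<noteq> 0 \<and> v = c *s u))"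
  proof (rule transpI, elim conjE exE, intro conjI)
    fix u v w :: "complex ^ 2" and c d :: complex
    assume "c \<noteq> 0" "v = c *s u" "d \<noteq> 0" "w = d *s v"
    then show "\<exists>c. c \<noteq> 0 \<and> w = c *s u"
      by (intro exI[of _ "d * c"]) (simp add: vec_eq_iff)
  qed
qed

text \<open>A point of the triple product is a function on the three-element type \<^typ>\<open>3\<close>.\<close>

type_synonym point = "3 \<Rightarrow> p1"

definition hom_coords :: "point \<Rightarrow> (3 \<Rightarrow> complex ^ 2) set" where
  "hom_coords x = {v. \<forall>i. v i \<noteq> 0 \<and> abs_p1 (v i) = x i}"

text \<open>The variable \<open>(i, j)\<close> stands for the \<open>j\<close>-th homogeneous coordinate on the \<open>i\<close>-th factor.\<close>

abbreviation coord_fun :: "(3 \<Rightarrow> complex ^ 2) \<Rightarrow> 3 \<times> 2 \<Rightarrow> complex" where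
  "coord_fun v \<equiv> (\<lambda>(i, j). v i $ j)"

definition multidegree :: "(3 \<times> 2 \<Rightarrow>\<^sub>0 nat) \<Rightarrow> 3 \<Rightarrow> nat" where
  "multidegree m i = (\<Sum>j\<in>UNIV. Poly_Mapping.lookup m (i, j))"

definition multihomogeneous :: "(3 \<Rightarrow> nat) \<Rightarrow> (3 \<times> 2) cpoly \<Rightarrow> bool" where
  "multihomogeneous d p \<longleftrightarrow> (\<forall>m\<in>Poly_Mapping.keys p. multidegree m = d)"

definition vanishes_at :: "(3 \<times> 2) cpoly \<Rightarrow> point \<Rightarrow> bool" where
  "vanishes_at p x \<longleftrightarrow> (\<forall>v\<in>hom_coords x. poly_eval (coord_fun v) p = 0)"

lemma multihomogeneous_mult:
  assumes "multihomogeneous d p" "multihomogeneous e q"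
  shows "multihomogeneous (\<lambda>i. d i + e i) (p * q)"
  unfolding multihomogeneous_def
proof
  fix k assume "k \<in> Poly_Mapping.keys (p * q)"
  then obtain m n where "k = m + n" "m \<in> Poly_Mapping.keys p" "n \<in> Poly_Mapping.keys q"
    using keys_mult[of p q] by blast
  then show "multidegree k = (\<lambda>i. d i + e i)"
    using assms by (auto simp: multihomogeneous_def multidegree_def fun_eq_iff lookup_add sum.distrib)
qed

lemma hom_coords_nonempty: "hom_coords x \<noteq> {}"
proof -
  have "rep_p1 y \<noteq> 0 \<and> abs_p1 (rep_p1 y) = y" for y
    using Quotient3_abs_rep[OF Quotient3_p1, of y] Quotient3_rep_reflp[OF Quotient3_p1, of y]
    by blast
  then have "(\<lambda>i. rep_p1 (x i)) \<in> hom_coords x"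
    by (simp add: hom_coords_def)
  then show ?thesis by blast
qed

lemma hom_coords_scale:
  assumes "v \<in> hom_coords x" "w \<in> hom_coords x"
  shows "\<exists>c. (\<forall>i. c i \<noteq> 0) \<and> w = (\<lambda>i. c i *s v i)"
proof -
  have "\<exists>c. c \<noteq> 0 \<and> w i = c *s v i" for i
  proof -
    have nz: "v i \<noteq> 0" "w i \<noteq> 0" and eq: "abs_p1 (v i) = abs_p1 (w i)"
      using assms by (auto simp: hom_coords_def)
    have r: "u \<noteq> 0 \<and> u \<noteq> 0 \<and> (\<exists>c. c \<noteq> 0 \<and> u = c *s u)" if "u \<noteq> 0" for u :: "complex ^ 2"
      using that by (auto intro!: exI[of _ 1])
    show ?thesis
      using Quotient3_rel[OF Quotient3_p1, of "v i" "w i"] r[OF nz(1)] r[OF nz(2)] eq by blast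
  qed
  then obtain c where "\<And>i. c i \<noteq> 0 \<and> w i = c i *s v i" by metis
  then show ?thesis by (intro exI[of _ c]) auto
qed

lemma poly_eval_scale:
  assumes "multihomogeneous d p"
  shows "poly_eval (coord_fun (\<lambda>i. c i *s v i)) p
    = (\<Prod>i\<in>UNIV. c i ^ d i) * poly_eval (coord_fun v) p"
proof -
  have "monom_eval (coord_fun (\<lambda>i. c i *s v i)) m
      = (\<Prod>i\<in>UNIV. c i ^ d i) * monom_eval (coord_fun v) m"
    if "m \<in> Poly_Mapping.keys p" for m
  proof -
    have d: "d = multidegree m"
      using that assms by (auto simp: multihomogeneous_def)
    have "(\<Prod>z\<in>UNIV. (case z of (i, j) \<Rightarrow> c i) ^ Poly_Mapping.lookup m z)
        = (\<Prod>i\<in>UNIV. \<Prod>j\<in>UNIV. c i ^ Poly_Mapping.lookup m (i, j))"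
      by (simp add: prod.cartesian_product split_def)
    also have "\<dots> = (\<Prod>i\<in>UNIV. c i ^ d i)"
      by (simp add: d multidegree_def power_sum)
    finally show ?thesis
      by (simp add: monom_eval_superset[of UNIV] split_def power_mult_distrib prod.distrib)
  qed
  then show ?thesis
    by (simp add: poly_eval_def sum_distrib_left algebra_simps)
qed

lemma vanishes_at_iff:
  assumes "multihomogeneous d p" "v \<in> hom_coords x"
  shows "vanishes_at p x \<longleftrightarrow> poly_eval (coord_fun v) p = 0"
proof
  assume v: "poly_eval (coord_fun v) p = 0"
  show "vanishes_at p x" unfolding vanishes_at_def
  proof
    fix w assume "w \<in> hom_coords x"
    then obtain c where "w = (\<lambda>i. c i *s v i)"
      using hom_coords_scale[OF assms(2)] by blast
    then show "poly_eval (coord_fun w) p = 0"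
      using v poly_eval_scale[OF assms(1), of c v] by simp
  qed
qed (use assms(2) in \<open>auto simp: vanishes_at_def\<close>)

definition zero_locus :: "(3 \<times> 2) cpoly set \<Rightarrow> point set" where
  "zero_locus S = {x. \<forall>p\<in>S. vanishes_at p x}"

definition algebraic_set :: "point set \<Rightarrow> bool" where
  "algebraic_set Z \<longleftrightarrow> (\<exists>S. (\<forall>p\<in>S. \<exists>d. multihomogeneous d p) \<and> Z = zero_locus S)"

definition zariski :: "point topology" where
  "zariski = topology (\<lambda>U. algebraic_set (- U))"

lemma algebraic_set_Un:
  assumes "algebraic_set Y" "algebraic_set Z"
  shows "algebraic_set (Y \<union> Z)"
proof -
  obtain S T where S: "\<forall>p\<in>S. \<exists>d. multihomogeneous d p" "Y = zero_locus S"
    and T: "\<forall>p\<in>T. \<exists>d. multihomogeneous d p" "Z = zero_locus T"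
    using assms by (auto simp: algebraic_set_def)
  let ?R = "{p * q |p q. p \<in> S \<and> q \<in> T}"
  have "\<forall>r\<in>?R. \<exists>d. multihomogeneous d r"
    using S(1) T(1) multihomogeneous_mult by blast
  moreover have "Y \<union> Z = zero_locus ?R"
  proof (intro equalityI subsetI)
    fix x assume "x \<in> Y \<union> Z"
    then show "x \<in> zero_locus ?R"
      by (auto simp: S(2) T(2) zero_locus_def vanishes_at_def poly_eval_mult)
  next
    fix x assume x: "x \<in> zero_locus ?R"
    obtain v where v: "v \<in> hom_coords x" using hom_coords_nonempty by blast
    show "x \<in> Y \<union> Z"
    proof (rule ccontr)
      assume "x \<notin> Y \<union> Z"
      then obtain p q where p: "p \<in> S" "\<not> vanishes_at p x" and q: "q \<in> T" "\<not> vanishes_at q x"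
        by (auto simp: S(2) T(2) zero_locus_def)
      then have "poly_eval (coord_fun v) p \<noteq> 0" "poly_eval (coord_fun v) q \<noteq> 0"
        using S(1) T(1) v vanishes_at_iff by blast+
      moreover have "vanishes_at (p * q) x"
        using x p(1) q(1) by (auto simp: zero_locus_def)
      ultimately show False
        using v by (auto simp: vanishes_at_def poly_eval_mult)
    qed
  qed
  ultimately show ?thesis unfolding algebraic_set_def by blast
qed

lemma algebraic_set_Inter:
  assumes "\<And>Z. Z \<in> \<Z> \<Longrightarrow> algebraic_set Z"
  shows "algebraic_set (\<Inter>\<Z>)"
proof -
  obtain S where "\<And>Z. Z \<in> \<Z> \<Longrightarrow> (\<forall>p\<in>S Z. \<exists>d. multihomogeneous d p) \<and> Z = zero_locus (S Z)"
    using assms unfolding algebraic_set_def by metis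
  then show ?thesis
    unfolding algebraic_set_def zero_locus_def
    by (intro exI[of _ "\<Union>(S ` \<Z>)"] conjI) (blast, blast)
qed

lemma openin_zariski: "openin zariski U \<longleftrightarrow> algebraic_set (- U)"
proof -
  have "istopology (\<lambda>U. algebraic_set (- U))"
    unfolding istopology_def
  proof (intro conjI allI impI)
    fix S T :: "point set"
    assume "algebraic_set (- S)" "algebraic_set (- T)"
    then show "algebraic_set (- (S \<inter> T))"
      using algebraic_set_Un by (simp add: Compl_Int)
  next
    fix \<K> :: "point set set"
    assume "\<forall>K\<in>\<K>. algebraic_set (- K)"
    then have "algebraic_set (\<Inter>(uminus ` \<K>))"
      by (intro algebraic_set_Inter) auto
    then show "algebraic_set (- \<Union>\<K>)"
      by (metis uminus_Sup)
  qed
  then show ?thesis by (simp add: zariski_def)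
qed

lemma topspace_zariski [simp]: "topspace zariski = UNIV"
proof -
  have "algebraic_set {}"
    unfolding algebraic_set_def
  proof (intro exI conjI)
    show "\<forall>p\<in>{1 :: (3 \<times> 2) cpoly}. \<exists>d. multihomogeneous d p"
      by (auto simp: multihomogeneous_def)
    have "poly_eval a 1 = 1" for a :: "3 \<times> 2 \<Rightarrow> complex"
      by (simp add: poly_eval_def monom_eval_def)
    then show "{} = zero_locus {1}"
      using hom_coords_nonempty by (auto simp: zero_locus_def vanishes_at_def)
  qed
  then have "openin zariski UNIV" by (simp add: openin_zariski)
  then show ?thesis using openin_subset by blast
qed

abbreviation zariski_on :: "point set \<Rightarrow> point topology" where
  "zariski_on X \<equiv> subtopology zariski X"

text \<open>Regular functions on an open subset \<open>U\<close> of \<open>X\<close>: locally quotients of multihomogeneous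
  polynomials of equal multidegree. Only the values on \<open>U\<close> matter.\<close>

definition regular_on :: "point set \<Rightarrow> point set \<Rightarrow> (point \<Rightarrow> complex) \<Rightarrow> bool" where
  "regular_on X U f \<longleftrightarrow> (\<forall>x\<in>U. \<exists>V. openin (zariski_on X) V \<and> x \<in> V \<and> V \<subseteq> U \<and>
     (\<exists>d p q. multihomogeneous d p \<and> multihomogeneous d q \<and>
        (\<forall>y\<in>V. \<forall>v\<in>hom_coords y. poly_eval (coord_fun v) q \<noteq> 0 \<and>
           f y = poly_eval (coord_fun v) p / poly_eval (coord_fun v) q)))"

definition variety_morphism :: "point set \<Rightarrow> point set \<Rightarrow> (point \<Rightarrow> point) \<Rightarrow> bool" where
  "variety_morphism X Y f \<longleftrightarrow> continuous_map (zariski_on X) (zariski_on Y) f \<and>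
     (\<forall>V g. openin (zariski_on Y) V \<longrightarrow> regular_on Y V g \<longrightarrow> regular_on X {x\<in>X. f x \<in> V} (g \<circ> f))"

definition Aut :: "point set \<Rightarrow> (point \<Rightarrow> point) monoid" where
  "Aut X = (BijGroup X)\<lparr>carrier :=
     {f \<in> Bij X. variety_morphism X X f \<and> variety_morphism X X (inv_into X f)}\<rparr>"

lemma variety_morphism_cong:
  assumes "\<And>x. x \<in> X \<Longrightarrow> f x = g x" "variety_morphism X Y f"
  shows "variety_morphism X Y g"
proof -
  have "continuous_map (zariski_on X) (zariski_on Y) g"
    using assms continuous_map_eq[of "zariski_on X" "zariski_on Y" f g]
    by (auto simp: variety_morphism_def)
  moreover have "regular_on X {x\<in>X. g x \<in> V} (h \<circ> g)"
    if V: "openin (zariski_on Y) V" "regular_on Y V h" for V h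
  proof -
    have eq: "{x\<in>X. g x \<in> V} = {x\<in>X. f x \<in> V}" using assms(1) by auto
    have reg: "regular_on X {x\<in>X. f x \<in> V} (h \<circ> f)"
      using assms(2) V by (auto simp: variety_morphism_def)
    show ?thesis unfolding eq unfolding regular_on_def
    proof
      fix x assume "x \<in> {x \<in> X. f x \<in> V}"
      then obtain W d p q where W: "openin (zariski_on X) W" "x \<in> W" "W \<subseteq> {x \<in> X. f x \<in> V}"
        "multihomogeneous d p" "multihomogeneous d q"
        "\<forall>y\<in>W. \<forall>v\<in>hom_coords y. poly_eval (coord_fun v) q \<noteq> 0 \<and>
           (h \<circ> f) y = poly_eval (coord_fun v) p / poly_eval (coord_fun v) q"
        using reg unfolding regular_on_def by meson
      have "\<forall>y\<in>W. (h \<circ> g) y = (h \<circ> f) y" using W(3) assms(1) by auto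
      then show "\<exists>V'. openin (zariski_on X) V' \<and> x \<in> V' \<and> V' \<subseteq> {x \<in> X. f x \<in> V} \<and>
          (\<exists>d p q. multihomogeneous d p \<and> multihomogeneous d q \<and>
            (\<forall>y\<in>V'. \<forall>v\<in>hom_coords y. poly_eval (coord_fun v) q \<noteq> 0 \<and>
              (h \<circ> g) y = poly_eval (coord_fun v) p / poly_eval (coord_fun v) q))"
        using W by (intro exI[of _ W] conjI exI[of _ d] exI[of _ p] exI[of _ q]) auto
    qed
  qed
  ultimately show ?thesis by (simp add: variety_morphism_def)
qed

lemma variety_morphism_id: "variety_morphism X X (\<lambda>x. x)"
  unfolding variety_morphism_def
proof (intro conjI allI impI)
  fix V g assume V: "openin (zariski_on X) V" "regular_on X V g"
  then have "{x \<in> X. x \<in> V} = V" using openin_subset by fastforce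
  then show "regular_on X {x \<in> X. x \<in> V} (g \<circ> (\<lambda>x. x))" using V(2) by (simp add: comp_def)
qed simp

lemma variety_morphism_comp:
  assumes f: "variety_morphism X Y f" and g: "variety_morphism Y Z g"
  shows "variety_morphism X Z (g \<circ> f)"
  unfolding variety_morphism_def
proof (intro conjI allI impI)
  show "continuous_map (zariski_on X) (zariski_on Z) (g \<circ> f)"
    using f g by (intro continuous_map_compose[of _ "zariski_on Y"]) (auto simp: variety_morphism_def)
  fix V h assume V: "openin (zariski_on Z) V" "regular_on Z V h"
  have "openin (zariski_on Y) {y \<in> Y. g y \<in> V}"
    using g V(1) by (auto simp: variety_morphism_def continuous_map_def)
  moreover have "regular_on Y {y \<in> Y. g y \<in> V} (h \<circ> g)"
    using g V by (auto simp: variety_morphism_def)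
  ultimately have *: "regular_on X {x \<in> X. f x \<in> {y \<in> Y. g y \<in> V}} (h \<circ> g \<circ> f)"
    by (rule f[unfolded variety_morphism_def, THEN conjunct2, rule_format])
  have "f x \<in> Y" if "x \<in> X" for x
    using f that by (auto simp: variety_morphism_def continuous_map_def)
  then have eq: "{x \<in> X. f x \<in> {y \<in> Y. g y \<in> V}} = {x \<in> X. (g \<circ> f) x \<in> V}" by auto
  show "regular_on X {x \<in> X. (g \<circ> f) x \<in> V} (h \<circ> (g \<circ> f))"
    using *[unfolded eq] by (simp only: comp_assoc)
qed

lemma group_Aut: "group (Aut X)"
proof -
  interpret B: group "BijGroup X" by (rule group_BijGroup)
  let ?A = "{f \<in> Bij X. variety_morphism X X f \<and> variety_morphism X X (inv_into X f)}"
  have inv: "inv\<^bsub>BijGroup X\<^esub> f = restrict (inv_into X f) X" if "f \<in> Bij X" for f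
    using that by (rule inv_BijGroup)
  have "subgroup ?A (BijGroup X)"
  proof (rule B.subgroupI)
    show "?A \<subseteq> carrier (BijGroup X)" by (auto simp: BijGroup_def)
    have "(\<lambda>x\<in>X. x) \<in> ?A"
    proof (intro CollectI conjI)
      show "(\<lambda>x\<in>X. x) \<in> Bij X" by (rule id_Bij)
      show "variety_morphism X X (\<lambda>x\<in>X. x)"
        by (rule variety_morphism_cong[OF _ variety_morphism_id]) simp
      have "inv_into X (\<lambda>x\<in>X. x) x = x" if "x \<in> X" for x
        using that by (intro inv_into_f_eq) (auto simp: inj_on_def)
      then show "variety_morphism X X (inv_into X (\<lambda>x\<in>X. x))"
        by (intro variety_morphism_cong[OF _ variety_morphism_id]) simp
    qed
    then show "?A \<noteq> {}" by blast
  next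
    fix f assume f: "f \<in> ?A"
    then have fB: "f \<in> Bij X" and bij: "bij_betw f X X" by (auto simp: Bij_def)
    have "variety_morphism X X (restrict (inv_into X f) X)"
      by (rule variety_morphism_cong[of _ "inv_into X f"]) (use f in auto)
    moreover have "f x = inv_into X (restrict (inv_into X f) X) x" if "x \<in> X" for x
    proof (rule sym, rule inv_into_f_eq)
      show "inj_on (restrict (inv_into X f) X) X"
        using bij_betw_inv_into[OF bij] by (simp add: bij_betw_def)
      show fx: "f x \<in> X" using bij that by (auto simp: bij_betw_def)
      show "restrict (inv_into X f) X (f x) = x"
        using bij that fx by (simp add: bij_betw_inv_into_left)
    qed
    then have "variety_morphism X X (inv_into X (restrict (inv_into X f) X))"
      by (rule variety_morphism_cong) (use f in auto)
    ultimately show "inv\<^bsub>BijGroup X\<^esub> f \<in> ?A"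
      using restrict_inv_into_Bij[OF fB] by (simp add: inv[OF fB])
  next
    fix f g assume fg: "f \<in> ?A" "g \<in> ?A"
    then have B: "f \<in> Bij X" "g \<in> Bij X" by auto
    then have bij: "bij_betw f X X" "bij_betw g X X" by (auto simp: Bij_def)
    have mor: "variety_morphism X X (f \<circ> g)"
      and inv_mor: "variety_morphism X X (inv_into X g \<circ> inv_into X f)"
      using fg by (blast intro: variety_morphism_comp)+
    have "variety_morphism X X (compose X f g)"
      by (rule variety_morphism_cong[OF _ mor]) (simp add: compose_def)
    moreover have "(inv_into X g \<circ> inv_into X f) x = inv_into X (compose X f g) x"
      if "x \<in> X" for x
    proof (rule sym, rule inv_into_f_eq)
      show "inj_on (compose X f g) X"
        using compose_Bij[OF B] by (auto simp: Bij_def bij_betw_def)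
      have *: "inv_into X f x \<in> X" using bij(1) that by (metis bij_betw_def inv_into_into)
      then show **: "(inv_into X g \<circ> inv_into X f) x \<in> X"
        using bij(2) by (metis bij_betw_def inv_into_into comp_apply)
      show "compose X f g ((inv_into X g \<circ> inv_into X f) x) = x"
        using * ** bij that by (simp add: compose_def bij_betw_inv_into_right)
    qed
    then have "variety_morphism X X (inv_into X (compose X f g))"
      by (rule variety_morphism_cong[OF _ inv_mor])
    ultimately show "f \<otimes>\<^bsub>BijGroup X\<^esub> g \<in> ?A"
      using B compose_Bij[OF B] by (simp add: BijGroup_def)
  qed
  then show ?thesis
    unfolding Aut_def by (rule subgroup.subgroup_is_group) (rule group_BijGroup)
qed

definition sections_L :: "(3 \<times> 2) cpoly set" where
  "sections_L = {P. multihomogeneous (\<lambda>_. 2) P}"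

text \<open>A member of \<open>|L|\<close> is a nonzero section up to nonzero scalars; multiplication by
  \<open>Poly_Mapping.single 0 c\<close> is scalar multiplication by \<open>c\<close>.\<close>

definition linear_system_L :: "(3 \<times> 2) cpoly set set" where
  "linear_system_L = {{Poly_Mapping.single 0 c * P |c. c \<noteq> 0} |P. P \<in> sections_L \<and> P \<noteq> 0}"

text \<open>The homogeneous coordinates on \<open>|L|\<close> are the 27 coefficients of an equation, so they are
  indexed by the monomials of multidegree (2,2,2). Accordingly a hypersurface is given by a
  homogeneous polynomial \<open>F\<close> whose variables are these monomials.\<close>

definition hypersurface_L :: "(3 \<times> 2) cpoly set set \<Rightarrow> bool" where
  "hypersurface_L H \<longleftrightarrow> (\<exists>(F :: (3 \<times> 2 \<Rightarrow>\<^sub>0 nat) cpoly) d. d > 0 \<and> F \<noteq> 0 \<and> homogeneous d F \<and>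
     (\<forall>\<mu>\<in>Poly_Mapping.keys F. Poly_Mapping.keys \<mu> \<subseteq> {m. multidegree m = (\<lambda>_. 2)}) \<and>
     H = {D \<in> linear_system_L. \<forall>P\<in>D. poly_eval (Poly_Mapping.lookup P) F = 0})"

definition surface :: "(3 \<times> 2) cpoly set \<Rightarrow> point set" where
  "surface D = zero_locus D"

text \<open>Smoothness by the Jacobian criterion, applied to the equation (hence scheme-theoretic:
  non-reduced members are not smooth). By Euler's relation in each factor, at a zero of the
  equation the six homogeneous partial derivatives all vanish iff the three partial derivatives
  in an affine chart do.\<close>

definition partial_deriv :: "(3 \<times> 2) cpoly \<Rightarrow> 3 \<times> 2 \<Rightarrow> (3 \<times> 2 \<Rightarrow> complex) \<Rightarrow> complex" where
  "partial_deriv P k a = deriv (\<lambda>t. poly_eval (a(k := t)) P) (a k)"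

definition wehler :: "(3 \<times> 2) cpoly set \<Rightarrow> bool" where
  "wehler D \<longleftrightarrow> D \<in> linear_system_L \<and>
     (\<forall>P\<in>D. \<forall>x\<in>surface D. \<forall>v\<in>hom_coords x. \<exists>k. partial_deriv P k (coord_fun v) \<noteq> 0)"

definition very_general_wehler :: "(point set \<Rightarrow> bool) \<Rightarrow> bool" where
  "very_general_wehler Q \<longleftrightarrow> (\<exists>\<H>. countable \<H> \<and> (\<forall>H\<in>\<H>. hypersurface_L H) \<and>
     (\<forall>D \<in> linear_system_L - \<Union>\<H>. wehler D \<longrightarrow> Q (surface D)))"

definition zariski_dense_in :: "point set \<Rightarrow> point set \<Rightarrow> bool" where
  "zariski_dense_in A X \<longleftrightarrow> zariski_on X closure_of A = X"

end

theory Submission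
  imports Defs "HOL-Algebra.Finite_Extensions" "HOL-Computational_Algebra.Polynomial_Factorial"
    "HOL-Computational_Algebra.Field_as_Ring"
begin

text \<open>The equation of a very general surface can be scaled so that its 27 coefficients are algebraically
  independent over the rationals; all that is used of this is that they are not contained in the
  algebraic closure of a field generated by 26 numbers. Every exceptional configuration is excluded by
  counting parameters in coordinates centred at a point of the surface.

  The two involutions preserving a coordinate act on a fibre, a curve of bidegree (2,2). If such a
  curve has a finite orbit at the origin and is smooth there, its four interior coefficients are
  algebraically dependent over the other ones, because the orbit is infinite for the special curves on
  which the involutions are affine. Applied to the three fibres through a point this gives three
  independent conditions, so no point has a finite orbit in each of its three fibres. If a polynomial
  vanishes on an orbit but not on the surface, then, all fibres being irreducible, the orbit is
  infinite in only finitely many fibres and hence some fibre contains infinitely many points that one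
  involution maps into a single other fibre, which a parameter count excludes as well.\<close>

hide_const (open) up_ring.coeff up_ring.monom Polynomials.degree Polynomials.lead_coeff module.smult
  Divisibility.irreducible Divisibility.prime

no_notation Polynomials.var (\<open>X\<index>\<close>)

subsection \<open>Algebraic closure in the complex numbers\<close>

text \<open>A point of the surface costs three parameters, one per coordinate, and in a frame
  centred at it one coefficient, the constant one, vanishes; so three further conditions already
  exceed the budget. The length of a finite orbit is not bounded in advance, hence no single
  polynomial condition on a curve expresses finiteness. This is why genericity is phrased by
  algebraic closure: if no interior coefficient of a (2,2) curve is algebraic over the remaining
  coefficients, a coincidence between two orbit points is a polynomial identity in the interior
  coefficients and must survive on a special curve, which refutes all lengths at once. A fibre that
  is singular at the point escapes this argument, because both involutions fix the point there. But
  then two linear coefficients vanish, each of which is a condition of its own, and the count still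
  closes.\<close>

definition complex_subfield :: "complex set \<Rightarrow> bool" where
  "complex_subfield K \<longleftrightarrow> 1 \<in> K \<and> (\<forall>x\<in>K. \<forall>y\<in>K. x - y \<in> K \<and> x * y \<in> K) \<and> (\<forall>x\<in>K. inverse x \<in> K)"

text \<open>\<open>K\<close> may be any set of numbers: besides fields, rings of polynomial values
  are inserted once denominators have been cleared.\<close>

definition algebraic_over :: "complex set \<Rightarrow> complex \<Rightarrow> bool" where
  "algebraic_over K z \<longleftrightarrow> (\<exists>p. p \<noteq> 0 \<and> (\<forall>i. coeff p i \<in> K) \<and> poly p z = 0)"

text \<open>A bridge to HOL-Algebra, whose theory of finite extensions supplies the closure of
  algebraic elements under field operations and the dimension argument for transitivity.\<close>

definition complex_ring :: "complex ring" where
  "complex_ring = \<lparr>carrier = UNIV, mult = (*), one = 1, zero = 0, add = (+)\<rparr>"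

lemma complex_ring_simps [simp]:
  "carrier complex_ring = UNIV" "\<one>\<^bsub>complex_ring\<^esub> = 1" "\<zero>\<^bsub>complex_ring\<^esub> = 0"
  "x \<otimes>\<^bsub>complex_ring\<^esub> y = x * y" "x \<oplus>\<^bsub>complex_ring\<^esub> y = x + y"
  by (simp_all add: complex_ring_def)

lemma cring_complex_ring: "cring complex_ring"
  by (rule cringI)
    (auto intro!: abelian_groupI comm_monoidI simp: algebra_simps, metis add.right_inverse add.commute)

lemma field_complex_ring: "Ring.field complex_ring"
proof (rule cring.cring_fieldI2[OF cring_complex_ring])
  fix a :: complex assume "a \<noteq> \<zero>\<^bsub>complex_ring\<^esub>"
  then show "\<exists>b\<in>carrier complex_ring. a \<otimes>\<^bsub>complex_ring\<^esub> b = \<one>\<^bsub>complex_ring\<^esub>"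
    by (auto intro!: exI[of _ "inverse a"])
qed simp

interpretation C: domain complex_ring by (rule field.axioms(1)[OF field_complex_ring])

lemma C_minus [simp]: "\<ominus>\<^bsub>complex_ring\<^esub> x = - x"
  by (rule C.minus_equality) auto

lemma C_inv: "x \<noteq> 0 \<Longrightarrow> inv\<^bsub>complex_ring\<^esub> x = inverse x"
  by (rule C.comm_inv_char) auto

lemma C_nat_pow [simp]: "x [^]\<^bsub>complex_ring\<^esub> (n :: nat) = x ^ n"
  by (induction n) auto

lemma subfield_complex_ring_iff: "subfield K complex_ring \<longleftrightarrow> complex_subfield K"
proof
  assume K: "subfield K complex_ring"
  note r = subringE[OF subfieldE(1)[OF K], simplified]
  have "x - y \<in> K" if "x \<in> K" "y \<in> K" for x y
    using r(7)[OF that(1) r(5)[OF that(2)]] by simp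
  moreover have "inverse x \<in> K" if "x \<in> K" for x
  proof (cases "x = 0")
    case False
    then show ?thesis using C.subfield_m_inv(1)[OF K, of x] that by (simp add: C_inv)
  qed (use r in auto)
  ultimately show "complex_subfield K"
    using r by (auto simp: complex_subfield_def)
next
  assume K: "complex_subfield K"
  then have 0: "0 \<in> K" by (metis complex_subfield_def diff_self)
  then have m: "- x \<in> K" if "x \<in> K" for x
    using K 0 that unfolding complex_subfield_def by (metis diff_0)
  have a: "x + y \<in> K" if "x \<in> K" "y \<in> K" for x y
    using K that(1) m[OF that(2)] by (metis complex_subfield_def diff_minus_eq_add)
  show "subfield K complex_ring"
  proof (rule field.subfieldI'[OF field_complex_ring])
    show "subring K complex_ring"
      by (rule C.subringI) (use K m a in \<open>auto simp: complex_subfield_def\<close>)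
    fix k assume "k \<in> K - {\<zero>\<^bsub>complex_ring\<^esub>}"
    then show "inv\<^bsub>complex_ring\<^esub> k \<in> K"
      using K by (simp add: C_inv complex_subfield_def)
  qed
qed

lemma poly_Poly_snoc: "poly (Poly (xs @ [a])) (x :: complex) = poly (Poly xs) x + a * x ^ length xs"
  by (induction xs) (auto simp: algebra_simps)

text \<open>The coefficient lists of HOL-Algebra start with the leading coefficient, whereas
  \<open>Poly\<close> expects the constant term first; hence the reversal.\<close>

lemma C_eval: "C.eval p x = poly (Poly (rev p)) x"
  by (induction p) (auto simp: poly_Poly_snoc)

lemma algebraic_over_iff:
  assumes "complex_subfield K"
  shows "algebraic_over K z \<longleftrightarrow> (C.algebraic over K) z"
proof
  have sf: "subfield K complex_ring" and sr: "subring K complex_ring"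
    using assms by (auto simp: subfield_complex_ring_iff[symmetric] subfieldE)
  have 0: "0 \<in> K" using subringE(2)[OF sr] by simp
  show "(C.algebraic over K) z" if z: "algebraic_over K z"
  proof -
    obtain p where p: "p \<noteq> 0" "\<And>i. coeff p i \<in> K" "poly p z = 0"
      using z by (auto simp: algebraic_over_def)
    have "rev (coeffs p) \<noteq> []" using p by simp
    moreover have "C.eval (rev (coeffs p)) z = \<zero>\<^bsub>complex_ring\<^esub>"
      using p by (simp add: C_eval)
    moreover have "rev (coeffs p) \<in> carrier (K[X]\<^bsub>complex_ring\<^esub>)"
      using p by (auto simp: univ_poly_def polynomial_def coeffs_def hd_rev last_map)
    ultimately show ?thesis by (intro C.algebraicI)
  qed
  show "algebraic_over K z" if z: "(C.algebraic over K) z"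
  proof -
    obtain p where p: "p \<in> carrier (K[X]\<^bsub>complex_ring\<^esub>)" "p \<noteq> []" "C.eval p z = \<zero>\<^bsub>complex_ring\<^esub>"
      using C.algebraicE[OF sr _ z] by auto
    have "set p \<subseteq> K" "hd p \<noteq> 0" using p by (auto simp: univ_poly_def polynomial_def)
    have "coeff (Poly (rev p)) i \<in> K" for i
      using \<open>set p \<subseteq> K\<close> 0 by (auto simp: coeff_Poly_eq nth_default_def rev_nth)
    moreover have "coeff (Poly (rev p)) (length p - 1) = hd p"
      using p(2) by (simp add: coeff_Poly_eq nth_default_def rev_nth hd_conv_nth)
    moreover have "Poly (rev p) \<noteq> 0"
      using calculation(2) \<open>hd p \<noteq> 0\<close> by (metis coeff_0)
    ultimately show ?thesis using p(3) unfolding algebraic_over_def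
      by (intro exI[of _ "Poly (rev p)"]) (simp add: C_eval)
  qed
qed

lemma complex_subfield_algebraic_over:
  assumes "complex_subfield K"
  shows "complex_subfield {z. algebraic_over K z}"
  using field.subfield_of_algebraics[OF field_complex_ring, of K] assms
  by (simp add: algebraic_over_iff subfield_complex_ring_iff)

lemma algebraic_over_self: "complex_subfield K \<Longrightarrow> z \<in> K \<Longrightarrow> algebraic_over K z"
  using C.algebraic_self[of K z]
  by (simp add: algebraic_over_iff subfield_complex_ring_iff[symmetric] subfieldE)

text \<open>An equation of \<open>z\<close> has only finitely many coefficients. They generate a
  finite extension \<open>?F\<close> of \<open>K\<close>, \<open>z\<close> is finite over
  \<open>?F\<close>, and finiteness is preserved in towers.\<close>

lemma algebraic_over_trans:
  assumes K: "complex_subfield K" and z: "algebraic_over {w. algebraic_over K w} z"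
  shows "algebraic_over K z"
proof -
  have sf: "subfield K complex_ring" using K by (simp add: subfield_complex_ring_iff)
  obtain p where p: "p \<noteq> 0" "\<And>i. algebraic_over K (coeff p i)" "poly p z = 0"
    using z by (auto simp: algebraic_over_def)
  let ?F = "C.finite_extension K (coeffs p)"
  have alg: "\<And>x. x \<in> set (coeffs p) \<Longrightarrow> (C.algebraic over K) x"
    using p(2) by (auto simp: coeffs_def algebraic_over_iff[OF K, symmetric] split: if_splits)
  have F: "subfield ?F complex_ring" "C.finite_dimension K ?F"
    using C.finite_extension_is_subfield[OF sf _ alg] C.finite_extension_finite_dimension(1)[OF sf _ alg]
    by auto
  have F': "complex_subfield ?F" using F by (simp add: subfield_complex_ring_iff)
  have "coeff p i \<in> ?F" for i
  proof (cases "coeff p i = 0")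
    case True
    then show ?thesis using subringE(2)[OF subfieldE(1)[OF F(1)]] by simp
  next
    case False
    then have "coeff p i \<in> set (coeffs p)" using range_coeff[of p] by auto
    then show ?thesis
      using C.finite_extension_mem[OF subfieldE(1)[OF sf], of "coeffs p"] by auto
  qed
  then have "algebraic_over ?F z" using p by (auto simp: algebraic_over_def)
  then have z: "(C.algebraic over ?F) z" unfolding algebraic_over_iff[OF F'] .
  have "C.finite_dimension ?F (C.simple_extension ?F z)"
    using C.finite_dimension_simple_extension[OF F(1), of z] z by simp
  then have "C.finite_dimension K (C.simple_extension ?F z)"
    by (rule C.telescopic_base_dim(1)[OF sf F])
  then have "(C.algebraic over K) z"
    using C.finite_dimension_imp_algebraic[OF sf C.simple_extension_is_subring[OF subfieldE(1)[OF F(1)]]]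
      C.simple_extension_mem[OF subfieldE(1)[OF F(1)]] by auto
  then show ?thesis by (simp add: algebraic_over_iff[OF K])
qed


text \<open>The algebraic closure in C of the field generated by \<open>S\<close>; all parameter
  counts are statements about it. Zero and sums come from \<open>diff\<close>, and the convention
  \<open>inverse 0 = 0\<close> keeps \<open>inv\<close> unconditional.\<close>

inductive_set acl :: "complex set \<Rightarrow> complex set" for S where
  base: "z \<in> S \<Longrightarrow> z \<in> acl S"
| one: "1 \<in> acl S"
| diff: "x \<in> acl S \<Longrightarrow> y \<in> acl S \<Longrightarrow> x - y \<in> acl S"
| mult: "x \<in> acl S \<Longrightarrow> y \<in> acl S \<Longrightarrow> x * y \<in> acl S"
| inv: "x \<in> acl S \<Longrightarrow> inverse x \<in> acl S"
| root: "p \<noteq> 0 \<Longrightarrow> (\<And>i. coeff p i \<in> acl S) \<Longrightarrow> poly p z = 0 \<Longrightarrow> z \<in> acl S"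

lemma acl_subset: "S \<subseteq> acl S"
  by (auto intro: acl.base)

lemma complex_subfield_acl: "complex_subfield (acl S)"
  by (auto simp: complex_subfield_def intro: acl.intros)

lemma acl_least:
  assumes "complex_subfield K" "\<And>z. algebraic_over K z \<Longrightarrow> z \<in> K" "S \<subseteq> K"
  shows "acl S \<subseteq> K"
proof
  fix z assume "z \<in> acl S"
  then show "z \<in> K"
  proof induction
    case (root p z)
    then show ?case by (intro assms(2)) (auto simp: algebraic_over_def)
  qed (use assms in \<open>auto simp: complex_subfield_def\<close>)
qed

lemma acl_root_closed: "algebraic_over (acl S) z \<Longrightarrow> z \<in> acl S"
  by (auto simp: algebraic_over_def intro: acl.root)

lemma acl_minimal: "S \<subseteq> acl T \<Longrightarrow> acl S \<subseteq> acl T"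
  by (intro acl_least complex_subfield_acl acl_root_closed)

lemma acl_mono: "S \<subseteq> T \<Longrightarrow> acl S \<subseteq> acl T"
  using acl_minimal acl_subset by blast

lemma acl_zero [simp]: "0 \<in> acl S"
  using acl.diff[OF acl.one acl.one] by simp

lemma acl_minus: "x \<in> acl S \<Longrightarrow> - x \<in> acl S"
  using acl.diff[OF acl_zero, of x] by simp

lemma acl_add: "x \<in> acl S \<Longrightarrow> y \<in> acl S \<Longrightarrow> x + y \<in> acl S"
  using acl.diff[OF _ acl_minus, of x S y] by simp

lemma acl_divide: "x \<in> acl S \<Longrightarrow> y \<in> acl S \<Longrightarrow> x / y \<in> acl S"
  by (simp add: divide_inverse acl.mult acl.inv)

lemma acl_power: "x \<in> acl S \<Longrightarrow> x ^ n \<in> acl S"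
  by (induction n) (auto intro: acl.one acl.mult)

lemma acl_sum: "(\<And>i. i \<in> A \<Longrightarrow> f i \<in> acl S) \<Longrightarrow> sum f A \<in> acl S"
  by (induction A rule: infinite_finite_induct) (auto intro: acl_add)

lemma acl_prod: "(\<And>i. i \<in> A \<Longrightarrow> f i \<in> acl S) \<Longrightarrow> prod f A \<in> acl S"
  by (induction A rule: infinite_finite_induct) (auto intro: acl.one acl.mult)

lemma acl_of_nat: "of_nat n \<in> acl S"
  by (induction n) (auto intro: acl.one acl_add)

section \<open>Clearing denominators and the exchange property\<close>

lemma complex_subfield_fractions:
  assumes R: "1 \<in> R" "\<And>x y. x \<in> R \<Longrightarrow> y \<in> R \<Longrightarrow> x - y \<in> R" "\<And>x y. x \<in> R \<Longrightarrow> y \<in> R \<Longrightarrow> x * y \<in> R"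
  shows "complex_subfield {a / b |a b. a \<in> R \<and> b \<in> R \<and> b \<noteq> 0}" (is "complex_subfield ?F")
  unfolding complex_subfield_def
proof (intro conjI ballI)
  have 0: "0 \<in> R" using R(2)[OF R(1) R(1)] by simp
  show "1 \<in> ?F" using R(1) by (intro CollectI exI[of _ 1]) simp
  fix x y assume "x \<in> ?F"
  then obtain a b where x: "x = a / b" "a \<in> R" "b \<in> R" "b \<noteq> 0" by blast
  show "inverse x \<in> ?F"
  proof (cases "a = 0")
    case True
    then show ?thesis using x R(1) 0 by (intro CollectI exI[of _ 0] exI[of _ 1] conjI) simp_all
  next
    case False
    then show ?thesis using x by (intro CollectI exI[of _ b] exI[of _ a] conjI) simp_all
  qed
  assume "y \<in> ?F"
  then obtain c d where y: "y = c / d" "c \<in> R" "d \<in> R" "d \<noteq> 0" by blast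
  show "x - y \<in> ?F"
    using x y R
    by (intro CollectI exI[of _ "a * d - c * b"] exI[of _ "b * d"] conjI) (simp_all add: diff_frac_eq)
  show "x * y \<in> ?F"
    using x y R by (intro CollectI exI[of _ "a * c"] exI[of _ "b * d"] conjI) simp_all
qed

lemma algebraic_over_fractions:
  assumes R: "1 \<in> R" "\<And>x y. x \<in> R \<Longrightarrow> y \<in> R \<Longrightarrow> x * y \<in> R"
    and z: "algebraic_over {a / b |a b. a \<in> R \<and> b \<in> R \<and> b \<noteq> 0} z"
  shows "algebraic_over R z"
proof -
  obtain p where p: "p \<noteq> 0" "\<And>i. \<exists>a b. coeff p i = a / b \<and> a \<in> R \<and> b \<in> R \<and> b \<noteq> 0" "poly p z = 0"
    using z unfolding algebraic_over_def by blast
  then obtain a b where ab: "\<And>i. coeff p i = a i / b i \<and> a i \<in> R \<and> b i \<in> R \<and> b i \<noteq> 0"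
    by metis
  define B where "B = (\<Prod>i\<le>degree p. b i)"
  have prod: "prod b I \<in> R" for I :: "nat set"
    by (induction I rule: infinite_finite_induct) (use R ab in auto)
  have coeff: "coeff (smult B p) i \<in> R" if "i \<le> degree p" for i
  proof -
    have "B = b i * (\<Prod>j\<in>{..degree p} - {i}. b j)"
      unfolding B_def using that by (intro prod.remove) auto
    then have "coeff (smult B p) i = a i * (\<Prod>j\<in>{..degree p} - {i}. b j)"
      using ab[of i] by simp
    then show ?thesis using R(2) ab prod by simp
  qed
  have "B \<noteq> 0" using ab by (simp add: B_def)
  show ?thesis
  proof (cases "0 \<in> R")
    case True
    have "coeff (smult B p) i \<in> R" for i
      using coeff[of i] True by (cases "i \<le> degree p") (auto simp: coeff_eq_0)
    then show ?thesis
      using \<open>B \<noteq> 0\<close> p unfolding algebraic_over_def by (intro exI[of _ "smult B p"]) auto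
  next
    case False
    \<comment> \<open>If 0 is not in \<open>R\<close>, no quotient of elements of \<open>R\<close>
      is 0, whereas the coefficients above the degree are; the case is void.\<close>
    then have "coeff p (Suc (degree p)) \<noteq> 0"
      using ab[of "Suc (degree p)"] by auto
    then show ?thesis by (simp add: coeff_eq_0)
  qed
qed

text \<open>An equation of \<open>z\<close> over the field generated by \<open>K\<close> and
  \<open>a\<close> can be given coefficients polynomial in \<open>a\<close>, and then read backwards
  as an equation of \<open>a\<close> over that of \<open>K\<close> and \<open>z\<close>. It could
  only fail by becoming trivial, which would make \<open>z\<close> algebraic over
  \<open>K\<close>.\<close>

theorem acl_exchange:
  assumes z: "z \<in> acl (insert a S)" "z \<notin> acl S"
  shows "a \<in> acl (insert z S)"
proof -
  define K where "K = acl S"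
  define R where "R = {poly p a |p. \<forall>i. coeff p i \<in> K}"
  define F where "F = {x / y |x y. x \<in> R \<and> y \<in> R \<and> y \<noteq> 0}"
  have R1: "x \<in> R" if "x \<in> K" for x
    using that unfolding R_def K_def by (intro CollectI exI[of _ "[:x:]"]) (auto simp: coeff_pCons split: nat.split)
  have R2: "x - y \<in> R" "x * y \<in> R" if xy: "x \<in> R" "y \<in> R" for x y
  proof -
    obtain p q where pq: "x = poly p a" "y = poly q a" "\<And>i. coeff p i \<in> K" "\<And>i. coeff q i \<in> K"
      using xy unfolding R_def by blast
    show "x - y \<in> R"
      using pq unfolding R_def K_def by (intro CollectI exI[of _ "p - q"]) (auto intro: acl.diff)
    show "x * y \<in> R"
      using pq unfolding R_def K_def
      by (intro CollectI exI[of _ "p * q"]) (auto simp: coeff_mult intro!: acl_sum acl.mult)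
  qed
  have "1 \<in> R" by (intro R1) (simp add: K_def acl.one)
  have "a \<in> R"
    unfolding R_def K_def
    by (intro CollectI exI[of _ "[:0, 1:]"]) (auto simp: coeff_pCons acl.one split: nat.split)
  have F: "complex_subfield F"
    unfolding F_def using \<open>1 \<in> R\<close> R2 by (intro complex_subfield_fractions)
  have RF: "R \<subseteq> F"
  proof
    fix x assume "x \<in> R"
    then show "x \<in> F"
      unfolding F_def using \<open>1 \<in> R\<close> by (intro CollectI exI[of _ x] exI[of _ 1]) simp
  qed
  have "insert a S \<subseteq> F"
    using RF \<open>a \<in> R\<close> R1 by (auto simp: K_def acl.base)
  then have "acl (insert a S) \<subseteq> {w. algebraic_over F w}"
    by (intro acl_least complex_subfield_algebraic_over[OF F])
      (auto intro: algebraic_over_trans[OF F] algebraic_over_self[OF F])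
  then have "algebraic_over R z"
    using z(1) algebraic_over_fractions[OF \<open>1 \<in> R\<close> R2(2)] unfolding F_def by blast
  then obtain p where p: "p \<noteq> 0" "\<And>i. \<exists>q. coeff p i = poly q a \<and> (\<forall>j. coeff q j \<in> K)" "poly p z = 0"
    unfolding algebraic_over_def R_def by blast
  then obtain q where q: "\<And>i. coeff p i = poly (q i) a" "\<And>i j. coeff (q i) j \<in> K" by metis
  obtain m where "coeff p m \<noteq> 0" using p(1) leading_coeff_0_iff by blast
  then have "q m \<noteq> 0" using q(1)[of m] by auto
  define G where "G = (\<Sum>i\<le>degree p. smult (z ^ i) (q i))"
  have "poly G a = 0"
    using p(3) by (simp add: G_def poly_sum poly_altdef[of p] q(1) mult.commute)
  moreover have "coeff G j \<in> acl (insert z S)" for j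
  proof -
    have "coeff (q i) j \<in> acl (insert z S)" for i
      using q(2)[of i j] acl_mono[of S "insert z S"] by (auto simp: K_def)
    then show ?thesis
      unfolding G_def coeff_sum coeff_smult
      using acl.base[of z "insert z S"] by (intro acl_sum acl.mult acl_power) auto
  qed
  moreover have "G \<noteq> 0"
  proof
    \<comment> \<open>The coefficient of \<open>G\<close> at \<open>j\<close> is the value at
      \<open>z\<close> of a polynomial \<open>h\<close> over \<open>K\<close>. The coefficient of
      \<open>h\<close> at \<open>m\<close> is the leading coefficient of \<open>q m\<close>, so
      \<open>h\<close> is a nontrivial equation of \<open>z\<close>.\<close>
    assume "G = 0"
    define j where "j = degree (q m)"
    have "m \<le> degree p" using \<open>coeff p m \<noteq> 0\<close> by (rule le_degree)
    define h where "h = (\<Sum>i\<le>degree p. monom (coeff (q i) j) i)"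
    have "coeff h m = coeff (q m) j"
      using \<open>m \<le> degree p\<close> by (simp add: h_def coeff_sum)
    then have "h \<noteq> 0" using \<open>q m \<noteq> 0\<close> by (auto simp: j_def)
    moreover have "coeff h i \<in> K" for i
      using q(2) by (auto simp: h_def coeff_sum K_def intro!: acl_sum)
    moreover have "poly h z = coeff G j"
      unfolding h_def G_def coeff_sum poly_sum by (intro sum.cong) (simp_all add: poly_monom)
    ultimately have "z \<in> K"
      using acl.root[of h S z] \<open>G = 0\<close> by (simp add: K_def)
    then show False using z(2) by (simp add: K_def)
  qed
  ultimately show ?thesis using acl.root[of G "insert z S" a] by blast
qed

text \<open>Adjoin the elements of \<open>T\<close> to \<open>A\<close> one at a time: the one whose
  arrival first makes \<open>z\<close> algebraic can be exchanged for \<open>z\<close>. This is why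
  \<open>A\<close> varies in the induction.\<close>

lemma acl_steinitz_step:
  assumes "finite T" "z \<in> acl (A \<union> T)" "z \<notin> acl A"
  shows "\<exists>t\<in>T. t \<in> acl (insert z (A \<union> (T - {t})))"
  using assms
proof (induction T arbitrary: A rule: finite_induct)
  case (insert t T)
  show ?case
  proof (cases "z \<in> acl (insert t A)")
    case True
    then have "t \<in> acl (insert z A)" using acl_exchange insert.prems(2) by blast
    moreover have "acl (insert z A) \<subseteq> acl (insert z (A \<union> (insert t T - {t})))"
      by (rule acl_mono) auto
    ultimately have "t \<in> acl (insert z (A \<union> (insert t T - {t})))" by (rule subsetD[rotated])
    then show ?thesis by (rule bexI) simp
  next
    case False
    have "z \<in> acl (insert t A \<union> T)" using insert.prems(1) by simp
    from insert.IH[OF this False]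
    obtain s where s: "s \<in> T" "s \<in> acl (insert z (insert t A \<union> (T - {s})))" by (rule bexE)
    have "insert z (insert t A \<union> (T - {s})) \<subseteq> insert z (A \<union> (insert t T - {s}))"
      using s(1) insert.hyps by auto
    from subsetD[OF acl_mono[OF this] s(2)] show ?thesis by (rule bexI) (simp add: s(1))
  qed
qed simp

subsection \<open>Very general coefficient vectors\<close>

definition rat_polys :: "'v set \<Rightarrow> 'v cpoly set" where
  "rat_polys M = {F. (\<forall>m. Poly_Mapping.lookup F m \<in> \<rat>) \<and>
     (\<forall>m\<in>Poly_Mapping.keys F. Poly_Mapping.keys m \<subseteq> M)}"

definition alg_indep :: "('v \<Rightarrow> complex) \<Rightarrow> 'v set \<Rightarrow> bool" where
  "alg_indep a M \<longleftrightarrow> (\<forall>F\<in>rat_polys M. poly_eval a F = 0 \<longrightarrow> F = 0)"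

lemma poly_eval_minus: "poly_eval a (- p) = - poly_eval a p"
proof -
  have "poly_eval a (- p) + poly_eval a p = 0"
    by (simp only: poly_eval_add[symmetric]) simp
  then show ?thesis by (rule eq_neg_iff_add_eq_0[THEN iffD2])
qed

lemma poly_eval_diff: "poly_eval a (p - q) = poly_eval a p - poly_eval a q"
  using poly_eval_add[of a p "- q"] by (simp only: poly_eval_minus add_uminus_conv_diff)

lemma poly_eval_one [simp]: "poly_eval a 1 = 1"
  by (simp add: poly_eval_def monom_eval_def)

lemma poly_eval_power: "poly_eval a (p ^ n) = poly_eval a p ^ n"
  by (induction n) (auto simp: poly_eval_mult)

lemma poly_eval_prod: "poly_eval a (prod f A) = (\<Prod>i\<in>A. poly_eval a (f i))"
  by (induction A rule: infinite_finite_induct) (auto simp: poly_eval_mult)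

definition pvar :: "'v \<Rightarrow> 'v cpoly" where
  "pvar x = Poly_Mapping.single (Poly_Mapping.single x 1) 1"

lemma poly_eval_pvar [simp]: "poly_eval a (pvar x) = a x"
  by (simp add: pvar_def poly_eval_single monom_eval_def)

lemma poly_eval_cong:
  assumes "\<And>m v. m \<in> Poly_Mapping.keys F \<Longrightarrow> v \<in> Poly_Mapping.keys m \<Longrightarrow> a v = b v"
  shows "poly_eval a F = poly_eval b F"
  using assms unfolding poly_eval_def monom_eval_def by (intro sum.cong) auto

lemma pvar_in_rat_polys: "x \<in> M \<Longrightarrow> pvar x \<in> rat_polys M"
  by (auto simp: rat_polys_def pvar_def lookup_single when_def)

lemma one_in_rat_polys: "1 \<in> rat_polys M"
  by (auto simp: rat_polys_def lookup_one when_def)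

lemma rat_polys_diff:
  assumes "F \<in> rat_polys M" "G \<in> rat_polys M"
  shows "F - G \<in> rat_polys M"
  using assms keys_diff[of F G] unfolding rat_polys_def by (simp add: lookup_minus) blast

lemma rat_polys_mult:
  assumes "F \<in> rat_polys M" "G \<in> rat_polys M"
  shows "F * G \<in> rat_polys M"
proof -
  have "F * G = (\<Sum>m\<in>Poly_Mapping.keys F. \<Sum>n\<in>Poly_Mapping.keys G.
      Poly_Mapping.single (m + n) (Poly_Mapping.lookup F m * Poly_Mapping.lookup G n))"
    by (subst cpoly_expand[of F], subst cpoly_expand[of G]) (simp only: sum_product mult_single)
  moreover have "Poly_Mapping.lookup (Poly_Mapping.single (m + n)
      (Poly_Mapping.lookup F m * Poly_Mapping.lookup G n)) k \<in> \<rat>" for m n k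
    using assms by (simp add: rat_polys_def lookup_single when_def)
  ultimately have "Poly_Mapping.lookup (F * G) k \<in> \<rat>" for k
    by (simp only: lookup_sum) (intro Rats_sum)
  moreover have "Poly_Mapping.keys k \<subseteq> M" if k: "k \<in> Poly_Mapping.keys (F * G)" for k
  proof -
    obtain m n where "k = m + n" "m \<in> Poly_Mapping.keys F" "n \<in> Poly_Mapping.keys G"
      using keys_mult[of F G] k by blast
    then show ?thesis using assms keys_add[of m n] unfolding rat_polys_def by blast
  qed
  ultimately show ?thesis by (auto simp: rat_polys_def)
qed

lemma zero_in_rat_polys: "0 \<in> rat_polys M"
  by (auto simp: rat_polys_def)

lemma rat_polys_add:
  assumes "F \<in> rat_polys M" "G \<in> rat_polys M"
  shows "F + G \<in> rat_polys M"
  using rat_polys_diff[OF assms(1) rat_polys_diff[OF zero_in_rat_polys assms(2)]] by simp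

lemma rat_polys_sum: "(\<And>i. i \<in> A \<Longrightarrow> f i \<in> rat_polys M) \<Longrightarrow> sum f A \<in> rat_polys M"
  by (induction A rule: infinite_finite_induct) (auto intro: rat_polys_add zero_in_rat_polys)

lemma rat_polys_power: "F \<in> rat_polys M \<Longrightarrow> F ^ n \<in> rat_polys M"
  by (induction n) (auto intro: one_in_rat_polys rat_polys_mult)

lemma rat_polys_mono: "M \<subseteq> N \<Longrightarrow> rat_polys M \<subseteq> rat_polys N"
  by (auto simp: rat_polys_def)

text \<open>A dependence, cleared of denominators, lifts to a rational polynomial \<open>H\<close>,
  which is zero by independence. Since \<open>x\<close> lies outside \<open>N\<close>, the value at
  \<open>x\<close> can be varied while the coefficients stay fixed, so the dependence itself was
  trivial.\<close>

lemma alg_indep_not_acl: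
  assumes ind: "alg_indep a M" and x: "x \<in> M" "x \<notin> N" and N: "N \<subseteq> M"
  shows "a x \<notin> acl (a ` N)"
proof
  assume ax: "a x \<in> acl (a ` N)"
  define R where "R = poly_eval a ` rat_polys N"
  define F where "F = {x / y |x y. x \<in> R \<and> y \<in> R \<and> y \<noteq> 0}"
  have 1: "1 \<in> R" unfolding R_def using one_in_rat_polys by (intro image_eqI[of _ _ 1]) auto
  have R: "x - y \<in> R" "x * y \<in> R" if "x \<in> R" "y \<in> R" for x y
    using that rat_polys_diff[of _ N] rat_polys_mult[of _ N] unfolding R_def
    by (auto simp: poly_eval_diff[symmetric] poly_eval_mult[symmetric])
  have F: "complex_subfield F"
    unfolding F_def using 1 R by (intro complex_subfield_fractions)
  have "a ` N \<subseteq> R"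
    unfolding R_def using pvar_in_rat_polys by (force intro: image_eqI[of _ _ "pvar _"])
  moreover have "x \<in> F" if "x \<in> R" for x
    unfolding F_def using 1 that by (intro CollectI exI[of _ x] exI[of _ 1]) simp
  then have "R \<subseteq> F" by blast
  ultimately have "acl (a ` N) \<subseteq> {w. algebraic_over F w}"
    by (intro acl_least complex_subfield_algebraic_over[OF F])
      (auto intro: algebraic_over_trans[OF F] algebraic_over_self[OF F])
  then have "algebraic_over R (a x)"
    using ax algebraic_over_fractions[OF 1 R(2)] unfolding F_def by blast
  then obtain p where p: "p \<noteq> 0" "\<And>i. \<exists>G\<in>rat_polys N. coeff p i = poly_eval a G" "poly p (a x) = 0"
    unfolding algebraic_over_def R_def by blast
  then obtain q where q: "\<And>i. q i \<in> rat_polys N" "\<And>i. coeff p i = poly_eval a (q i)" by metis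
  define H where "H = (\<Sum>i\<le>degree p. q i * pvar x ^ i)"
  have eval: "poly_eval (a(x := t)) H = poly p t" for t
  proof -
    have "poly_eval (a(x := t)) (q i) = coeff p i" for i
      unfolding q(2) using q(1)[of i] x(2) by (intro poly_eval_cong) (auto simp: rat_polys_def)
    then show ?thesis
      by (simp add: H_def poly_eval_sum poly_eval_mult poly_eval_power poly_altdef)
  qed
  have "poly_eval a H = 0" using eval[of "a x"] p(3) by simp
  moreover have "q i \<in> rat_polys M" for i using rat_polys_mono[OF N] q(1) by blast
  then have "H \<in> rat_polys M"
    unfolding H_def by (intro rat_polys_sum rat_polys_mult rat_polys_power pvar_in_rat_polys x)
  ultimately have "H = 0" using ind by (auto simp: alg_indep_def)
  then have "poly p t = 0" for t using eval[of t] by simp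
  then have "p = 0" using poly_all_0_iff_0[of p] by blast
  then show False using p(1) by simp
qed

text \<open>Steinitz replacement: each \<open>x\<close> joining \<open>N\<close> expels one element
  of \<open>S\<close>; \<open>T\<close> consists of the survivors, and \<open>S\<close> stays
  algebraic over what is left. The bound is read off at \<open>N = M\<close>.\<close>

theorem alg_indep_card_le:
  assumes ind: "alg_indep a M" and fin: "finite M" "finite S" and sub: "a ` M \<subseteq> acl S"
  shows "card M \<le> card S"
proof -
  have "\<exists>T\<subseteq>S. card T + card N \<le> card S \<and> S \<subseteq> acl (a ` N \<union> T)" if "finite N" "N \<subseteq> M" for N
    using that
  proof (induction N rule: finite_induct)
    case empty
    then show ?case using acl_subset by (intro exI[of _ S]) auto
  next
    case (insert x N)
    then obtain T where T: "T \<subseteq> S" "card T + card N \<le> card S" "S \<subseteq> acl (a ` N \<union> T)" by auto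
    have finT: "finite T" using T(1) fin(2) by (rule finite_subset)
    have "a x \<in> acl (a ` N \<union> T)" using insert.prems sub acl_minimal[OF T(3)] by auto
    moreover have "a x \<notin> acl (a ` N)"
      using insert by (intro alg_indep_not_acl[OF ind]) auto
    ultimately obtain t where t: "t \<in> T" "t \<in> acl (insert (a x) (a ` N \<union> (T - {t})))"
      using acl_steinitz_step[OF finT] by blast
    let ?A = "insert (a x) (a ` N \<union> (T - {t}))"
    have "a ` N \<union> T \<subseteq> acl ?A" using t acl_subset[of ?A] by auto
    then have "S \<subseteq> acl (a ` insert x N \<union> (T - {t}))"
      using T(3) acl_minimal[of "a ` N \<union> T" ?A] by simp
    moreover have "card T = Suc (card (T - {t}))" using finT t(1) by (rule card.remove)
    ultimately show ?case
      using T insert.hyps by (intro exI[of _ "T - {t}"]) auto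
  qed
  from this[OF fin(1) order_refl] show ?thesis by auto
qed


lemma countable_rat_polys:
  assumes M: "finite M"
  shows "countable (rat_polys M)"
proof -
  define E where "E = {m :: 'a \<Rightarrow>\<^sub>0 nat. Poly_Mapping.keys m \<subseteq> M}"
  have "inj_on (\<lambda>m. restrict (Poly_Mapping.lookup m) M) E"
  proof (rule inj_onI)
    fix m n assume mn: "m \<in> E" "n \<in> E"
      "restrict (Poly_Mapping.lookup m) M = restrict (Poly_Mapping.lookup n) M"
    show "m = n"
    proof (rule poly_mapping_eqI)
      fix v
      show "Poly_Mapping.lookup m v = Poly_Mapping.lookup n v"
      proof (cases "v \<in> M")
        case True
        then show ?thesis using fun_cong[OF mn(3), of v] by simp
      next
        case False
        then have "v \<notin> Poly_Mapping.keys m" "v \<notin> Poly_Mapping.keys n" using mn by (auto simp: E_def)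
        then show ?thesis by (simp add: in_keys_iff)
      qed
    qed
  qed
  moreover have "(\<lambda>m. restrict (Poly_Mapping.lookup m) M) ` E \<subseteq> PiE M (\<lambda>_. UNIV)" by auto
  moreover have "countable (PiE M (\<lambda>_. UNIV :: nat set))" using M by (intro countable_PiE) auto
  ultimately have E: "countable E" by (meson countable_image_inj_on countable_subset)
  define G where "G = (\<lambda>F :: 'a cpoly. (\<lambda>m. (m, Poly_Mapping.lookup F m)) ` Poly_Mapping.keys F)"
  have "inj_on G (rat_polys M)"
  proof (rule inj_onI)
    fix F F' assume eq: "G F = G F'"
    have keys: "Poly_Mapping.keys H = fst ` G H" for H
      by (simp add: G_def image_image)
    show "F = F'"
    proof (rule poly_mapping_eqI)
      fix m
      show "Poly_Mapping.lookup F m = Poly_Mapping.lookup F' m"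
      proof (cases "m \<in> Poly_Mapping.keys F")
        case True
        then have "(m, Poly_Mapping.lookup F m) \<in> G F'" using eq by (auto simp: G_def)
        then show ?thesis by (auto simp: G_def)
      next
        case False
        then have "m \<notin> Poly_Mapping.keys F'" using keys[of F] keys[of F'] eq by simp
        then show ?thesis using False by (simp add: in_keys_iff)
      qed
    qed
  qed
  moreover have "G ` rat_polys M \<subseteq> {A. finite A \<and> A \<subseteq> E \<times> \<rat>}"
    by (auto simp: G_def rat_polys_def E_def)
  moreover have "countable {A. finite A \<and> A \<subseteq> E \<times> (\<rat> :: complex set)}"
    using E countable_rat by (intro countable_Collect_finite_subset countable_SIGMA) auto
  ultimately show ?thesis by (meson countable_image_inj_on countable_subset)
qed

section \<open>From points of |L| to scaled coefficient vectors\<close>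

definition total_degree :: "('v \<Rightarrow>\<^sub>0 nat) \<Rightarrow> nat" where
  "total_degree m = (\<Sum>v\<in>Poly_Mapping.keys m. Poly_Mapping.lookup m v)"

lemma homogeneous_iff: "homogeneous d p \<longleftrightarrow> (\<forall>m\<in>Poly_Mapping.keys p. total_degree m = d)"
  by (simp add: homogeneous_def total_degree_def)

lemma monom_eval_smult: "monom_eval (\<lambda>v. t * a v) m = t ^ total_degree m * monom_eval a m"
  by (simp add: monom_eval_def total_degree_def power_mult_distrib prod.distrib power_sum)

lemma poly_eval_smult:
  assumes "homogeneous d F"
  shows "poly_eval (\<lambda>v. t * a v) F = t ^ d * poly_eval a F"
  using assms
  by (auto simp: poly_eval_def monom_eval_smult homogeneous_iff sum_distrib_left intro!: sum.cong)

definition hom_part :: "nat \<Rightarrow> 'v cpoly \<Rightarrow> 'v cpoly" where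
  "hom_part d F = (\<Sum>m\<in>{m \<in> Poly_Mapping.keys F. total_degree m = d}.
     Poly_Mapping.single m (Poly_Mapping.lookup F m))"

lemma lookup_hom_part:
  "Poly_Mapping.lookup (hom_part d F) m = (if total_degree m = d then Poly_Mapping.lookup F m else 0)"
  by (auto simp: hom_part_def lookup_sum lookup_single when_def in_keys_iff)

lemma keys_hom_part: "Poly_Mapping.keys (hom_part d F) = {m \<in> Poly_Mapping.keys F. total_degree m = d}"
  by (auto simp: in_keys_iff lookup_hom_part split: if_splits)

text \<open>Hypersurfaces of |L| test homogeneous polynomials only. On the multiple of a vector by
  \<open>t\<close> an arbitrary polynomial becomes a polynomial in \<open>t\<close> whose
  coefficients are the values of its homogeneous parts, so homogeneous information suffices.\<close>

lemma poly_eval_scaled: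
  "poly_eval (\<lambda>v. t * a v) F =
     poly (\<Sum>m\<in>Poly_Mapping.keys F. monom (Poly_Mapping.lookup F m * monom_eval a m) (total_degree m)) t"
  by (simp add: poly_eval_def monom_eval_smult poly_sum poly_monom mult_ac)

text \<open>The scalar is chosen transcendental over the entries of the vector.\<close>

lemma exists_scaling_alg_indep:
  assumes M: "finite M"
    and hom: "\<And>F d. F \<in> rat_polys M \<Longrightarrow> homogeneous d F \<Longrightarrow> F \<noteq> 0 \<Longrightarrow> poly_eval a F \<noteq> 0"
  shows "\<exists>t. t \<noteq> 0 \<and> alg_indep (\<lambda>v. t * a v) M"
proof -
  define q where "q = (\<lambda>F. \<Sum>m\<in>Poly_Mapping.keys F.
    monom (Poly_Mapping.lookup F m * monom_eval a m) (total_degree m))"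
  define bad where "bad = insert 0 (\<Union>F\<in>rat_polys M - {0}. {t. poly (q F) t = 0})"
  have "q F \<noteq> 0" if F: "F \<in> rat_polys M" "F \<noteq> 0" for F
  proof -
    obtain m where m: "m \<in> Poly_Mapping.keys F" using F(2) by fastforce
    define d where "d = total_degree m"
    have "hom_part d F \<in> rat_polys M"
      using F(1) by (auto simp: rat_polys_def lookup_hom_part keys_hom_part)
    moreover have "hom_part d F \<noteq> 0"
      using m by (metis (mono_tags, lifting) d_def keys_hom_part keys_zero mem_Collect_eq empty_iff)
    moreover have "homogeneous d (hom_part d F)" by (auto simp: homogeneous_iff keys_hom_part)
    ultimately have "poly_eval a (hom_part d F) \<noteq> 0" by (intro hom)
    moreover have "poly_eval a (hom_part d F) = coeff (q F) d"
      by (auto simp: q_def coeff_sum poly_eval_def keys_hom_part lookup_hom_part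
          sum.inter_filter intro!: sum.cong)
    ultimately show ?thesis by auto
  qed
  then have "finite {t. poly (q F) t = 0}" if "F \<in> rat_polys M - {0}" for F
    using that by (intro poly_roots_finite) auto
  then have "countable bad"
    unfolding bad_def using countable_rat_polys[OF M]
    by (intro countable_insert countable_UN) (auto intro: countable_finite)
  then obtain t where t: "t \<notin> bad"
    using uncountable_UNIV_complex by (metis UNIV_eq_I)
  have "alg_indep (\<lambda>v. t * a v) M"
    unfolding alg_indep_def
  proof (intro ballI impI)
    fix F assume "F \<in> rat_polys M" "poly_eval (\<lambda>v. t * a v) F = 0"
    then show "F = 0" using t by (auto simp: bad_def q_def poly_eval_scaled)
  qed
  then show ?thesis using t by (auto simp: bad_def)
qed

text \<open>Exponents of the coordinates \<open>(i, 0)\<close>. The degree in each factor being 2,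
  the exponents of the coordinates \<open>(i, 1)\<close> are \<open>2 - e i\<close>; this gives 27 =
  3^3 coefficients.\<close>

definition idx :: "(3 \<Rightarrow> nat) set" where
  "idx = {e. \<forall>i. e i \<le> 2}"

lemma idx_PiE: "idx = PiE UNIV (\<lambda>_. {..2})"
  by (auto simp: idx_def)

lemma finite_idx [simp]: "finite idx"
  unfolding idx_PiE by (intro finite_PiE) auto

lemma card_idx: "card idx = 27"
  unfolding idx_PiE by (subst card_PiE) auto

definition mon :: "(3 \<Rightarrow> nat) \<Rightarrow> 3 \<times> 2 \<Rightarrow>\<^sub>0 nat" where
  "mon e = Abs_poly_mapping (\<lambda>(i, j). if j = 0 then e i else 2 - e i)"

lemma lookup_Abs_finite: "Poly_Mapping.lookup (Abs_poly_mapping (f :: 'a :: finite \<Rightarrow> _)) = f"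
  by (simp add: Abs_poly_mapping_inverse)

lemma lookup_mon: "Poly_Mapping.lookup (mon e) (i, j) = (if j = 0 then e i else 2 - e i)"
  by (simp add: mon_def lookup_Abs_finite)

lemma two_cases: "(j :: 2) = 0 \<or> j = 1"
  using exhaust_2[of j] by auto

lemma sum_UNIV_2: "(\<Sum>j\<in>(UNIV :: 2 set). f j) = f 0 + f 1"
proof -
  have U: "UNIV = {0 :: 2, 1}" using two_cases by auto
  show ?thesis unfolding U by simp
qed

lemma inj_mon: "inj_on mon idx"
  by (rule inj_onI) (metis ext lookup_mon)

lemma multidegree_eq_2_iff: "multidegree m = (\<lambda>_. 2) \<longleftrightarrow> m \<in> mon ` idx"
proof
  assume m: "multidegree m = (\<lambda>_. 2)"
  define e where "e = (\<lambda>i. Poly_Mapping.lookup m (i, 0))"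
  have e: "e i + Poly_Mapping.lookup m (i, 1) = 2" for i
    using fun_cong[OF m, of i] by (simp add: multidegree_def sum_UNIV_2 e_def)
  have "m = mon e"
  proof (rule poly_mapping_eqI)
    fix k :: "3 \<times> 2"
    obtain i j where k: "k = (i, j)" by force
    show "Poly_Mapping.lookup m k = Poly_Mapping.lookup (mon e) k"
      using e[of i] two_cases[of j] by (auto simp: k lookup_mon e_def)
  qed
  moreover have "e i \<le> 2" for i using e[of i] by linarith
  then have "e \<in> idx" by (simp add: idx_def)
  ultimately show "m \<in> mon ` idx" by blast
qed (auto simp: multidegree_def sum_UNIV_2 lookup_mon idx_def)

definition cf :: "(3 \<times> 2) cpoly \<Rightarrow> (3 \<Rightarrow> nat) \<Rightarrow> complex" where
  "cf P e = Poly_Mapping.lookup P (mon e)"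

definition generic :: "((3 \<Rightarrow> nat) \<Rightarrow> complex) \<Rightarrow> bool" where
  "generic c \<longleftrightarrow> (\<forall>S. finite S \<longrightarrow> c ` idx \<subseteq> acl S \<longrightarrow> card S \<ge> 27)"

lemma lookup_const_mult: "Poly_Mapping.lookup (Poly_Mapping.single 0 t * P) m = t * Poly_Mapping.lookup P m"
  for P :: "'v cpoly"
proof -
  have "Poly_Mapping.single 0 t * P = (\<Sum>n\<in>Poly_Mapping.keys P.
      Poly_Mapping.single n (t * Poly_Mapping.lookup P n))"
    using arg_cong[OF cpoly_expand[of P], of "(*) (Poly_Mapping.single 0 t)"]
    by (simp add: sum_distrib_left mult_single)
  then show ?thesis
    by (auto simp: lookup_sum lookup_single when_def in_keys_iff)
qed

text \<open>The excluded hypersurfaces are those of homogeneous polynomials with rational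
  coefficients, of which there are countably many. Off them some representative of the point has
  algebraically independent coefficients, and it defines the same surface.\<close>

lemma very_general_wehlerI:
  assumes Q: "\<And>P. P \<in> sections_L \<Longrightarrow> generic (cf P) \<Longrightarrow> Q {x. vanishes_at P x}"
  shows "very_general_wehler Q"
proof -
  define M where "M = mon ` idx"
  have M: "{m. multidegree m = (\<lambda>_. 2)} = M" by (auto simp: M_def multidegree_eq_2_iff)
  define h where "h = (\<lambda>F. {D \<in> linear_system_L. \<forall>P\<in>D. poly_eval (Poly_Mapping.lookup P) F = 0})"
  define \<F> where "\<F> = {F \<in> rat_polys M. F \<noteq> 0 \<and> (\<exists>d>0. homogeneous d F)}"
  have "countable \<F>"
    using countable_rat_polys[of M] unfolding \<F>_def M_def by (rule countable_subset[rotated]) auto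
  moreover have "hypersurface_L (h F)" if "F \<in> \<F>" for F
    using that unfolding hypersurface_L_def h_def \<F>_def M rat_polys_def by blast
  moreover have "Q (surface D)" if D: "D \<in> linear_system_L - \<Union>(h ` \<F>)" for D
  proof -
    obtain P where P: "P \<in> sections_L" "P \<noteq> 0" "D = {Poly_Mapping.single 0 c * P |c. c \<noteq> 0}"
      using D by (auto simp: linear_system_L_def)
    let ?a = "Poly_Mapping.lookup P"
    have "poly_eval ?a F \<noteq> 0" if F: "F \<in> rat_polys M" "homogeneous d F" "F \<noteq> 0" for F d
    proof (cases "d = 0")
      \<comment> \<open>Degree 0 gives no hypersurface and is settled directly: \<open>F\<close> is
        then a nonzero constant.\<close>
      case True
      have "Poly_Mapping.keys F \<subseteq> {0}"
        using F(2) True by (auto simp: homogeneous_iff total_degree_def in_keys_iff intro!: poly_mapping_eqI)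
      then have "poly_eval ?a F = Poly_Mapping.lookup F 0"
        by (subst poly_eval_superset[of "{0}"]) (auto simp: monom_eval_def)
      moreover have "Poly_Mapping.lookup F 0 \<noteq> 0"
        using \<open>Poly_Mapping.keys F \<subseteq> {0}\<close> F(3) by (metis in_keys_iff keys_eq_empty subset_singletonD singletonI)
      ultimately show ?thesis by simp
    next
      case False
      then have "F \<in> \<F>" using F by (auto simp: \<F>_def)
      then have "D \<notin> h F" using D by auto
      \<comment> \<open>Avoiding the hypersurface means that some multiple of \<open>P\<close> is
        not a zero of \<open>F\<close>; by homogeneity neither is \<open>P\<close>.\<close>
      then obtain t where t: "poly_eval (Poly_Mapping.lookup (Poly_Mapping.single 0 t * P)) F \<noteq> 0"
        using D unfolding h_def P(3) by blast
      have "Poly_Mapping.lookup (Poly_Mapping.single 0 t * P) = (\<lambda>m. t * ?a m)"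
        by (simp add: lookup_const_mult fun_eq_iff)
      then show ?thesis using t poly_eval_smult[OF F(2), of t ?a] by auto
    qed
    then obtain t where t: "t \<noteq> 0" "alg_indep (\<lambda>m. t * ?a m) M"
      using exists_scaling_alg_indep[of M ?a] by (auto simp: M_def)
    let ?P = "Poly_Mapping.single 0 t * P"
    have lookup: "Poly_Mapping.lookup ?P = (\<lambda>m. t * ?a m)"
      by (simp add: lookup_const_mult fun_eq_iff)
    have "?P \<in> sections_L"
      using P(1) by (auto simp: sections_L_def multihomogeneous_def in_keys_iff lookup)
    moreover have "generic (cf ?P)"
      unfolding generic_def
    proof (intro allI impI)
      fix S assume S: "finite S" "cf ?P ` idx \<subseteq> acl S"
      have "card M \<le> card S"
        using S(2) by (intro alg_indep_card_le[OF t(2) _ S(1)]) (auto simp: M_def cf_def lookup)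
      then show "27 \<le> card S" by (simp add: M_def card_image inj_mon card_idx)
    qed
    moreover have "surface D = {x. vanishes_at ?P x}"
    proof -
      have "poly_eval a (Poly_Mapping.single 0 c * P) = c * poly_eval a P" for a c
        by (simp add: poly_eval_mult poly_eval_single monom_eval_def)
      then show ?thesis
        using t(1) by (auto simp: surface_def zero_locus_def P(3) vanishes_at_def)
    qed
    ultimately show ?thesis using Q[of ?P] by simp
  qed
  ultimately show ?thesis
    unfolding very_general_wehler_def by (intro exI[of _ "h ` \<F>"]) auto
qed

subsection \<open>Bivariate polynomials\<close>

text \<open>The outer variable is y; the coefficients are polynomials in z.\<close>

definition eval2 :: "complex poly poly \<Rightarrow> complex \<Rightarrow> complex \<Rightarrow> complex" where
  "eval2 F y z = poly (poly F [:y:]) z"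

lemma eval2_simps [simp]:
  "eval2 (F * G) y z = eval2 F y z * eval2 G y z" "eval2 (F + G) y z = eval2 F y z + eval2 G y z"
  "eval2 [:c:] y z = poly c z" "eval2 0 y z = 0" "eval2 (smult c F) y z = poly c z * eval2 F y z"
  by (simp_all add: eval2_def)

lemma eval2_altdef: "eval2 F y z = (\<Sum>i\<le>degree F. poly (coeff F i) z * y ^ i)"
  unfolding eval2_def poly_altdef[of F] by (simp add: poly_sum poly_power)

definition slice :: "complex \<Rightarrow> complex poly poly \<Rightarrow> complex poly" where
  "slice z F = map_poly (\<lambda>c. poly c z) F"

lemma coeff_slice: "coeff (slice z F) i = poly (coeff F i) z"
  by (simp add: slice_def coeff_map_poly)

lemma poly_slice: "poly (slice z F) y = eval2 F y z"
proof -
  have "degree (slice z F) \<le> degree F" by (intro degree_le) (simp add: coeff_slice coeff_eq_0)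
  then have "poly (slice z F) y = (\<Sum>i\<le>degree F. coeff (slice z F) i * y ^ i)"
    unfolding poly_altdef by (intro sum.mono_neutral_left) (auto simp: coeff_eq_0)
  then show ?thesis by (simp add: eval2_altdef coeff_slice)
qed

lemma slice_eq_0_dvd:
  assumes "slice z F = 0"
  shows "[:[:- z, 1:]:] dvd F"
proof -
  have "poly (coeff F i) z = 0" for i using assms coeff_slice[of z F i] by simp
  then show ?thesis by (simp add: const_poly_dvd_iff poly_eq_0_iff_dvd)
qed

text \<open>Bezout's identity over the rational functions in z, without fractions: \<open>h\<close>
  is a nonzero combination of least degree in y, pseudo-division makes it divide multiples of
  \<open>f\<close> and \<open>g\<close>, and primality of \<open>f\<close> forces it to be free of
  y.\<close>

lemma eliminate_variable:
  fixes f g :: "complex poly poly"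
  assumes f: "prime_elem f" "degree f > 0" and g: "\<not> f dvd g"
  shows "\<exists>u v c. c \<noteq> 0 \<and> u * f + v * g = [:c:]"
proof -
  define J where "J = {h. h \<noteq> 0 \<and> (\<exists>u v. h = u * f + v * g)}"
  have "f = 1 * f + 0 * g" by simp
  then have "f \<in> J" using f unfolding J_def prime_elem_def by blast
  then obtain h where h: "h \<in> J" "\<And>k. k \<in> J \<Longrightarrow> degree h \<le> degree k"
    using ex_has_least_nat[of "\<lambda>h. h \<in> J" f degree] by blast
  obtain u v where uv: "h = u * f + v * g" and "h \<noteq> 0" using h(1) by (auto simp: J_def)
  have dvd: "\<exists>a. a \<noteq> 0 \<and> h dvd smult a k" if k: "k = u' * f + v' * g" for k u' v'
  proof -
    obtain a q where aq: "a \<noteq> 0" "smult a k = h * q + pseudo_mod k h"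
      and r: "pseudo_mod k h = 0 \<or> degree (pseudo_mod k h) < degree h"
      using pseudo_mod[OF \<open>h \<noteq> 0\<close>, of k] by blast
    have "pseudo_mod k h = smult a k - h * q" using aq(2) by simp
    also have "\<dots> = (smult a u' - u * q) * f + (smult a v' - v * q) * g"
      by (simp add: k uv algebra_simps smult_add_right)
    finally have "pseudo_mod k h = 0"
      using r h(2)[of "pseudo_mod k h"] unfolding J_def by fastforce
    then show ?thesis using aq by (intro exI[of _ a]) auto
  qed
  obtain a where a: "a \<noteq> 0" "h dvd smult a f" using dvd[of f 1 0] by auto
  obtain b where b: "b \<noteq> 0" "h dvd smult b g" using dvd[of g 0 1] by auto
  have ndvd: "\<not> f dvd [:c:]" if "c \<noteq> 0" for c
    using dvd_imp_degree_le[of f "[:c:]"] f(2) that by auto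
  have "\<not> f dvd h"
  proof
    assume "f dvd h"
    then have "f dvd [:b:] * g" using b(2) dvd_trans by fastforce
    then show False using prime_elem_dvd_multD[OF f(1)] ndvd[OF b(1)] g by blast
  qed
  obtain q where q: "[:a:] * f = h * q" using a(2) by (auto elim: dvdE)
  then have "f dvd h * q" by (metis dvd_triv_right)
  then have "f dvd q" using prime_elem_dvd_multD[OF f(1)] \<open>\<not> f dvd h\<close> by blast
  then obtain q' where "q = f * q'" by (auto elim: dvdE)
  then have "f * [:a:] = f * (h * q')" using q by (simp add: mult_ac)
  moreover have "f \<noteq> 0" using f by auto
  ultimately have "[:a:] = h * q'" using mult_left_cancel by blast
  then have "degree h = 0"
    using a(1) by (metis degree_mult_eq_0 degree_pCons_0 mult_zero_left mult_zero_right pCons_eq_0_iff degree_mult_eq add_is_0)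
  then obtain c where "h = [:c:]" by (metis degree_eq_zeroE)
  then show ?thesis using uv \<open>h \<noteq> 0\<close> by (intro exI[of _ u] exI[of _ v] exI[of _ c]) auto
qed

text \<open>If \<open>f\<close> involves y and does not divide \<open>g\<close>, elimination
  confines z to the roots of \<open>c\<close>, and each z leaves finitely many y. If
  \<open>f\<close> is a polynomial in z alone, it is linear up to a unit, and \<open>g\<close>
  vanishes on the corresponding line.\<close>

theorem irreducible_dvd_of_infinite_zeros:
  fixes f g :: "complex poly poly"
  assumes f: "irreducible f" and inf: "infinite {(y, z). eval2 f y z = 0 \<and> eval2 g y z = 0}"
  shows "f dvd g"
proof -
  define Z where "Z = {(y, z). eval2 f y z = 0 \<and> eval2 g y z = 0}"
  have fin: False
    if "finite R" "\<And>y z. (y, z) \<in> Z \<Longrightarrow> z \<in> R" "\<And>z. z \<in> R \<Longrightarrow> finite {y. (y, z) \<in> Z}" for R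
  proof -
    have "Z \<subseteq> (\<Union>z\<in>R. (\<lambda>y. (y, z)) ` {y. (y, z) \<in> Z})" using that(2) by auto
    moreover have "finite (\<Union>z\<in>R. (\<lambda>y. (y, z)) ` {y. (y, z) \<in> Z})" using that by auto
    ultimately show False using inf finite_subset unfolding Z_def by blast
  qed
  show ?thesis
  proof (cases "degree f = 0")
    case False
    show ?thesis
    proof (rule ccontr)
      assume "\<not> f dvd g"
      then obtain u v c where c: "c \<noteq> 0" "u * f + v * g = [:c:]"
        using eliminate_variable[of f g] irreducible_imp_prime_poly[OF f] False by auto
      show False
      proof (rule fin)
        show "finite {z. poly c z = 0}" using c(1) by (rule poly_roots_finite)
        fix y z assume "(y, z) \<in> Z"
        then have "eval2 (u * f + v * g) y z = 0" by (simp add: Z_def)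
        then show "z \<in> {z. poly c z = 0}" unfolding c(2) by simp
      next
        fix z
        \<comment> \<open>A vanishing slice splits off a linear factor in the inner variable, which
          irreducibility forbids when \<open>f\<close> involves y.\<close>
        have "slice z f \<noteq> 0"
        proof
          assume "slice z f = 0"
          then obtain h where h: "f = [:[:- z, 1:]:] * h" using slice_eq_0_dvd by (metis dvdE)
          have "\<not> [:[:- z, 1:]:] dvd 1" by (simp add: is_unit_const_poly_iff is_unit_pCons_iff)
          then have "h dvd 1" using f h Factorial_Ring.irreducibleD by blast
          then have "degree h = 0" by (metis degree_1 dvd_imp_degree_le le_zero_eq one_neq_zero)
          then show False using False h by simp
        qed
        then have "finite {y. poly (slice z f) y = 0}" by (rule poly_roots_finite)
        then show "finite {y. (y, z) \<in> Z}"
          by (rule rev_finite_subset) (auto simp: Z_def poly_slice)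
      qed
    qed
  next
    case True
    then obtain c where c: "f = [:c:]" by (metis degree_eq_zeroE)
    then have "c \<noteq> 0" using f by auto
    show ?thesis
    proof (cases "\<exists>z. poly c z = 0 \<and> infinite {y. (y, z) \<in> Z}")
      case True
      then obtain z where z: "poly c z = 0" "infinite {y. (y, z) \<in> Z}" by blast
      have "slice z g = 0"
      proof (rule ccontr)
        assume "slice z g \<noteq> 0"
        then have "finite {y. poly (slice z g) y = 0}" by (rule poly_roots_finite)
        then have "finite {y. (y, z) \<in> Z}"
          by (rule rev_finite_subset) (auto simp: Z_def poly_slice)
        then show False using z(2) by simp
      qed
      then have g: "[:[:- z, 1:]:] dvd g" by (rule slice_eq_0_dvd)
      obtain d where d: "c = [:- z, 1:] * d" using z(1) by (auto simp: poly_eq_0_iff_dvd elim: dvdE)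
      have "f = [:[:- z, 1:]:] * [:d:]" by (simp add: c d)
      moreover have "\<not> [:[:- z, 1:]:] dvd 1" by (simp add: is_unit_const_poly_iff is_unit_pCons_iff)
      ultimately have "[:d:] dvd 1" using f Factorial_Ring.irreducibleD by blast
      then have "f dvd [:[:- z, 1:]:]"
        using \<open>f = [:[:- z, 1:]:] * [:d:]\<close> by (metis dvd_refl mult_unit_dvd_iff)
      then show ?thesis using g by (rule dvd_trans)
    next
      case False
      have False
      proof (rule fin)
        show "finite {z. poly c z = 0}" using \<open>c \<noteq> 0\<close> by (rule poly_roots_finite)
      qed (use False in \<open>auto simp: Z_def c\<close>)
      then show ?thesis ..
    qed
  qed
qed

text \<open>The degree in z, so that \<open>degree\<close> and \<open>inner_degree\<close> together
  form the bidegree.\<close>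

definition inner_degree :: "complex poly poly \<Rightarrow> nat" where
  "inner_degree F = Max (insert 0 ((\<lambda>i. degree (coeff F i)) ` {..degree F}))"

lemma degree_coeff_le_inner: "degree (coeff F i) \<le> inner_degree F"
  by (cases "i \<le> degree F") (auto simp: inner_degree_def coeff_eq_0 intro!: Max_ge)

lemma inner_degree_le:
  assumes "\<And>i. degree (coeff F i) \<le> n"
  shows "inner_degree F \<le> n"
  using assms by (auto simp: inner_degree_def)

lemma inner_degree_attained:
  assumes "F \<noteq> 0"
  shows "\<exists>i. coeff (coeff F i) (inner_degree F) \<noteq> 0"
proof (cases "inner_degree F = 0")
  case True
  have "degree (coeff F (degree F)) = 0"
    using degree_coeff_le_inner[of F "degree F"] True by simp
  then have "coeff (coeff F (degree F)) 0 \<noteq> 0"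
    using assms by (metis leading_coeff_0_iff)
  then show ?thesis using True by auto
next
  case False
  have "inner_degree F \<in> insert 0 ((\<lambda>i. degree (coeff F i)) ` {..degree F})"
    unfolding inner_degree_def by (rule Max_in) auto
  then obtain i where i: "inner_degree F = degree (coeff F i)" using False by auto
  then have "coeff F i \<noteq> 0" using False by auto
  then show ?thesis unfolding i using leading_coeff_0_iff by blast
qed

text \<open>The coefficient of the top power of z, turned by \<open>L\<close> into a polynomial in
  y, is multiplicative, and polynomials in y have no zero divisors.\<close>

lemma inner_degree_mult:
  assumes "F \<noteq> 0" "G \<noteq> 0"
  shows "inner_degree F + inner_degree G \<le> inner_degree (F * G)"
proof -
  define m n where "m = inner_degree F" and "n = inner_degree G"
  define L where "L = (\<lambda>k (H :: complex poly poly). map_poly (\<lambda>c. coeff c k) H)"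
  have cL: "coeff (L k H) i = coeff (coeff H i) k" for k H i by (simp add: L_def coeff_map_poly)
  have top: "coeff (p * q) (m + n) = coeff p m * coeff q n"
    if "degree p \<le> m" "degree q \<le> n" for p q :: "complex poly"
  proof -
    have "coeff p i * coeff q (m + n - i) = 0" if "i \<le> m + n" "i \<noteq> m" for i
      using that \<open>degree p \<le> m\<close> \<open>degree q \<le> n\<close> by (cases "i < m") (auto simp: coeff_eq_0)
    then have "coeff (p * q) (m + n) = (\<Sum>i\<in>{m}. coeff p i * coeff q (m + n - i))"
      unfolding coeff_mult by (intro sum.mono_neutral_right) auto
    then show ?thesis by simp
  qed
  have "L (m + n) (F * G) = L m F * L n G"
  proof (rule poly_eqI)
    fix k
    have "coeff (coeff F i * coeff G (k - i)) (m + n) = coeff (coeff F i) m * coeff (coeff G (k - i)) n" for i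
      by (rule top) (simp_all add: m_def n_def degree_coeff_le_inner)
    then show "coeff (L (m + n) (F * G)) k = coeff (L m F * L n G) k"
      unfolding cL coeff_mult[of F] coeff_sum coeff_mult[of "L m F"] by simp
  qed
  moreover have "L m F \<noteq> 0" "L n G \<noteq> 0"
    using inner_degree_attained[OF assms(1)] inner_degree_attained[OF assms(2)] cL[of m F] cL[of n G]
    by (metis coeff_0 m_def, metis coeff_0 n_def)
  ultimately have "L (m + n) (F * G) \<noteq> 0" by simp
  then obtain i where "coeff (L (m + n) (F * G)) i \<noteq> 0" by (metis leading_coeff_0_iff)
  then have "coeff (coeff (F * G) i) (m + n) \<noteq> 0" by (simp only: cL not_False_eq_True)
  then have "m + n \<le> degree (coeff (F * G) i)" by (rule le_degree)
  also have "\<dots> \<le> inner_degree (F * G)" by (rule degree_coeff_le_inner)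
  finally show ?thesis by (simp add: m_def n_def)
qed

lemma is_unit_bidegree_0:
  assumes "F \<noteq> 0" "degree F = 0" "inner_degree F = 0"
  shows "F dvd 1"
proof -
  obtain c where c: "F = [:c:]" using assms(2) by (metis degree_eq_zeroE)
  have "degree c = 0" using degree_coeff_le_inner[of F 0] assms(3) by (simp add: c)
  then obtain d where d: "c = [:d:]" by (metis degree_eq_zeroE)
  have "d \<noteq> 0" using assms(1) by (auto simp: c d)
  then have "F * [:[:inverse d:]:] = 1" by (simp add: c d one_pCons)
  then show ?thesis by (metis dvdI)
qed

subsection \<open>Generic curves of bidegree (2,2)\<close>

text \<open>Polynomial functions of \<open>u 0\<close>, ..., \<open>u (n - 1)\<close> built from
  constants in \<open>K\<close>. As functions rather than formal polynomials they make
  specialisation from one vector to another a mere change of argument.\<close>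

inductive_set polyfun :: "complex set \<Rightarrow> nat \<Rightarrow> ((nat \<Rightarrow> complex) \<Rightarrow> complex) set" for K n where
  const: "k \<in> K \<Longrightarrow> (\<lambda>_. k) \<in> polyfun K n"
| var: "i < n \<Longrightarrow> (\<lambda>u. u i) \<in> polyfun K n"
| diff: "F \<in> polyfun K n \<Longrightarrow> G \<in> polyfun K n \<Longrightarrow> (\<lambda>u. F u - G u) \<in> polyfun K n"
| mult: "F \<in> polyfun K n \<Longrightarrow> G \<in> polyfun K n \<Longrightarrow> (\<lambda>u. F u * G u) \<in> polyfun K n"

lemma polyfun_minus:
  assumes "0 \<in> K" "F \<in> polyfun K n"
  shows "(\<lambda>u. - F u) \<in> polyfun K n"
  using polyfun.diff[OF polyfun.const[OF assms(1)] assms(2)] by simp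

lemma polyfun_add:
  assumes "0 \<in> K" "F \<in> polyfun K n" "G \<in> polyfun K n"
  shows "(\<lambda>u. F u + G u) \<in> polyfun K n"
  using polyfun.diff[OF assms(2) polyfun_minus[OF assms(1,3)]] by simp

lemma polyfun_sum:
  assumes "0 \<in> K" "\<And>i. i \<in> A \<Longrightarrow> F i \<in> polyfun K n"
  shows "(\<lambda>u. \<Sum>i\<in>A. F i u) \<in> polyfun K n"
  using assms(2)
  by (induction A rule: infinite_finite_induct) (auto intro: polyfun.const polyfun_add assms(1))

lemma polyfun_in_acl: "F \<in> polyfun K n \<Longrightarrow> F u \<in> acl (K \<union> u ` {..<n})"
  by (induction rule: polyfun.induct) (auto intro: acl.base acl.diff acl.mult)

text \<open>Isolating the last variable lets specialisation proceed by induction, one transcendental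
  coordinate at a time.\<close>

lemma polyfun_Suc_expand:
  assumes K: "0 \<in> K" "1 \<in> K" and F: "F \<in> polyfun K (Suc n)"
  shows "\<exists>G :: _ \<Rightarrow> complex poly. (\<forall>i. (\<lambda>u. coeff (G u) i) \<in> polyfun K n) \<and> (\<forall>u. F u = poly (G u) (u n))"
  using F
proof induction
  case (const k)
  then show ?case
    using K by (intro exI[of _ "\<lambda>_. [:k:]"]) (auto simp: coeff_pCons split: nat.split intro: polyfun.const)
next
  case (var i)
  show ?case
  proof (cases "i = n")
    case True
    then show ?thesis
      using K by (intro exI[of _ "\<lambda>_. [:0, 1:]"]) (auto simp: coeff_pCons split: nat.split intro: polyfun.const)
  next
    case False
    then have i: "i < n" using var by simp
    have "(\<lambda>u. coeff [:u i:] j) \<in> polyfun K n" for j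
      using K i by (cases j) (auto intro: polyfun.const polyfun.var)
    then show ?thesis by (intro exI[of _ "\<lambda>u. [:u i:]"]) auto
  qed
next
  case (diff F H)
  then obtain G G' where "\<forall>i. (\<lambda>u. coeff (G u) i) \<in> polyfun K n" "\<forall>u. F u = poly (G u) (u n)"
    "\<forall>i. (\<lambda>u. coeff (G' u) i) \<in> polyfun K n" "\<forall>u. H u = poly (G' u) (u n)" by blast
  then show ?case by (intro exI[of _ "\<lambda>u. G u - G' u"]) (auto intro: polyfun.diff)
next
  case (mult F H)
  then obtain G G' where "\<forall>i. (\<lambda>u. coeff (G u) i) \<in> polyfun K n" "\<forall>u. F u = poly (G u) (u n)"
    "\<forall>i. (\<lambda>u. coeff (G' u) i) \<in> polyfun K n" "\<forall>u. H u = poly (G' u) (u n)" by blast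
  then show ?case
    using K by (intro exI[of _ "\<lambda>u. G u * G' u"]) (auto simp: coeff_mult intro!: polyfun_sum polyfun.mult)
qed

text \<open>Contrapositively, an inequation holds at a generic point as soon as it holds at one special point.\<close>

lemma polyfun_specialise:
  assumes K: "0 \<in> K" "1 \<in> K" and u: "\<And>i. i < n \<Longrightarrow> u i \<notin> acl (K \<union> u ` {..<i})"
    and F: "F \<in> polyfun K n" "F u = 0"
  shows "F v = 0"
  using u F
proof (induction n arbitrary: F v)
  case 0
  from 0(2) have "F v = F u" by (induction rule: polyfun.induct) auto
  then show ?case using 0(3) by simp
next
  case (Suc n)
  obtain G :: "_ \<Rightarrow> complex poly" where G: "\<And>i. (\<lambda>u. coeff (G u) i) \<in> polyfun K n"
    "\<And>u. F u = poly (G u) (u n)"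
    using polyfun_Suc_expand[OF K Suc.prems(2)] by blast
  have "G u = 0"
  proof (rule ccontr)
    assume "G u \<noteq> 0"
    then have "u n \<in> acl (K \<union> u ` {..<n})"
      using acl.root[of "G u" "K \<union> u ` {..<n}" "u n"] polyfun_in_acl[OF G(1)] G(2)[of u] Suc.prems(3)
      by simp
    then show False using Suc.prems(1)[of n] by simp
  qed
  then have "coeff (G v) i = 0" for i
    using Suc.IH[OF _ G(1)[of i], of v] Suc.prems(1) by simp
  then have "G v = 0" by (intro poly_eqI) auto
  then show ?case using G(2)[of v] by simp
qed

text \<open>The orbit of \<open>(0, 0)\<close> under the two involutions of the curve
  \<open>a1 y + a2 y^2 + b1 z + b2 z^2 + u0 y z + u1 y z^2 + u2 y^2 z + u3 y^2 z^2 = 0\<close>,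
  a point being stored as numerators and denominators \<open>(p, q, r, s)\<close> with \<open>y = p / q\<close>, \<open>z = r / s\<close>.\<close>

definition step :: "complex \<Rightarrow> complex \<Rightarrow> complex \<Rightarrow> complex \<Rightarrow> (nat \<Rightarrow> complex) \<Rightarrow>
    complex \<times> complex \<times> complex \<times> complex \<Rightarrow> complex \<times> complex \<times> complex \<times> complex" where
  "step a1 a2 b1 b2 u = (\<lambda>(p, q, r, s).
     let A = a2 * (s * s) + u 2 * (r * s) + u 3 * (r * r);
         B = a1 * (s * s) + u 0 * (r * s) + u 1 * (r * r);
         p' = - (p * A) - q * B; q' = q * A;
         A' = b2 * (q' * q') + u 1 * (p' * q') + u 3 * (p' * p');
         B' = b1 * (q' * q') + u 0 * (p' * q') + u 2 * (p' * p')
     in (p', q', - (r * A') - s * B', s * A'))"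

definition orb :: "complex \<Rightarrow> complex \<Rightarrow> complex \<Rightarrow> complex \<Rightarrow> (nat \<Rightarrow> complex) \<Rightarrow>
    nat \<Rightarrow> complex \<times> complex \<times> complex \<times> complex" where
  "orb a1 a2 b1 b2 u n = (step a1 a2 b1 b2 u ^^ n) (0, 1, 0, 1)"

lemma orb_SucD:
  assumes "orb a1 a2 b1 b2 u n = (p, q, r, s)" "orb a1 a2 b1 b2 u (Suc n) = (p', q', r', s')"
  shows "p' = - (p * (a2 * (s * s) + u 2 * (r * s) + u 3 * (r * r))) - q * (a1 * (s * s) + u 0 * (r * s) + u 1 * (r * r))"
    and "q' = q * (a2 * (s * s) + u 2 * (r * s) + u 3 * (r * r))"
    and "r' = - (r * (b2 * (q' * q') + u 1 * (p' * q') + u 3 * (p' * p'))) - s * (b1 * (q' * q') + u 0 * (p' * q') + u 2 * (p' * p'))"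
    and "s' = s * (b2 * (q' * q') + u 1 * (p' * q') + u 3 * (p' * p'))"
  using assms by (auto simp: orb_def step_def Let_def)

text \<open>Division would leave the polynomial functions; this is why numerators and denominators
  are carried separately. The four outer coefficients are constants, only the interior ones
  vary.\<close>

lemma polyfun_orb:
  assumes K: "0 \<in> K" "1 \<in> K" "a1 \<in> K" "a2 \<in> K" "b1 \<in> K" "b2 \<in> K"
  shows "\<exists>p q r s. p \<in> polyfun K 4 \<and> q \<in> polyfun K 4 \<and> r \<in> polyfun K 4 \<and> s \<in> polyfun K 4 \<and>
    (\<forall>u. orb a1 a2 b1 b2 u n = (p u, q u, r u, s u))"
proof (induction n)
  case 0
  show ?case
    using K(1,2)
    by (intro exI[of _ "\<lambda>_. 0"] exI[of _ "\<lambda>_. 1"] conjI polyfun.const) (simp_all add: orb_def)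
next
  case (Suc n)
  then obtain p q r s where IH: "p \<in> polyfun K 4" "q \<in> polyfun K 4" "r \<in> polyfun K 4" "s \<in> polyfun K 4"
    "\<And>u. orb a1 a2 b1 b2 u n = (p u, q u, r u, s u)" by blast
  note I = polyfun.mult polyfun_add[OF K(1)] polyfun.diff polyfun_minus[OF K(1)]
  have c: "(\<lambda>u. a1) \<in> polyfun K 4" "(\<lambda>u. a2) \<in> polyfun K 4" "(\<lambda>u. b1) \<in> polyfun K 4" "(\<lambda>u. b2) \<in> polyfun K 4"
    using K by (auto intro: polyfun.const)
  have v: "(\<lambda>u. u 0) \<in> polyfun K 4" "(\<lambda>u. u 1) \<in> polyfun K 4" "(\<lambda>u. u 2) \<in> polyfun K 4" "(\<lambda>u. u 3) \<in> polyfun K 4"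
    by (auto intro: polyfun.var)
  define A where "A = (\<lambda>u. a2 * (s u * s u) + u 2 * (r u * s u) + u 3 * (r u * r u))"
  define B where "B = (\<lambda>u. a1 * (s u * s u) + u 0 * (r u * s u) + u 1 * (r u * r u))"
  have AB: "A \<in> polyfun K 4" "B \<in> polyfun K 4"
    unfolding A_def B_def by (intro I c v IH)+
  define p' where "p' = (\<lambda>u. - (p u * A u) - q u * B u)"
  define q' where "q' = (\<lambda>u. q u * A u)"
  have pq: "p' \<in> polyfun K 4" "q' \<in> polyfun K 4"
    unfolding p'_def q'_def by (intro I AB IH)+
  define A' where "A' = (\<lambda>u. b2 * (q' u * q' u) + u 1 * (p' u * q' u) + u 3 * (p' u * p' u))"
  define B' where "B' = (\<lambda>u. b1 * (q' u * q' u) + u 0 * (p' u * q' u) + u 2 * (p' u * p' u))"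
  have AB': "A' \<in> polyfun K 4" "B' \<in> polyfun K 4"
    unfolding A'_def B'_def by (intro I c v pq)+
  have rs: "(\<lambda>u. - (r u * A' u) - s u * B' u) \<in> polyfun K 4" "(\<lambda>u. s u * A' u) \<in> polyfun K 4"
    by (intro I AB' IH)+
  have "orb a1 a2 b1 b2 u (Suc n) = (p' u, q' u, - (r u * A' u) - s u * B' u, s u * A' u)" for u
  proof -
    have "orb a1 a2 b1 b2 u (Suc n) = step a1 a2 b1 b2 u (p u, q u, r u, s u)"
      using IH(5)[of u] by (simp add: orb_def)
    then show ?thesis by (simp add: step_def Let_def A_def B_def p'_def q'_def A'_def B'_def)
  qed
  then show ?case using pq rs by blast
qed

text \<open>With the yz-term \<open>t\<close> as the only interior one, the curve is a conic and
  both involutions are affine: y becomes -y - \<alpha> - (t/a2) z, and similarly for z. The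
  denominators are products of powers of \<open>a2\<close> and \<open>b2\<close>, and for large
  \<open>t\<close> the orbit of the origin escapes to infinity.\<close>

lemma orb_special:
  assumes nz: "a1 \<noteq> 0" "a2 \<noteq> 0" "b2 \<noteq> 0"
  shows "\<exists>t. (\<forall>n. fst (snd (orb a1 a2 b1 b2 ((\<lambda>_. 0)(0 := t)) n)) \<noteq> 0 \<and>
      snd (snd (snd (orb a1 a2 b1 b2 ((\<lambda>_. 0)(0 := t)) n))) \<noteq> 0) \<and>
    inj_on (\<lambda>n. fst (orb a1 a2 b1 b2 ((\<lambda>_. 0)(0 := t)) n) / fst (snd (orb a1 a2 b1 b2 ((\<lambda>_. 0)(0 := t)) n))) {1..}"
proof -
  define \<alpha> \<beta> where "\<alpha> = a1 / a2" and "\<beta> = b1 / b2"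
  have \<alpha>: "cmod \<alpha> > 0" using nz by (simp add: \<alpha>_def)
  \<comment> \<open>The summands 3, \<open>cmod \<alpha>\<close> and \<open>cmod \<beta>\<close> let
    every later move at least double the norm. The quotient is there for the start: the first
    y-value is -\<alpha>, and the z-value following it has to dominate it.\<close>
  define T where "T = 3 + cmod \<alpha> + cmod \<beta> + (1 + cmod \<beta>) / cmod \<alpha>"
  \<comment> \<open>The sum of both norms makes the quotients of \<open>t\<close> by
    \<open>a2\<close> and by \<open>b2\<close> large at once.\<close>
  define t where "t = complex_of_real (T * (cmod a2 + cmod b2))"
  have T0: "T \<ge> 0" using \<alpha> by (simp add: T_def)
  have "cmod t = T * (cmod a2 + cmod b2)" using T0 by (simp add: t_def del: of_real_mult of_real_add)
  then have "cmod t \<ge> T * cmod a2" "cmod t \<ge> T * cmod b2" using T0 by (auto simp: distrib_left)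
  then have T: "cmod (t / a2) \<ge> T" "cmod (t / b2) \<ge> T"
    using nz by (simp_all add: norm_divide field_simps)
  have T1: "T \<ge> 3 + cmod \<alpha> + cmod \<beta>" and T2: "T * cmod \<alpha> \<ge> cmod \<alpha> + 1 + cmod \<beta>"
  proof -
    show "T \<ge> 3 + cmod \<alpha> + cmod \<beta>" using \<alpha> by (simp add: T_def)
    have "1 + (1 + cmod \<beta>) / cmod \<alpha> \<le> T" by (simp add: T_def)
    then have "(1 + (1 + cmod \<beta>) / cmod \<alpha>) * cmod \<alpha> \<le> T * cmod \<alpha>"
      using \<alpha> by (intro mult_right_mono) auto
    also have "(1 + (1 + cmod \<beta>) / cmod \<alpha>) * cmod \<alpha> = cmod \<alpha> + (1 + cmod \<beta>)"
    proof -
      have "(1 + cmod \<beta>) / cmod \<alpha> * cmod \<alpha> = 1 + cmod \<beta>" using \<alpha> by simp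
      then show ?thesis unfolding distrib_right[of 1] by linarith
    qed
    finally show "T * cmod \<alpha> \<ge> cmod \<alpha> + 1 + cmod \<beta>" by simp
  qed
  define u where "u = (\<lambda>_ :: nat. 0 :: complex)(0 := t)"
  define P where "P = (\<lambda>n. fst (orb a1 a2 b1 b2 u n))"
  define Q where "Q = (\<lambda>n. fst (snd (orb a1 a2 b1 b2 u n)))"
  define R where "R = (\<lambda>n. fst (snd (snd (orb a1 a2 b1 b2 u n))))"
  define S where "S = (\<lambda>n. snd (snd (snd (orb a1 a2 b1 b2 u n))))"
  define y where "y = (\<lambda>n. P n / Q n)"
  define z where "z = (\<lambda>n. R n / S n)"
  have init: "P 0 = 0" "Q 0 = 1" "R 0 = 0" "S 0 = 1" by (simp_all add: P_def Q_def R_def S_def orb_def)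
  have Suc: "P (Suc n) = - (P n * (a2 * (S n * S n))) - Q n * (a1 * (S n * S n) + t * (R n * S n))"
    "Q (Suc n) = Q n * (a2 * (S n * S n))"
    "R (Suc n) = - (R n * (b2 * (Q (Suc n) * Q (Suc n)))) - S n * (b1 * (Q (Suc n) * Q (Suc n)) + t * (P (Suc n) * Q (Suc n)))"
    "S (Suc n) = S n * (b2 * (Q (Suc n) * Q (Suc n)))" for n
    by (simp_all add: P_def Q_def R_def S_def orb_def step_def Let_def u_def split: prod.split)
  have nz': "Q n \<noteq> 0 \<and> S n \<noteq> 0" for n
    by (induction n) (use nz in \<open>auto simp: init Suc\<close>)
  have y: "y (Suc n) = - y n - \<alpha> - (t / a2) * z n" for n
    using nz' nz by (simp add: y_def z_def Suc(1,2) \<alpha>_def field_simps)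
  have z: "z (Suc n) = - z n - \<beta> - (t / b2) * y (Suc n)" for n
    using nz' nz by (simp add: y_def z_def Suc(3,4) \<beta>_def field_simps)
  have tri: "cmod (- a - b - c * d) \<ge> T * cmod d - cmod a - cmod b" if "cmod c \<ge> T" for a b c d
  proof -
    have "T * cmod d \<le> cmod (c * d)" using that by (simp add: norm_mult mult_right_mono)
    also have "c * d = - ((- a - b - c * d) + a + b)" by simp
    also have "cmod \<dots> \<le> cmod (- a - b - c * d) + cmod a + cmod b"
      by (metis norm_minus_cancel norm_triangle_le norm_triangle_ineq add_mono order_refl)
    finally show ?thesis by simp
  qed
  have stepy: "cmod (y (Suc n)) \<ge> 2 * cmod (z n)" if "cmod (z n) \<ge> 1" "cmod (z n) \<ge> cmod (y n)" for n
  proof -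
    have "cmod \<alpha> * 1 \<le> cmod \<alpha> * cmod (z n)" using that by (intro mult_left_mono) auto
    moreover have "(3 + cmod \<alpha>) * cmod (z n) \<le> T * cmod (z n)"
      using T1 by (intro mult_right_mono) (auto intro: order_trans[rotated])
    moreover have "cmod (y (Suc n)) \<ge> T * cmod (z n) - cmod (y n) - cmod \<alpha>"
      unfolding y by (rule tri[OF T(1)])
    ultimately show ?thesis using that unfolding distrib_right by linarith
  qed
  have stepz: "cmod (z (Suc n)) \<ge> 2 * cmod (y (Suc n))"
    if "cmod (y (Suc n)) \<ge> 1" "cmod (y (Suc n)) \<ge> cmod (z n)" for n
  proof -
    have "cmod \<beta> * 1 \<le> cmod \<beta> * cmod (y (Suc n))" using that by (intro mult_left_mono) auto
    moreover have "(3 + cmod \<beta>) * cmod (y (Suc n)) \<le> T * cmod (y (Suc n))"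
      using T1 by (intro mult_right_mono) (auto intro: order_trans[rotated])
    moreover have "cmod (z (Suc n)) \<ge> T * cmod (y (Suc n)) - cmod (z n) - cmod \<beta>"
      unfolding z by (rule tri[OF T(2)])
    ultimately show ?thesis using that unfolding distrib_right by linarith
  qed
  \<comment> \<open>From the first z-value on, z dominates y and has norm at least 1; this is the
    situation in which the two doubling estimates alternate.\<close>
  have inv: "cmod (z (Suc n)) \<ge> 1 \<and> cmod (z (Suc n)) \<ge> cmod (y (Suc n))" for n
  proof (induction n)
    case 0
    have "y 0 = 0" "z 0 = 0" by (simp_all add: y_def z_def init)
    then have "y (Suc 0) = - \<alpha>" using y[of 0] by simp
    moreover have "cmod (z (Suc 0)) \<ge> T * cmod (y (Suc 0)) - cmod (z 0) - cmod \<beta>"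
      unfolding z by (rule tri[OF T(2)])
    ultimately have "cmod (z (Suc 0)) \<ge> T * cmod \<alpha> - cmod \<beta>" "cmod (y (Suc 0)) = cmod \<alpha>"
      using \<open>z 0 = 0\<close> by simp_all
    then show ?case using T2 \<alpha> by linarith
  next
    case (Suc n)
    then show ?case using stepy[of "Suc n"] stepz[of "Suc n"] by linarith
  qed
  have less: "cmod (y (Suc n)) < cmod (y (Suc (Suc n)))" for n
    using inv[of n] stepy[of "Suc n"] by linarith
  have "strict_mono (\<lambda>n. cmod (y (Suc n)))"
    using less by (intro strict_monoI_Suc) auto
  then have "inj (\<lambda>n. cmod (y (Suc n)))" by (rule strict_mono_imp_inj_on)
  have "inj_on y {1..}"
  proof (rule inj_onI)
    fix m n assume mn: "m \<in> {1..}" "n \<in> {1..}" "y m = y n"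
    then have "m - 1 = n - 1"
      using injD[OF \<open>inj (\<lambda>n. cmod (y (Suc n)))\<close>, of "m - 1" "n - 1"] by simp
    then show "m = n" using mn by auto
  qed
  then show ?thesis
    using nz' unfolding y_def P_def Q_def S_def u_def by (intro exI[of _ t]) auto
qed

text \<open>If each interior coefficient were transcendental over all the others, what holds for the
  special orbit would hold here: no denominator vanishes and the y-values are distinct. A finite set
  that contains the origin and is closed under both involutions contradicts this.\<close>

lemma biquadratic_orbit_infinite_aux:
  fixes f :: "nat \<Rightarrow> nat \<Rightarrow> complex"
  assumes nz: "f 1 0 \<noteq> 0" "f 2 0 \<noteq> 0" "f 0 2 \<noteq> 0"
    and S: "finite S" "(0, 0) \<in> S"
    and cly: "\<And>y z. (y, z) \<in> S \<Longrightarrow> f 2 0 + f 2 1 * z + f 2 2 * z\<^sup>2 \<noteq> 0 \<Longrightarrow>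
      (- y - (f 1 0 + f 1 1 * z + f 1 2 * z\<^sup>2) / (f 2 0 + f 2 1 * z + f 2 2 * z\<^sup>2), z) \<in> S"
    and clz: "\<And>y z. (y, z) \<in> S \<Longrightarrow> f 0 2 + f 1 2 * y + f 2 2 * y\<^sup>2 \<noteq> 0 \<Longrightarrow>
      (y, - z - (f 0 1 + f 1 1 * y + f 2 1 * y\<^sup>2) / (f 0 2 + f 1 2 * y + f 2 2 * y\<^sup>2)) \<in> S"
  shows "\<exists>j\<in>{1,2}. \<exists>k\<in>{1,2}. f j k \<in> acl ((\<lambda>(a, b). f a b) ` ({..2} \<times> {..2} - {(j, k)}))"
proof (rule ccontr)
  assume neg: "\<not> ?thesis"
  define K where "K = acl {f 1 0, f 2 0, f 0 1, f 0 2}"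
  define u where "u = (\<lambda>i :: nat. if i = 0 then f 1 1 else if i = 1 then f 1 2 else if i = 2 then f 2 1 else f 2 2)"
  \<comment> \<open>\<open>u\<close> lists the interior coefficients in the order of
    \<open>step\<close>. Each avoids even the closure of all other coefficients of the curve, in
    particular that of \<open>K\<close> and its predecessors.\<close>
  have u: "u i \<notin> acl (K \<union> u ` {..<i})" if "i < 4" for i
  proof -
    define j where "j = (if i \<le> 1 then 1 else 2 :: nat)"
    define k where "k = (if i = 0 \<or> i = 2 then 1 else 2 :: nat)"
    have ui: "u i = f j k" using that by (auto simp: u_def j_def k_def)
    define W where "W = ((\<lambda>(a, b). f a b) ` ({..2} \<times> {..2} - {(j, k)}))"
    have W: "f a b \<in> W" if "a \<le> 2" "b \<le> 2" "(a, b) \<noteq> (j, k)" for a b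
      unfolding W_def by (rule image_eqI[of _ _ "(a, b)"]) (use that in auto)
    have "{f 1 0, f 2 0, f 0 1, f 0 2} \<subseteq> W" using W by (auto simp: j_def k_def)
    then have "K \<subseteq> acl W" unfolding K_def by (rule acl_mono)
    moreover have "u l \<in> W" if "l < i" for l
      using that \<open>i < 4\<close> W[of 1 1] W[of 1 2] W[of 2 1] by (auto simp: u_def j_def k_def split: if_splits)
    then have "u ` {..<i} \<subseteq> acl W" using acl_subset by blast
    ultimately have "acl (K \<union> u ` {..<i}) \<subseteq> acl W" by (intro acl_minimal) blast
    moreover have "j \<in> {1, 2}" "k \<in> {1, 2}" by (auto simp: j_def k_def)
    then have "f j k \<notin> acl W" using neg unfolding W_def by blast
    ultimately show ?thesis unfolding ui by blast
  qed
  have K: "0 \<in> K" "1 \<in> K" "f 1 0 \<in> K" "f 2 0 \<in> K" "f 0 1 \<in> K" "f 0 2 \<in> K"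
    by (auto simp: K_def intro: acl.one acl.base)
  obtain p q r s where pf: "\<And>n. p n \<in> polyfun K 4" "\<And>n. q n \<in> polyfun K 4" "\<And>n. s n \<in> polyfun K 4"
    and orb: "\<And>n u. orb (f 1 0) (f 2 0) (f 0 1) (f 0 2) u n = (p n u, q n u, r n u, s n u)"
    using polyfun_orb[OF K] by metis
  obtain t where t: "\<And>n. q n ((\<lambda>_. 0)(0 := t)) \<noteq> 0" "\<And>n. s n ((\<lambda>_. 0)(0 := t)) \<noteq> 0"
    "inj_on (\<lambda>n. p n ((\<lambda>_. 0)(0 := t)) / q n ((\<lambda>_. 0)(0 := t))) {1..}"
    using orb_special[OF nz, of "f 0 1"] unfolding orb by auto
  have special: "F v = 0" if "F \<in> polyfun K 4" "F u = 0" for F v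
    using polyfun_specialise[OF K(1,2) _ that, of v] u by blast
  have nz': "q n u \<noteq> 0" "s n u \<noteq> 0" for n
    using special[OF pf(2)[of n]] special[OF pf(3)[of n]] t(1,2)[of n] by blast+
  have inS: "(p n u / q n u, r n u / s n u) \<in> S" for n
  proof (induction n)
    case 0
    have "p 0 u = 0" "r 0 u = 0" using orb[of u 0] by (simp_all add: orb_def)
    then show ?case using S(2) by simp
  next
    case (Suc n)
    have u': "u 0 = f 1 1" "u 1 = f 1 2" "u 2 = f 2 1" "u 3 = f 2 2" by (simp_all add: u_def)
    define y z where "y = p n u / q n u" and "z = r n u / s n u"
    define A where "A = f 2 0 + f 2 1 * z + f 2 2 * z\<^sup>2"
    define B where "B = f 1 0 + f 1 1 * z + f 1 2 * z\<^sup>2"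
    define y' where "y' = p (Suc n) u / q (Suc n) u"
    define A' where "A' = f 0 2 + f 1 2 * y' + f 2 2 * y'\<^sup>2"
    define B' where "B' = f 0 1 + f 1 1 * y' + f 2 1 * y'\<^sup>2"
    \<comment> \<open>Dehomogenisation, which turns \<open>step\<close> into the involution formulas
      for y = p/q and z = r/s.\<close>
    have hom: "c0 * (s * s) + c1 * (r * s) + c2 * (r * r) = (c0 + c1 * (r / s) + c2 * (r / s)\<^sup>2) * (s * s)"
      if "s \<noteq> 0" for c0 c1 c2 r s :: complex
    proof -
      define x where "x = r / s"
      have r: "r = x * s" using that by (simp add: x_def)
      show ?thesis unfolding x_def[symmetric] unfolding r power2_eq_square by (simp add: algebra_simps)
    qed
    note raw = orb_SucD[OF orb[of u n] orb[of u "Suc n"], unfolded u']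
    have st: "p (Suc n) u = - (p n u * (A * (s n u * s n u))) - q n u * (B * (s n u * s n u))"
      "q (Suc n) u = q n u * (A * (s n u * s n u))"
      "r (Suc n) u = - (r n u * (A' * (q (Suc n) u * q (Suc n) u))) - s n u * (B' * (q (Suc n) u * q (Suc n) u))"
      "s (Suc n) u = s n u * (A' * (q (Suc n) u * q (Suc n) u))"
      using raw unfolding hom[OF nz'(2)] hom[OF nz'(1)] A_def B_def A'_def B'_def y'_def z_def .
    have A: "A \<noteq> 0" "A' \<noteq> 0" using st(2,4) nz'[of "Suc n"] by auto
    have "y' = - y - B / A"
      unfolding y'_def y_def st(1) st(2) using A nz'[of n] by (simp add: field_simps)
    moreover have "r (Suc n) u / s (Suc n) u = - z - B' / A'"
      unfolding z_def st(3) st(4) using A nz'[of n] nz'[of "Suc n"] by (simp add: field_simps)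
    moreover have "(- y - B / A, z) \<in> S"
      using cly[of y z] Suc A(1) unfolding A_def B_def y_def z_def by blast
    ultimately show ?case
      using clz[of y' z] A(2) unfolding y'_def[symmetric] A'_def B'_def by simp
  qed
  have "finite (fst ` S)" using S(1) by simp
  moreover have "(\<lambda>n. p n u / q n u) ` {1..} \<subseteq> fst ` S" using inS by force
  ultimately have "finite ((\<lambda>n. p n u / q n u) ` {1 :: nat..})" by (rule rev_finite_subset)
  \<comment> \<open>A repetition among the y-values is, after cross-multiplication, a polynomial
    relation between the interior coefficients; specialised, it contradicts injectivity on the
    special orbit.\<close>
  then have "\<not> inj_on (\<lambda>n. p n u / q n u) {1..}"
    using infinite_Ici finite_imageD by blast
  then obtain m n where mn: "m \<ge> 1" "n \<ge> 1" "m \<noteq> n" "p m u / q m u = p n u / q n u"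
    by (auto simp: inj_on_def)
  have "(\<lambda>u. p m u * q n u - p n u * q m u) \<in> polyfun K 4"
    by (intro polyfun.diff polyfun.mult pf)
  moreover have "p m u * q n u - p n u * q m u = 0"
    using mn(4) unfolding frac_eq_eq[OF nz'(1) nz'(1)] by simp
  ultimately have "p m ((\<lambda>_. 0)(0 := t)) * q n ((\<lambda>_. 0)(0 := t)) - p n ((\<lambda>_. 0)(0 := t)) * q m ((\<lambda>_. 0)(0 := t)) = 0"
    by (rule special)
  then have "p m ((\<lambda>_. 0)(0 := t)) / q m ((\<lambda>_. 0)(0 := t)) = p n ((\<lambda>_. 0)(0 := t)) / q n ((\<lambda>_. 0)(0 := t))"
    unfolding frac_eq_eq[OF t(1) t(1)] by (simp only: right_minus_eq)
  then show False
    using t(3)[unfolded inj_on_def, THEN bspec, of m, THEN bspec, of n] mn(1,2,3) by simp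
qed


text \<open>The recursion moves y first, which fixes the origin when \<open>f 1 0 = 0\<close>. In
  that case \<open>f 0 1\<close> is nonzero and the variables are exchanged.\<close>

lemma biquadratic_orbit_infinite:
  fixes f :: "nat \<Rightarrow> nat \<Rightarrow> complex"
  assumes nz: "f 1 0 \<noteq> 0 \<or> f 0 1 \<noteq> 0" "f 2 0 \<noteq> 0" "f 0 2 \<noteq> 0"
    and S: "finite S" "(0, 0) \<in> S"
    and cly: "\<And>y z. (y, z) \<in> S \<Longrightarrow> f 2 0 + f 2 1 * z + f 2 2 * z\<^sup>2 \<noteq> 0 \<Longrightarrow>
      (- y - (f 1 0 + f 1 1 * z + f 1 2 * z\<^sup>2) / (f 2 0 + f 2 1 * z + f 2 2 * z\<^sup>2), z) \<in> S"
    and clz: "\<And>y z. (y, z) \<in> S \<Longrightarrow> f 0 2 + f 1 2 * y + f 2 2 * y\<^sup>2 \<noteq> 0 \<Longrightarrow>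
      (y, - z - (f 0 1 + f 1 1 * y + f 2 1 * y\<^sup>2) / (f 0 2 + f 1 2 * y + f 2 2 * y\<^sup>2)) \<in> S"
  shows "\<exists>j\<in>{1,2}. \<exists>k\<in>{1,2}. f j k \<in> acl ((\<lambda>(a, b). f a b) ` ({..2} \<times> {..2} - {(j, k)}))"
proof (cases "f 1 0 = 0")
  case False
  from this nz(2,3) S cly clz show ?thesis by (rule biquadratic_orbit_infinite_aux)
next
  case True
  define g where "g = (\<lambda>a b. f b a)"
  have swap: "(y, z) \<in> prod.swap ` S \<longleftrightarrow> (z, y) \<in> S" for y z by force
  have "\<exists>j\<in>{1,2}. \<exists>k\<in>{1,2}. g j k \<in> acl ((\<lambda>(a, b). g a b) ` ({..2} \<times> {..2} - {(j, k)}))"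
  proof (rule biquadratic_orbit_infinite_aux)
    show "g 1 0 \<noteq> 0" "g 2 0 \<noteq> 0" "g 0 2 \<noteq> 0" using nz True by (auto simp: g_def)
    show "finite (prod.swap ` S)" "(0, 0) \<in> prod.swap ` S" using S by (simp_all add: swap)
  qed (use cly clz in \<open>simp_all only: swap g_def\<close>)
  then obtain j where j: "j \<in> {1, 2}"
    and ex: "\<exists>k\<in>{1,2}. g j k \<in> acl ((\<lambda>(a, b). g a b) ` ({..2} \<times> {..2} - {(j, k)}))" by (rule bexE)
  from ex obtain k where k: "k \<in> {1, 2}"
    and jk: "g j k \<in> acl ((\<lambda>(a, b). g a b) ` ({..2} \<times> {..2} - {(j, k)}))" by (rule bexE)
  have "((\<lambda>(a, b). g a b) ` ({..2} \<times> {..2} - {(j, k)})) \<subseteq>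
      ((\<lambda>(a, b). f a b) ` ({..2} \<times> {..2} - {(k, j)}))"
  proof
    fix x assume "x \<in> ((\<lambda>(a, b). g a b) ` ({..2} \<times> {..2} - {(j, k)}))"
    then obtain a b where x: "x = f b a" and ab: "(a, b) \<in> {..2} \<times> {..2} - {(j, k)}"
      by (auto simp: g_def)
    from ab have "(b, a) \<in> {..2} \<times> {..2} - {(k, j)}" by auto
    then show "x \<in> (\<lambda>(a, b). f a b) ` ({..2} \<times> {..2} - {(k, j)})"
      by (rule rev_image_eqI) (simp add: x)
  qed
  from subsetD[OF acl_mono[OF this] jk] have "f k j \<in> acl ((\<lambda>(a, b). f a b) ` ({..2} \<times> {..2} - {(k, j)}))"
    unfolding g_def .
  then show ?thesis using j k by (intro bexI[of _ k] bexI[of _ j])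
qed

subsection \<open>Forms of multidegree (2,2,2)\<close>

lemma prod_UNIV_2: "(\<Prod>j\<in>(UNIV :: 2 set). f j) = f 0 * f 1"
proof -
  have U: "UNIV = {0 :: 2, 1}" using two_cases by auto
  show ?thesis unfolding U by simp
qed

lemma sum_atMost_2: "(\<Sum>a\<le>(2::nat). f a) = f 0 + f 1 + f 2"
  by (simp add: numeral_2_eq_2)

lemma le_2_cases: "(n :: nat) \<le> 2 \<Longrightarrow> n = 0 \<or> n = 1 \<or> n = 2"
  by auto

lemma vec2_eq_iff: "(u :: complex ^ 2) = v \<longleftrightarrow> u $ 0 = v $ 0 \<and> u $ 1 = v $ 1"
  by (metis vec_eq_iff two_cases)

definition form :: "((3 \<Rightarrow> nat) \<Rightarrow> complex) \<Rightarrow> (3 \<Rightarrow> complex ^ 2) \<Rightarrow> complex" where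
  "form c v = (\<Sum>e\<in>idx. c e * (\<Prod>i\<in>UNIV. (v i $ 0) ^ e i * (v i $ 1) ^ (2 - e i)))"

lemma monom_eval_mon:
  "monom_eval (coord_fun v) (mon e) = (\<Prod>i\<in>UNIV. (v i $ 0) ^ e i * (v i $ 1) ^ (2 - e i))"
proof -
  have "monom_eval (coord_fun v) (mon e) =
      (\<Prod>z\<in>UNIV \<times> UNIV. coord_fun v z ^ Poly_Mapping.lookup (mon e) z)"
    by (subst monom_eval_superset[of UNIV]) auto
  also have "\<dots> = (\<Prod>i\<in>UNIV. \<Prod>j\<in>UNIV. (v i $ j) ^ Poly_Mapping.lookup (mon e) (i, j))"
    by (subst prod.cartesian_product) (simp add: split_def)
  finally show ?thesis by (simp add: prod_UNIV_2 lookup_mon)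
qed

lemma poly_eval_form:
  assumes "P \<in> sections_L"
  shows "poly_eval (coord_fun v) P = form (cf P) v"
proof -
  have "Poly_Mapping.keys P \<subseteq> mon ` idx"
    using assms by (auto simp: sections_L_def multihomogeneous_def multidegree_eq_2_iff)
  then have "poly_eval (coord_fun v) P = (\<Sum>m\<in>mon ` idx. Poly_Mapping.lookup P m * monom_eval (coord_fun v) m)"
    by (intro poly_eval_superset) auto
  then show ?thesis
    by (simp add: sum.reindex[OF inj_mon] form_def cf_def monom_eval_mon)
qed

text \<open>It serves in two ways: its vanishing on nonzero vectors means equality of projective
  points, and \<open>det2 u\<close> is the linear form with root \<open>u\<close>, so that roots
  become factors.\<close>

definition det2 :: "complex ^ 2 \<Rightarrow> complex ^ 2 \<Rightarrow> complex" where
  "det2 u v = u $ 0 * v $ 1 - u $ 1 * v $ 0"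

lemma det2_self [simp]: "det2 u u = 0"
  by (simp add: det2_def)

lemma det2_zero [simp]: "det2 0 u = 0" "det2 u 0 = 0"
  by (simp_all add: det2_def)

lemma det2_scale [simp]: "det2 (k *s u) v = k * det2 u v" "det2 u (k *s v) = k * det2 u v"
  by (simp_all add: det2_def algebra_simps)

lemma det2_add: "det2 (u + u') v = det2 u v + det2 u' v" "det2 u (v + v') = det2 u v + det2 u v'"
  by (simp_all add: det2_def algebra_simps)

lemma det2_swap: "det2 u v = - det2 v u"
  by (simp add: det2_def)

lemma det2_expand:
  assumes "det2 e d \<noteq> 0"
  shows "u = (det2 u d / det2 e d) *s e + (det2 e u / det2 e d) *s d"
proof -
  have "det2 u d * e $ j + det2 e u * d $ j = det2 e d * u $ j" for j
    using two_cases[of j] by (auto simp: det2_def algebra_simps)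
  from this[of 0] this[of 1] show ?thesis using assms by (simp add: vec2_eq_iff field_simps)
qed

lemma det2_eq_0_imp:
  assumes "det2 u v = 0" "u \<noteq> 0"
  shows "\<exists>k. v = k *s u"
proof (cases "u $ 0 = 0")
  case False
  then show ?thesis using assms
    by (intro exI[of _ "v $ 0 / u $ 0"]) (simp add: vec2_eq_iff det2_def field_simps)
next
  case True
  then have "u $ 1 \<noteq> 0" using assms(2) by (auto simp: vec2_eq_iff)
  then show ?thesis using assms
    by (intro exI[of _ "v $ 1 / u $ 1"]) (simp add: vec2_eq_iff det2_def field_simps)
qed

lemma abs_p1_eq_iff:
  assumes "u \<noteq> 0" "v \<noteq> 0"
  shows "abs_p1 u = abs_p1 v \<longleftrightarrow> det2 u v = 0"
proof -
  have r: "w \<noteq> 0 \<and> w \<noteq> 0 \<and> (\<exists>c. c \<noteq> 0 \<and> w = c *s w)" if "w \<noteq> 0" for w :: "complex ^ 2"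
    using that by (auto intro!: exI[of _ 1])
  have "abs_p1 u = abs_p1 v \<longleftrightarrow> (\<exists>c. c \<noteq> 0 \<and> v = c *s u)"
    using Quotient3_rel[OF Quotient3_p1, of u v] r[OF assms(1)] r[OF assms(2)] assms by blast
  also have "\<dots> \<longleftrightarrow> det2 u v = 0"
    using det2_eq_0_imp[of u v] assms by auto
  finally show ?thesis .
qed

section \<open>Points of the surface and its equation in each factor\<close>

definition nz :: "(3 \<Rightarrow> complex ^ 2) \<Rightarrow> bool" where
  "nz v \<longleftrightarrow> (\<forall>i. v i \<noteq> 0)"

definition pt :: "(3 \<Rightarrow> complex ^ 2) \<Rightarrow> point" where
  "pt v = (\<lambda>i. abs_p1 (v i))"

lemma hom_coords_iff: "v \<in> hom_coords x \<longleftrightarrow> nz v \<and> pt v = x"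
  by (auto simp: hom_coords_def nz_def pt_def fun_eq_iff)

lemma pt_upd: "pt (v(i := u)) = (pt v)(i := abs_p1 u)"
  by (auto simp: pt_def)

lemma nz_upd: "nz v \<Longrightarrow> u \<noteq> 0 \<Longrightarrow> nz (v(i := u))"
  by (auto simp: nz_def)

lemma pt_rep: "\<exists>v. nz v \<and> pt v = x"
  using hom_coords_nonempty[of x] hom_coords_iff by blast

lemma p1_rep: "\<exists>u. u \<noteq> 0 \<and> abs_p1 u = x"
  using pt_rep[of "\<lambda>_. x"] by (auto simp: nz_def pt_def fun_eq_iff)

definition surf :: "((3 \<Rightarrow> nat) \<Rightarrow> complex) \<Rightarrow> point set" where
  "surf c = {x. \<forall>v\<in>hom_coords x. form c v = 0}"

lemma vanishes_at_surf: "P \<in> sections_L \<Longrightarrow> {x. vanishes_at P x} = surf (cf P)"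
  by (auto simp: vanishes_at_def surf_def poly_eval_form)

lemma form_scale: "form c (\<lambda>i. k i *s v i) = (\<Prod>i\<in>UNIV. (k i)\<^sup>2) * form c v"
proof -
  have "(k * x) ^ e * (k * y) ^ (2 - e) = k\<^sup>2 * (x ^ e * y ^ (2 - e))" if "e \<le> 2" for e :: nat and k x y :: complex
    using le_2_cases[OF that] by (auto simp: power2_eq_square)
  then have "(\<Prod>i\<in>UNIV. ((k i *s v i) $ 0) ^ e i * ((k i *s v i) $ 1) ^ (2 - e i)) =
      (\<Prod>i\<in>UNIV. (k i)\<^sup>2) * (\<Prod>i\<in>UNIV. (v i $ 0) ^ e i * (v i $ 1) ^ (2 - e i))"
    if "e \<in> idx" for e
    unfolding prod.distrib[symmetric] using that by (intro prod.cong) (auto simp: idx_def)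
  then show ?thesis
    unfolding form_def sum_distrib_left by (intro sum.cong) (auto simp: mult_ac)
qed

lemma pt_in_surf:
  assumes "nz v"
  shows "pt v \<in> surf c \<longleftrightarrow> form c v = 0"
proof
  assume v: "form c v = 0"
  have v': "v \<in> hom_coords (pt v)" using assms by (simp add: hom_coords_iff)
  have "form c w = 0" if w: "w \<in> hom_coords (pt v)" for w
  proof -
    obtain k where "w = (\<lambda>i. k i *s v i)" using hom_coords_scale[OF v' w] by blast
    then show ?thesis using v by (simp add: form_scale)
  qed
  then show "pt v \<in> surf c" by (simp add: surf_def)
qed (use assms in \<open>auto simp: surf_def hom_coords_iff\<close>)

text \<open>The equation as a binary quadratic form in the \<open>i\<close>-th factor: the
  coefficient of the \<open>a\<close>-th power of the first coordinate, depending only on the other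
  two components of \<open>v\<close>.\<close>

definition slot :: "((3 \<Rightarrow> nat) \<Rightarrow> complex) \<Rightarrow> (3 \<Rightarrow> complex ^ 2) \<Rightarrow> 3 \<Rightarrow> nat \<Rightarrow> complex" where
  "slot c v i a = (\<Sum>e\<in>{e \<in> idx. e i = a}. c e *
     (\<Prod>l\<in>UNIV - {i}. (v l $ 0) ^ e l * (v l $ 1) ^ (2 - e l)))"

lemma form_slot:
  "form c (v(i := u)) = slot c v i 0 * (u $ 1)\<^sup>2 + slot c v i 1 * (u $ 0 * u $ 1) + slot c v i 2 * (u $ 0)\<^sup>2"
proof -
  let ?g = "\<lambda>e. c e * (\<Prod>l\<in>UNIV. ((v(i := u)) l $ 0) ^ e l * ((v(i := u)) l $ 1) ^ (2 - e l))"
  have g: "?g e = c e * (\<Prod>l\<in>UNIV - {i}. (v l $ 0) ^ e l * (v l $ 1) ^ (2 - e l)) * ((u $ 0) ^ e i * (u $ 1) ^ (2 - e i))" for e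
    by (subst prod.remove[of UNIV i]) (auto intro!: prod.cong)
  have "form c (v(i := u)) = (\<Sum>a\<in>{..2}. \<Sum>e\<in>{e \<in> idx. e i = a}. ?g e)"
    unfolding form_def
    by (rule sum.group[symmetric]) (simp_all, auto simp: idx_def)
  also have "\<dots> = (\<Sum>a\<le>2. slot c v i a * ((u $ 0) ^ a * (u $ 1) ^ (2 - a)))"
    unfolding g slot_def sum_distrib_right by (intro sum.cong) auto
  finally show ?thesis by (simp add: sum_atMost_2)
qed

lemma slot_upd [simp]: "slot c (v(i := u)) i a = slot c v i a"
  unfolding slot_def by (intro sum.cong refl arg_cong2[of _ _ _ _ "(*)"] prod.cong) auto

text \<open>Coefficients of the form in the coordinates \<open>(\<beta> i, \<alpha> i)\<close> given by
  \<open>v i = \<alpha> i *s E i + \<beta> i *s D i\<close>: the symmetric square of the base change matrix in each factor.\<close>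

definition tri :: "nat \<Rightarrow> complex \<Rightarrow> complex \<Rightarrow> complex \<Rightarrow> complex" where
  "tri a x y z = (if a = 0 then x else if a = 1 then y else z)"

lemma tri_simps [simp]:
  "tri 0 x y z = x" "tri (Suc 0) x y z = y" "tri 1 x y z = y" "tri 2 x y z = z"
  by (simp_all add: tri_def)

definition sq :: "complex ^ 2 \<Rightarrow> complex ^ 2 \<Rightarrow> nat \<Rightarrow> nat \<Rightarrow> complex" where
  "sq e d i a =
    tri i (tri a ((e $ 1)\<^sup>2) (2 * (e $ 1 * d $ 1)) ((d $ 1)\<^sup>2))
      (tri a (e $ 0 * e $ 1) (e $ 0 * d $ 1 + e $ 1 * d $ 0) (d $ 0 * d $ 1))
      (tri a ((e $ 0)\<^sup>2) (2 * (e $ 0 * d $ 0)) ((d $ 0)\<^sup>2))"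

definition base_change :: "((3 \<Rightarrow> nat) \<Rightarrow> complex) \<Rightarrow> (3 \<Rightarrow> complex ^ 2) \<Rightarrow> (3 \<Rightarrow> complex ^ 2) \<Rightarrow> (3 \<Rightarrow> nat) \<Rightarrow> complex" where
  "base_change c E D a = (\<Sum>b\<in>idx. c b * (\<Prod>l\<in>UNIV. sq (E l) (D l) (b l) (a l)))"

lemma prod_sum_idx:
  "(\<Prod>l\<in>(UNIV :: 3 set). \<Sum>a\<le>2. g l a) = (\<Sum>a\<in>idx. \<Prod>l\<in>UNIV. g l (a l) :: complex)"
  unfolding idx_PiE by (rule prod_sum_PiE) simp_all

lemma form_base_change:
  "form c (\<lambda>l. \<alpha> l *s E l + \<beta> l *s D l) =
    (\<Sum>a\<in>idx. base_change c E D a * (\<Prod>l\<in>UNIV. \<beta> l ^ a l * \<alpha> l ^ (2 - a l)))"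
proof -
  have sq: "(x * e $ 0 + y * d $ 0) ^ n * (x * e $ 1 + y * d $ 1) ^ (2 - n) =
      (\<Sum>a\<le>2. sq e d n a * (y ^ a * x ^ (2 - a)))" if "n \<le> 2" for n x y and e d :: "complex ^ 2"
    using le_2_cases[OF that]
    by (elim disjE) (simp_all add: sum_atMost_2 sq_def power2_eq_square algebra_simps)
  have "form c (\<lambda>l. \<alpha> l *s E l + \<beta> l *s D l) =
      (\<Sum>b\<in>idx. c b * (\<Prod>l\<in>UNIV. \<Sum>a\<le>2. sq (E l) (D l) (b l) a * (\<beta> l ^ a * \<alpha> l ^ (2 - a))))"
    unfolding form_def by (intro sum.cong refl arg_cong2[of _ _ _ _ "(*)"] prod.cong) (auto simp: idx_def sq)
  also have "\<dots> = (\<Sum>b\<in>idx. \<Sum>a\<in>idx. c b * (\<Prod>l\<in>UNIV. sq (E l) (D l) (b l) (a l)) *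
      (\<Prod>l\<in>UNIV. \<beta> l ^ a l * \<alpha> l ^ (2 - a l)))"
    unfolding prod_sum_idx by (simp add: sum_distrib_left prod.distrib mult.assoc)
  also have "\<dots> = (\<Sum>a\<in>idx. base_change c E D a * (\<Prod>l\<in>UNIV. \<beta> l ^ a l * \<alpha> l ^ (2 - a l)))"
    unfolding base_change_def sum_distrib_right by (rule sum.swap)
  finally show ?thesis .
qed

text \<open>Needed to undo a base change. Coordinate 0 belongs to \<open>D\<close> and coordinate 1
  to \<open>E\<close>, because an exponent counts the power of \<beta>, the multiplier of
  \<open>D\<close>.\<close>

lemma base_change_base_change:
  "base_change (base_change c E D) E' D' a =
    base_change c (\<lambda>l. E' l $ 0 *s D l + E' l $ 1 *s E l) (\<lambda>l. D' l $ 0 *s D l + D' l $ 1 *s E l) a"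
proof -
  have sq: "(\<Sum>k\<le>2. sq e d i k * sq e' d' k n) = sq (e' $ 0 *s d + e' $ 1 *s e) (d' $ 0 *s d + d' $ 1 *s e) i n"
    for e d e' d' i n
    by (cases "i = 0"; cases "i = 1"; cases "n = 0"; cases "n = 1")
      (simp_all add: sum_atMost_2 sq_def tri_def power2_eq_square algebra_simps)
  have "base_change (base_change c E D) E' D' a = (\<Sum>k\<in>idx. \<Sum>b\<in>idx. c b *
      (\<Prod>l\<in>UNIV. sq (E l) (D l) (b l) (k l) * sq (E' l) (D' l) (k l) (a l)))"
    unfolding base_change_def sum_distrib_right prod.distrib by (simp add: mult.assoc)
  also have "\<dots> = (\<Sum>b\<in>idx. \<Sum>k\<in>idx. c b *
      (\<Prod>l\<in>UNIV. sq (E l) (D l) (b l) (k l) * sq (E' l) (D' l) (k l) (a l)))"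
    by (rule sum.swap)
  also have "\<dots> = base_change c (\<lambda>l. E' l $ 0 *s D l + E' l $ 1 *s E l) (\<lambda>l. D' l $ 0 *s D l + D' l $ 1 *s E l) a"
  proof -
    have "(\<Sum>k\<in>idx. \<Prod>l\<in>UNIV. sq (E l) (D l) (b l) (k l) * sq (E' l) (D' l) (k l) (a l)) =
        (\<Prod>l\<in>UNIV. \<Sum>k\<le>2. sq (E l) (D l) (b l) k * sq (E' l) (D' l) k (a l))" for b
      by (rule prod_sum_idx[symmetric])
    then show ?thesis unfolding sum_distrib_left[symmetric] sq base_change_def by simp
  qed
  finally show ?thesis .
qed

definition ax :: "2 \<Rightarrow> complex ^ 2" where
  "ax m = (\<chi> j. if j = m then 1 else 0)"

lemma ax_nth [simp]: "ax m $ j = (if j = m then 1 else 0)"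
  by (simp add: ax_def)

lemma base_change_std:
  assumes "a \<in> idx"
  shows "base_change c (\<lambda>_. ax 1) (\<lambda>_. ax 0) a = c a"
proof -
  have sq: "sq (ax 1) (ax 0) i n = (if i = n then 1 else 0)" if "i \<le> 2" "n \<le> 2" for i n
    using le_2_cases[OF that(1)] le_2_cases[OF that(2)] by (auto simp: sq_def)
  have "c b * (\<Prod>l\<in>UNIV. sq (ax 1) (ax 0) (b l) (a l)) = (if b = a then c b else 0)" if "b \<in> idx" for b
  proof (cases "b = a")
    case False
    then obtain l where "b l \<noteq> a l" by auto
    then have "sq (ax 1) (ax 0) (b l) (a l) = 0" using that assms by (simp add: sq idx_def)
    then have "(\<Prod>l\<in>UNIV. sq (ax 1) (ax 0) (b l) (a l)) = 0" by (intro prod_zero) auto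
    then show ?thesis using False by simp
  qed (use assms in \<open>simp add: sq idx_def\<close>)
  then show ?thesis unfolding base_change_def using assms by simp
qed

lemma sq_in_acl:
  assumes "\<And>j. e $ j \<in> acl S" "\<And>j. d $ j \<in> acl S"
  shows "sq e d i a \<in> acl S"
proof -
  have "2 \<in> acl S" using acl_of_nat[of 2 S] by simp
  then show ?thesis unfolding sq_def tri_def using assms by (auto intro!: acl.mult acl_add acl_power)
qed

text \<open>The inverse of the base change is again a base change; its matrix entries come from
  Cramer's rule and therefore lie in the same closure.\<close>

lemma base_change_coeffs_in_acl:
  assumes det: "\<And>l. det2 (E l) (D l) \<noteq> 0"
    and ED: "\<And>l j. E l $ j \<in> acl S" "\<And>l j. D l $ j \<in> acl S"
    and base_change: "base_change c E D ` idx \<subseteq> acl S"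
  shows "c ` idx \<subseteq> acl S"
proof -
  define E' :: "3 \<Rightarrow> complex ^ 2" where "E' = (\<lambda>l. \<chi> j.
    (if j = 0 then det2 (E l) (ax 1) else det2 (ax 1) (D l)) / det2 (E l) (D l))"
  define D' :: "3 \<Rightarrow> complex ^ 2" where "D' = (\<lambda>l. \<chi> j.
    (if j = 0 then det2 (E l) (ax 0) else det2 (ax 0) (D l)) / det2 (E l) (D l))"
  have det_acl: "det2 u v \<in> acl S" if "\<And>j. u $ j \<in> acl S" "\<And>j. v $ j \<in> acl S" for u v
    unfolding det2_def by (intro acl.diff acl.mult that)
  have "ax m $ j \<in> acl S" for m j by (simp add: acl.one)
  then have ED': "E' l $ j \<in> acl S" "D' l $ j \<in> acl S" for l j
    using ED by (simp_all add: E'_def D'_def acl_divide det_acl)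
  have E1: "(\<lambda>l. E' l $ 0 *s D l + E' l $ 1 *s E l) = (\<lambda>_. ax 1)"
    using det2_expand[OF det, of "ax 1"] by (simp add: E'_def add.commute)
  have D1: "(\<lambda>l. D' l $ 0 *s D l + D' l $ 1 *s E l) = (\<lambda>_. ax 0)"
    using det2_expand[OF det, of "ax 0"] by (simp add: D'_def add.commute)
  have "c a \<in> acl S" if "a \<in> idx" for a
  proof -
    have "c a = base_change (base_change c E D) E' D' a"
      unfolding base_change_base_change E1 D1 using that by (simp add: base_change_std)
    also have "\<dots> \<in> acl S"
      unfolding base_change_def[of "base_change c E D"] using base_change ED'
      by (intro acl_sum acl.mult acl_prod sq_in_acl) auto
    finally show ?thesis .
  qed
  then show ?thesis by blast
qed

lemma generic_chart_bound:
  assumes "generic c" "\<And>l. det2 (E l) (D l) \<noteq> 0" "\<And>l j. E l $ j \<in> acl S" "\<And>l j. D l $ j \<in> acl S"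
    "base_change c E D ` idx \<subseteq> acl S" "finite S"
  shows "card S \<ge> 27"
  using assms base_change_coeffs_in_acl[of E D S c] unfolding generic_def by blast

text \<open>Exponent \<open>n\<close> on the factor \<open>i\<close>, \<open>a\<close> on
  \<open>j\<close> and \<open>b\<close> on the third factor. For fixed \<open>n\<close> these are
  nine coefficients, a face, and the face \<open>n = 0\<close> is the equation of a fibre.\<close>

definition ix :: "3 \<Rightarrow> 3 \<Rightarrow> nat \<Rightarrow> nat \<Rightarrow> nat \<Rightarrow> 3 \<Rightarrow> nat" where
  "ix i j n a b = (\<lambda>l. if l = i then n else if l = j then a else b)"

definition distinct3 :: "3 \<Rightarrow> 3 \<Rightarrow> 3 \<Rightarrow> bool" where
  "distinct3 i j k \<longleftrightarrow> i \<noteq> j \<and> i \<noteq> k \<and> j \<noteq> k"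

lemma UNIV_3_distinct:
  assumes "distinct3 i j k"
  shows "UNIV = {i, j, k}"
proof -
  have "card {i, j, k} = card (UNIV :: 3 set)" using assms by (simp add: distinct3_def)
  then show ?thesis by (metis card_subset_eq finite subset_UNIV)
qed

lemma ix_eval:
  assumes "distinct3 i j k"
  shows "ix i j n a b i = n" "ix i j n a b j = a" "ix i j n a b k = b"
  using assms by (auto simp: ix_def distinct3_def)

lemma ix_idx: "n \<le> 2 \<Longrightarrow> a \<le> 2 \<Longrightarrow> b \<le> 2 \<Longrightarrow> ix i j n a b \<in> idx"
  by (auto simp: ix_def idx_def)

lemma ix_surj:
  assumes "distinct3 i j k"
  shows "e = ix i j (e i) (e j) (e k)"
proof
  fix l
  have "l \<in> {i, j, k}" using UNIV_3_distinct[OF assms] by blast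
  then show "e l = ix i j (e i) (e j) (e k) l" using assms by (auto simp: ix_def)
qed

lemma ix_inj:
  assumes "distinct3 i j k" "ix i j n a b = ix i j n' a' b'"
  shows "n = n' \<and> a = a' \<and> b = b'"
  using assms(2) ix_eval[OF assms(1)] by metis

lemma sum_idx:
  assumes d: "distinct3 i j k"
  shows "sum g idx = (\<Sum>n\<le>2. \<Sum>a\<le>2. \<Sum>b\<le>2. g (ix i j n a b))"
proof -
  have "sum g idx = (\<Sum>(n, a, b)\<in>{..2} \<times> {..2} \<times> {..2}. g (ix i j n a b))"
    by (rule sum.reindex_bij_witness[of _ "\<lambda>(n, a, b). ix i j n a b" "\<lambda>e. (e i, e j, e k)"])
      (use ix_surj[OF d] ix_eval[OF d] in \<open>auto simp: ix_idx\<close>, auto simp: idx_def)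
  then show ?thesis by (simp add: sum.cartesian_product split_def)
qed

lemma form_chart:
  assumes d: "distinct3 i j k"
  shows "form c ((\<lambda>l. E l + s l *s D l)(i := \<alpha> *s E i + \<beta> *s D i)) =
    (\<Sum>n\<le>2. (\<Sum>a\<le>2. \<Sum>b\<le>2. base_change c E D (ix i j n a b) * s j ^ a * s k ^ b) * (\<beta> ^ n * \<alpha> ^ (2 - n)))"
proof -
  have "(\<lambda>l. E l + s l *s D l)(i := \<alpha> *s E i + \<beta> *s D i) =
      (\<lambda>l. ((\<lambda>_. 1)(i := \<alpha>)) l *s E l + (s(i := \<beta>)) l *s D l)"
    by (auto simp: fun_eq_iff)
  moreover have "(\<Prod>l\<in>UNIV. (s(i := \<beta>)) l ^ e l * ((\<lambda>_. 1)(i := \<alpha>)) l ^ (2 - e l)) =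
      (\<beta> ^ e i * \<alpha> ^ (2 - e i)) * s j ^ e j * s k ^ e k" for e
    unfolding UNIV_3_distinct[OF d] using d by (auto simp: distinct3_def)
  ultimately show ?thesis
    by (simp add: form_base_change sum_idx[OF d] ix_eval[OF d] sum_distrib_left sum_distrib_right mult_ac)
qed

text \<open>The principle behind all counts: \<open>T\<close> holds the parameters of the frame and
  of the configuration, \<open>R\<close> the coefficients determined by them and by the other
  coefficients. Then \<open>T\<close> and the 27 - card R other coefficients generate everything, so
  there cannot be more conditions than parameters.\<close>

lemma generic_count:
  assumes c: "generic c" and det: "\<And>l. det2 (E l) (D l) \<noteq> 0"
    and ED: "\<And>l j. E l $ j \<in> acl T" "\<And>l j. D l $ j \<in> acl T" and T: "finite T"
    and R: "R \<subseteq> idx" "base_change c E D ` R \<subseteq> acl (T \<union> base_change c E D ` (idx - R))"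
  shows "card R \<le> card T"
proof -
  let ?S = "T \<union> base_change c E D ` (idx - R)"
  have sub: "acl T \<subseteq> acl ?S" by (rule acl_mono) auto
  have "base_change c E D ` (idx - R) \<subseteq> acl ?S" using acl_subset[of ?S] by blast
  then have "base_change c E D ` idx \<subseteq> acl ?S" using R by blast
  then have "27 \<le> card ?S"
    using c det ED sub T by (intro generic_chart_bound[of c E D]) auto
  also have "\<dots> \<le> card T + card (base_change c E D ` (idx - R))" by (rule card_Un_le)
  also have "card (base_change c E D ` (idx - R)) \<le> card (idx - R)" by (rule card_image_le) simp
  also have "card (idx - R) = 27 - card R"
    using R(1) by (simp add: card_Diff_subset finite_subset[OF R(1)] card_idx)
  finally show ?thesis using card_mono[OF finite_idx R(1)] by (simp add: card_idx)
qed

text \<open>One homogeneous coordinate is scaled to 1, so a point of the projective line costs a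
  single parameter.\<close>

lemma p1_rep_acl: "\<exists>e t. e \<noteq> 0 \<and> abs_p1 e = x \<and> (\<forall>j. e $ j \<in> acl {t})"
proof -
  obtain u where u: "u \<noteq> 0" "abs_p1 u = x" using p1_rep by blast
  obtain m where m: "u $ m \<noteq> 0" using u(1) by (metis vec2_eq_iff zero_index)
  define m' where "m' = m + 1"
  have mm: "m' \<noteq> m" "j = m \<or> j = m'" for j
    using two_cases[of m] two_cases[of j] by (auto simp: m'_def)
  define e where "e = inverse (u $ m) *s u"
  have "e $ j \<in> acl {u $ m' / u $ m}" for j
    using mm(2)[of j] m by (auto simp: e_def acl.one divide_inverse mult.commute intro: acl.base)
  moreover have "e \<noteq> 0" using u(1) m by (simp add: e_def vec2_eq_iff)
  moreover have "abs_p1 e = x"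
    using u \<open>e \<noteq> 0\<close> abs_p1_eq_iff[of e u] by (simp add: e_def)
  ultimately show ?thesis by blast
qed

lemma ax_in_acl [simp]: "ax m $ j \<in> acl S"
  by (simp add: acl.one)

lemma ax_independent: "e \<noteq> 0 \<Longrightarrow> \<exists>m. det2 e (ax m) \<noteq> 0"
proof (cases "e $ 0 = 0")
  case True
  then show "e \<noteq> 0 \<Longrightarrow> ?thesis" by (intro exI[of _ 0]) (auto simp: vec2_eq_iff det2_def)
next
  case False
  then show ?thesis by (intro exI[of _ 1]) (simp add: det2_def)
qed

text \<open>A nonzero binary quadratic form cannot vanish at all of (1,0), (0,1) and (1,1). One of
  them serves as second frame vector without spending a parameter, and it is independent of
  \<open>e\<close> because \<open>q e = 0\<close>.\<close>

lemma rational_nonroot: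
  assumes q: "\<And>u. q u = C * (u $ 1)\<^sup>2 + B * (u $ 0 * u $ 1) + A * (u $ 0)\<^sup>2"
    and nz: "\<not> (A = 0 \<and> B = 0 \<and> C = 0)" and e: "q e = 0" "e \<noteq> 0"
  shows "\<exists>d. (\<forall>j S. d $ j \<in> acl S) \<and> q d \<noteq> 0 \<and> det2 e d \<noteq> 0"
proof -
  have "\<exists>d. (\<forall>j S. d $ j \<in> acl S) \<and> q d \<noteq> 0"
  proof (cases "A = 0 \<and> C = 0")
    case True
    then have "q (\<chi> j. 1) \<noteq> 0" using nz by (simp add: q)
    then show ?thesis by (intro exI[of _ "\<chi> j. 1"]) (simp add: acl.one)
  next
    case False
    then have "q (ax 0) \<noteq> 0 \<or> q (ax 1) \<noteq> 0" by (auto simp: q)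
    then show ?thesis using ax_in_acl by blast
  qed
  then obtain d where d: "\<And>j S. d $ j \<in> acl S" "q d \<noteq> 0" by blast
  have "det2 e d \<noteq> 0"
  proof
    assume "det2 e d = 0"
    then obtain k where "d = k *s e" using det2_eq_0_imp e(2) by blast
    then have "q d = k\<^sup>2 * q e" by (simp add: q power2_eq_square algebra_simps)
    then show False using d(2) e(1) by simp
  qed
  then show ?thesis using d by blast
qed

lemma distinct3_exists: "\<exists>j k. distinct3 i j k"
proof -
  have "i = 1 \<or> i = 2 \<or> i = 3" by (rule exhaust_3)
  then show ?thesis
  proof (elim disjE)
    show "i = 1 \<Longrightarrow> ?thesis" by (intro exI[of _ 2] exI[of _ 3]) (simp add: distinct3_def)
    show "i = 2 \<Longrightarrow> ?thesis" by (intro exI[of _ 1] exI[of _ 3]) (simp add: distinct3_def)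
    show "i = 3 \<Longrightarrow> ?thesis" by (intro exI[of _ 1] exI[of _ 2]) (simp add: distinct3_def)
  qed
qed

lemma distinct3_third: "i \<noteq> j \<Longrightarrow> \<exists>k. distinct3 i j k"
proof -
  assume ij: "i \<noteq> j"
  obtain a b where ab: "distinct3 i a b" using distinct3_exists by blast
  then have "j = a \<or> j = b" using UNIV_3_distinct[OF ab] ij by auto
  then show ?thesis using ab unfolding distinct3_def by blast
qed

lemma form_chart_axis:
  assumes d: "distinct3 i j k"
  shows "form c (E(i := \<alpha> *s E i + \<beta> *s D i)) =
    base_change c E D (ix i j 0 0 0) * \<alpha>\<^sup>2 + base_change c E D (ix i j 1 0 0) * (\<alpha> * \<beta>) + base_change c E D (ix i j 2 0 0) * \<beta>\<^sup>2"
  using form_chart[OF d, of c E "\<lambda>_. 0" D \<alpha> \<beta>] by (simp add: sum_atMost_2 mult_ac)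

text \<open>A line in the direction \<open>i\<close> has two parameters, its coordinates on the
  other factors, but lying on the surface makes three coefficients vanish.\<close>

lemma no_vertical_line:
  assumes c: "generic c" and v: "nz v"
  shows "\<not> (slot c v i 0 = 0 \<and> slot c v i 1 = 0 \<and> slot c v i 2 = 0)"
proof
  assume z: "slot c v i 0 = 0 \<and> slot c v i 1 = 0 \<and> slot c v i 2 = 0"
  obtain j k where d: "distinct3 i j k" using distinct3_exists by blast
  obtain e t where e: "\<And>l. e l \<noteq> 0" "\<And>l. abs_p1 (e l) = pt v l" "\<And>l j. e l $ j \<in> acl {t l}"
    using p1_rep_acl[of "pt v l" for l] by metis
  \<comment> \<open>Along the line any frame will do, so a rational vector is taken on the factor
    \<open>i\<close> and \<open>t i\<close> is saved.\<close>
  define E where "E = e(i := ax 1)"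
  have Enz: "E l \<noteq> 0" for l using e(1) by (simp add: E_def vec2_eq_iff)
  obtain m where m: "\<And>l. det2 (E l) (ax (m l)) \<noteq> 0" using ax_independent[OF Enz] by metis
  define D where "D = (\<lambda>l. ax (m l))"
  have form0: "form c (E(i := u)) = 0" if "u \<noteq> 0" for u
  proof -
    have "form c (v(i := u)) = 0" using z by (simp add: form_slot)
    then have "pt (v(i := u)) \<in> surf c" using v that by (simp add: pt_in_surf nz_upd)
    moreover have "pt (v(i := u)) = pt (E(i := u))"
      using e(2) by (auto simp: fun_eq_iff pt_def E_def)
    moreover have "nz (E(i := u))" using Enz that by (simp add: nz_def)
    ultimately show ?thesis by (simp add: pt_in_surf)
  qed
  let ?p = "base_change c E D"
  have comb: "\<alpha> *s E i + \<beta> *s D i \<noteq> 0" if "\<not> (\<alpha> = 0 \<and> \<beta> = 0)" for \<alpha> \<beta>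
  proof
    assume "\<alpha> *s E i + \<beta> *s D i = 0"
    then have "det2 (\<alpha> *s E i + \<beta> *s D i) (D i) = 0" "det2 (E i) (\<alpha> *s E i + \<beta> *s D i) = 0"
      by (simp_all add: det2_zero)
    then show False using that m[of i] by (simp add: det2_add D_def)
  qed
  have eq: "?p (ix i j 0 0 0) * \<alpha>\<^sup>2 + ?p (ix i j 1 0 0) * (\<alpha> * \<beta>) + ?p (ix i j 2 0 0) * \<beta>\<^sup>2 = 0"
    if "\<not> (\<alpha> = 0 \<and> \<beta> = 0)" for \<alpha> \<beta>
    using form0[OF comb[OF that]] form_chart_axis[OF d, of c E \<alpha> \<beta> D] by simp
  have zero: "?p (ix i j 0 0 0) = 0" "?p (ix i j 2 0 0) = 0" "?p (ix i j 1 0 0) = 0"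
    using eq[of 1 0] eq[of 0 1] eq[of 1 1] by auto
  define R where "R = (\<lambda>n. ix i j n 0 0) ` {..2}"
  have "inj_on (\<lambda>n. ix i j n 0 0) {..2}" using ix_inj[OF d] by (intro inj_onI) blast
  then have "card R = 3" by (simp add: R_def card_image)
  moreover have "card R \<le> card {t j, t k}"
  proof (rule generic_count[OF c])
    show "det2 (E l) (D l) \<noteq> 0" for l using m by (simp add: D_def)
    show "E l $ a \<in> acl {t j, t k}" for l a
    proof (cases "l = i")
      case False
      then have "l = j \<or> l = k" using UNIV_3_distinct[OF d] by auto
      then have "{t l} \<subseteq> {t j, t k}" by auto
      from subsetD[OF acl_mono[OF this] e(3)] show ?thesis using False by (simp add: E_def)
    qed (simp add: E_def acl.one)
    show "D l $ a \<in> acl {t j, t k}" for l a unfolding D_def by (rule ax_in_acl)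
    show "R \<subseteq> idx" by (auto simp: R_def ix_idx)
    show "?p ` R \<subseteq> acl ({t j, t k} \<union> ?p ` (idx - R))"
      unfolding R_def using zero le_2_cases by fastforce
  qed simp
  moreover have "card {t j, t k} \<le> 2" using card_insert_le_m1[of 2 "{t k}" "t j"] by simp
  ultimately show False by simp
qed

text \<open>\<open>w\<close> represents the residual intersection of the surface with the line
  through \<open>v\<close> in the direction \<open>i\<close>; at a double root it is proportional to
  \<open>v i\<close>. The factor \<open>k\<close> leaves the choice of representatives free.\<close>

definition other :: "((3 \<Rightarrow> nat) \<Rightarrow> complex) \<Rightarrow> 3 \<Rightarrow> (3 \<Rightarrow> complex ^ 2) \<Rightarrow> complex ^ 2 \<Rightarrow> bool" where
  "other c i v w \<longleftrightarrow> w \<noteq> 0 \<and> (\<exists>k. k \<noteq> 0 \<and> (\<forall>u. form c (v(i := u)) = k * det2 (v i) u * det2 w u))"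

lemma quadratic_other_root:
  assumes q: "\<And>u. q u = C * (u $ 1)\<^sup>2 + B * (u $ 0 * u $ 1) + A * (u $ 0)\<^sup>2"
    and nz: "\<not> (A = 0 \<and> B = 0 \<and> C = 0)" and e: "q e = 0" "e \<noteq> 0"
  shows "\<exists>w. w \<noteq> 0 \<and> (\<forall>u. q u = det2 e u * det2 w u)"
proof -
  have e': "C * (e $ 1)\<^sup>2 + B * (e $ 0 * e $ 1) + A * (e $ 0)\<^sup>2 = 0" using e(1) by (simp add: q)
  have "\<exists>w0 w1. C = e $ 0 * w0 \<and> B = - (e $ 0 * w1) - e $ 1 * w0 \<and> A = e $ 1 * w1"
  proof (cases "e $ 0 = 0")
    case True
    then have "e $ 1 \<noteq> 0" "C = 0" using e e' by (auto simp: vec2_eq_iff)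
    then show ?thesis using True by (intro exI[of _ "- B / e $ 1"] exI[of _ "A / e $ 1"]) simp
  next
    case False
    define w0 where "w0 = C / e $ 0"
    define w1 where "w1 = (- B - e $ 1 * w0) / e $ 0"
    have w: "C = e $ 0 * w0" "e $ 0 * w1 = - B - e $ 1 * w0" using False by (simp_all add: w0_def w1_def)
    then have B: "B = - (e $ 0 * w1) - e $ 1 * w0" by simp
    have "(A - e $ 1 * w1) * (e $ 0)\<^sup>2 = 0"
      using e' unfolding B w(1) by (simp add: power2_eq_square algebra_simps)
    then have "A = e $ 1 * w1" using False by simp
    then show ?thesis using w(1) B by blast
  qed
  then obtain w0 w1 where w01: "C = e $ 0 * w0" "B = - (e $ 0 * w1) - e $ 1 * w0" "A = e $ 1 * w1" by blast
  have "q u = det2 e u * det2 (\<chi> j. if j = 0 then w0 else w1) u" for u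
    unfolding q w01 by (simp add: det2_def power2_eq_square algebra_simps)
  then have "\<exists>w. \<forall>u. q u = det2 e u * det2 w u" by blast
  then obtain w where w: "\<And>u. q u = det2 e u * det2 w u" by blast
  have "w \<noteq> 0"
  proof
    assume "w = 0"
    then have "q u = 0" for u using w by simp
    from this[of "ax 0"] this[of "ax 1"] this[of "ax 0 + ax 1"] show False using nz by (simp add: q)
  qed
  then show ?thesis using w by blast
qed

lemma other_exists:
  assumes c: "generic c" and v: "nz v" "form c v = 0"
  shows "\<exists>w. other c i v w"
proof -
  have "form c (v(i := v i)) = 0" "v i \<noteq> 0" using v by (simp_all add: nz_def)
  then obtain w where "w \<noteq> 0" "\<And>u. form c (v(i := u)) = det2 (v i) u * det2 w u"
    using quadratic_other_root[where q = "\<lambda>u. form c (v(i := u))" and e = "v i", OF form_slot]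
      no_vertical_line[OF c v(1), of i] by auto
  then show ?thesis unfolding other_def by (intro exI[of _ w] conjI exI[of _ 1]) auto
qed

lemma same_pt_scale:
  assumes "nz v" "nz v'" "pt v = pt v'"
  shows "\<exists>k. (\<forall>i. k i \<noteq> 0) \<and> v' = (\<lambda>i. k i *s v i)"
  using hom_coords_scale[of v "pt v" v'] assms by (simp add: hom_coords_iff)

lemma same_p1_scale:
  assumes "u \<noteq> 0" "v \<noteq> 0" "abs_p1 u = abs_p1 v"
  shows "\<exists>k. k \<noteq> 0 \<and> v = k *s u"
  using det2_eq_0_imp[of u v] abs_p1_eq_iff[OF assms(1,2)] assms by auto

lemma form_scale_upd:
  "form c ((\<lambda>l. k l *s v l)(i := u)) = (\<Prod>l\<in>UNIV. ((k(i := 1)) l)\<^sup>2) * form c (v(i := u))"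
proof -
  have "(\<lambda>l. k l *s v l)(i := u) = (\<lambda>l. (k(i := 1)) l *s (v(i := u)) l)" by (auto simp: fun_eq_iff)
  then show ?thesis by (simp only: form_scale)
qed

lemma other_transfer:
  assumes v: "nz v" "nz v'" "pt v = pt v'" and w: "w' \<noteq> 0" "abs_p1 w = abs_p1 w'" and o: "other c i v w"
  shows "other c i v' w'"
proof -
  obtain \<kappa> where \<kappa>: "\<And>l. \<kappa> l \<noteq> 0" "v' = (\<lambda>l. \<kappa> l *s v l)" using same_pt_scale[OF v] by blast
  obtain k where k: "w \<noteq> 0" "k \<noteq> 0" "\<And>u. form c (v(i := u)) = k * det2 (v i) u * det2 w u"
    using o by (auto simp: other_def)
  obtain m where m: "m \<noteq> 0" "w' = m *s w" using same_p1_scale[OF k(1) w] by blast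
  define K where "K = (\<Prod>l\<in>UNIV. ((\<kappa>(i := 1)) l)\<^sup>2)"
  have K: "K \<noteq> 0" using \<kappa>(1) by (auto simp: K_def)
  have "form c (v'(i := u)) = (K * k / (\<kappa> i * m)) * det2 (v' i) u * det2 w' u" for u
    unfolding \<kappa>(2) form_scale_upd K_def[symmetric] k(3) m(2) using \<kappa>(1)[of i] m(1) by simp
  then show ?thesis
    unfolding other_def using w(1) K k(2) \<kappa>(1)[of i] m(1)
    by (intro conjI exI[of _ "K * k / (\<kappa> i * m)"]) auto
qed

lemma line_finite:
  assumes c: "generic c" and ij: "i \<noteq> j"
  shows "finite {x \<in> surf c. x i = a \<and> x j = b}"
proof -
  obtain k where d: "distinct3 i j k" using distinct3_third[OF ij] by blast
  obtain v where v: "nz v" "pt v = (\<lambda>_. a)(j := b)" using pt_rep by blast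
  define p where "p = [:slot c v k 0, slot c v k 1, slot c v k 2:]"
  have "p \<noteq> 0" using no_vertical_line[OF c v(1), of k] by (auto simp: p_def)
  then have fin: "finite {s. poly p s = 0}" by (rule poly_roots_finite)
  have "{x \<in> surf c. x i = a \<and> x j = b} \<subseteq>
      insert (pt (v(k := ax 0))) ((\<lambda>s. pt (v(k := ax 1 + s *s ax 0))) ` {s. poly p s = 0})"
  proof
    fix x assume x: "x \<in> {x \<in> surf c. x i = a \<and> x j = b}"
    obtain u where u: "u \<noteq> 0" "abs_p1 u = x k" using p1_rep by blast
    have xk: "x = pt (v(k := u))"
    proof
      fix l
      have "l \<in> {i, j, k}" using UNIV_3_distinct[OF d] by blast
      then show "x l = pt (v(k := u)) l" using x v(2) u(2) d by (auto simp: pt_upd distinct3_def)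
    qed
    show "x \<in> insert (pt (v(k := ax 0))) ((\<lambda>s. pt (v(k := ax 1 + s *s ax 0))) ` {s. poly p s = 0})"
    proof (cases "u $ 1 = 0")
      case True
      then have "abs_p1 u = abs_p1 (ax 0)"
        using u(1) by (subst abs_p1_eq_iff) (auto simp: vec2_eq_iff det2_def)
      then show ?thesis by (simp add: xk pt_upd)
    next
      case False
      define s where "s = u $ 0 / u $ 1"
      have "abs_p1 u = abs_p1 (ax 1 + s *s ax 0)"
        using u(1) False by (subst abs_p1_eq_iff) (auto simp: vec2_eq_iff det2_def s_def)
      then have xs: "x = pt (v(k := ax 1 + s *s ax 0))" by (simp add: xk pt_upd)
      moreover have "nz (v(k := ax 1 + s *s ax 0))" using v(1) by (intro nz_upd) (auto simp: vec2_eq_iff)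
      ultimately have "form c (v(k := ax 1 + s *s ax 0)) = 0" using x pt_in_surf by blast
      then have "poly p s = 0"
        by (simp add: form_slot p_def power2_eq_square algebra_simps)
      then show ?thesis using xs by blast
    qed
  qed
  then show ?thesis using fin finite_subset by blast
qed

text \<open>Fibres in two different directions always meet on the surface, by the solution formula
  for quadratics; (1 : 0) is a root when the leading coefficient vanishes.\<close>

lemma line_nonempty:
  assumes "i \<noteq> j"
  shows "\<exists>x\<in>surf c. x i = a \<and> x j = b"
proof -
  obtain k where d: "distinct3 i j k" using distinct3_third[OF assms] by blast
  obtain v where v: "nz v" "pt v = (\<lambda>_. a)(j := b)" using pt_rep by blast
  define A B C where "A = slot c v k 2" and "B = slot c v k 1" and "C = slot c v k 0"
  have "\<exists>u. u \<noteq> 0 \<and> form c (v(k := u)) = 0"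
  proof (cases "A = 0")
    case True
    then show ?thesis by (intro exI[of _ "ax 0"]) (simp add: form_slot A_def vec2_eq_iff)
  next
    case False
    define s where "s = (- B + csqrt (B\<^sup>2 - 4 * A * C)) / (2 * A)"
    have "2 * A * s + B = csqrt (B\<^sup>2 - 4 * A * C)" using False by (simp add: s_def)
    then have "(2 * A * s + B)\<^sup>2 = B\<^sup>2 - 4 * A * C" by simp
    moreover have "4 * A * (C + B * s + A * s\<^sup>2) = (2 * A * s + B)\<^sup>2 - (B\<^sup>2 - 4 * A * C)"
      by (simp add: power2_eq_square algebra_simps)
    ultimately have "4 * A * (C + B * s + A * s\<^sup>2) = 0" by simp
    then have "C + B * s + A * s\<^sup>2 = 0" using False by simp
    then show ?thesis
      by (intro exI[of _ "ax 1 + s *s ax 0"]) (simp add: form_slot A_def B_def C_def vec2_eq_iff)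
  qed
  then obtain u where u: "u \<noteq> 0" "form c (v(k := u)) = 0" by blast
  then have "pt (v(k := u)) \<in> surf c" using v(1) by (simp add: pt_in_surf nz_upd)
  moreover have "pt (v(k := u)) i = a" "pt (v(k := u)) j = b" using v(2) d by (auto simp: pt_upd distinct3_def)
  ultimately show ?thesis by blast
qed

subsection \<open>Fibres of invariant sets\<close>

text \<open>Stability under the three involutions, expressed on vectors so that no map on points has
  to be constructed yet.\<close>

definition other_closed :: "((3 \<Rightarrow> nat) \<Rightarrow> complex) \<Rightarrow> point set \<Rightarrow> bool" where
  "other_closed c Om \<longleftrightarrow> (\<forall>v i w. nz v \<longrightarrow> pt v \<in> Om \<longrightarrow> other c i v w \<longrightarrow> pt (v(i := w)) \<in> Om)"

lemma affine_nz: "det2 e d \<noteq> 0 \<Longrightarrow> e + s *s d \<noteq> 0"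
proof
  assume "det2 e d \<noteq> 0" "e + s *s d = 0"
  then have "det2 (e + s *s d) d = 0" by simp
  then show False using \<open>det2 e d \<noteq> 0\<close> by (simp only: det2_add det2_scale det2_self mult_zero_right add_0_right)
qed

lemma abs_p1_affine_inj:
  assumes "det2 e d \<noteq> 0" "abs_p1 (e + s *s d) = abs_p1 (e + s' *s d)"
  shows "s = s'"
proof -
  have "det2 (e + s *s d) (e + s' *s d) = 0"
    using assms abs_p1_eq_iff affine_nz by blast
  moreover have "det2 (e + s *s d) (e + s' *s d) = (s' - s) * det2 e d"
    by (simp add: det2_def algebra_simps)
  ultimately show ?thesis using assms(1) by simp
qed

lemma abs_p1_affine_surj:
  assumes "det2 e d \<noteq> 0" "u \<noteq> 0" "det2 u d \<noteq> 0"
  shows "\<exists>s. abs_p1 u = abs_p1 (e + s *s d)"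
proof -
  have "det2 u (e + (det2 e u / det2 u d) *s d) = 0"
    using assms(3) by (simp add: det2_add det2_swap[of u e])
  then show ?thesis using abs_p1_eq_iff[OF assms(2) affine_nz[OF assms(1)]] by blast
qed

text \<open>Vieta's formula in the affine coordinate \<beta>/\<alpha>. The condition on
  \<open>A\<close> says that \<open>d\<close>, the point at infinity of the chart, is not a root, so
  the second root stays in the chart.\<close>

lemma quadratic_affine_other_root:
  assumes q: "\<And>\<alpha> \<beta>. q (\<alpha> *s e + \<beta> *s d) = C * \<alpha>\<^sup>2 + B * (\<alpha> * \<beta>) + A * \<beta>\<^sup>2"
    and det: "det2 e d \<noteq> 0" and A: "A \<noteq> 0" and y: "C + B * y + A * y\<^sup>2 = 0"
  shows "\<exists>k. k \<noteq> 0 \<and> (\<forall>u. q u = k * det2 (e + y *s d) u * det2 (e + (- y - B / A) *s d) u)"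
proof -
  have "q u = A / (det2 e d)\<^sup>2 * det2 (e + y *s d) u * det2 (e + (- y - B / A) *s d) u" for u
  proof -
    define \<Delta> where "\<Delta> = det2 e d"
    define \<alpha> \<beta> where "\<alpha> = det2 u d / \<Delta>" and "\<beta> = det2 e u / \<Delta>"
    define y' where "y' = - y - B / A"
    have B: "B = - A * (y + y')" using A by (simp add: y'_def field_simps)
    have C: "C = A * (y * y')"
    proof -
      have "C = - (B * y + A * y\<^sup>2)"
        by (rule eq_neg_iff_add_eq_0[THEN iffD2]) (use y in \<open>simp add: add.assoc\<close>)
      then show ?thesis unfolding B by (simp add: power2_eq_square algebra_simps)
    qed
    have u: "u = \<alpha> *s e + \<beta> *s d"
      using det2_expand[OF det, of u] by (simp add: \<alpha>_def \<beta>_def \<Delta>_def)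
    have dets: "det2 (e + z *s d) u = (\<beta> - z * \<alpha>) * \<Delta>" for z
      unfolding u \<Delta>_def by (simp add: det2_add det2_swap[of d e] algebra_simps)
    have "A / \<Delta>\<^sup>2 * ((\<beta> - y * \<alpha>) * \<Delta>) * ((\<beta> - y' * \<alpha>) * \<Delta>) = A * ((\<beta> - y * \<alpha>) * (\<beta> - y' * \<alpha>))"
      using det by (simp add: \<Delta>_def power2_eq_square)
    also have "\<dots> = C * \<alpha>\<^sup>2 + B * (\<alpha> * \<beta>) + A * \<beta>\<^sup>2"
      unfolding B C by (simp add: power2_eq_square algebra_simps)
    also have "\<dots> = q u" using q[of \<alpha> \<beta>] u by simp
    finally show ?thesis unfolding y'_def[symmetric] dets \<Delta>_def[symmetric] by simp
  qed
  then show ?thesis using A det by (intro exI[of _ "A / (det2 e d)\<^sup>2"]) simp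
qed

lemma other_closed_affine:
  assumes sub: "Om \<subseteq> surf c" and cl: "other_closed c Om" and v: "nz v" "pt v \<in> Om"
    and det: "det2 e d \<noteq> 0" and vi: "v i = e + y *s d"
    and q: "\<And>\<alpha> \<beta>. form c (v(i := \<alpha> *s e + \<beta> *s d)) = C * \<alpha>\<^sup>2 + B * (\<alpha> * \<beta>) + A * \<beta>\<^sup>2"
    and A: "A \<noteq> 0"
  shows "pt (v(i := e + (- y - B / A) *s d)) \<in> Om"
proof -
  have "form c v = 0" using v sub pt_in_surf by blast
  moreover have "v(i := 1 *s e + y *s d) = v" using vi by (simp add: fun_upd_idem)
  ultimately have "C + B * y + A * y\<^sup>2 = 0" using q[of 1 y] by simp
  from quadratic_affine_other_root[where q = "\<lambda>u. form c (v(i := u))", OF q det A this]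
  have "other c i v (e + (- y - B / A) *s d)" unfolding other_def vi using affine_nz[OF det] by blast
  then show ?thesis using cl v unfolding other_closed_def by blast
qed

definition sg :: "3 \<Rightarrow> nat \<Rightarrow> 3 \<Rightarrow> nat" where
  "sg l n = (\<lambda>m. if m = l then n else 0)"

lemma ix_sg:
  assumes "distinct3 i j k"
  shows "ix i j n 0 0 = sg i n" "ix i j 0 n 0 = sg j n" "ix i j 0 0 n = sg k n"
  using assms UNIV_3_distinct[OF assms]
  by (auto simp: ix_def sg_def distinct3_def fun_eq_iff)

lemma ix_swap:
  assumes "distinct3 i j k"
  shows "ix j i n 0 b = ix i j 0 n b" "ix k i n 0 a = ix i j 0 a n"
  using assms UNIV_3_distinct[OF assms]
  by (auto simp: ix_def distinct3_def fun_eq_iff)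

text \<open>In a frame centred at the point, the fibre is a (2,2) curve through the origin with
  coefficients \<open>f\<close>, and the chart turns the part of \<open>Om\<close> in it into a
  finite set stable under two involutions. The square terms keep the curve away from the points at
  infinity of the axes; the linear terms make it smooth at the origin.\<close>

lemma face_dependent:
  assumes d: "distinct3 i j k" and sub: "Om \<subseteq> surf c" and cl: "other_closed c Om"
    and det: "\<And>l. det2 (E l) (D l) \<noteq> 0" and E: "pt E \<in> Om"
    and fin: "finite {x \<in> Om. x i = pt E i}"
    and nz2: "base_change c E D (sg j 2) \<noteq> 0" "base_change c E D (sg k 2) \<noteq> 0"
    and nz1: "base_change c E D (sg j 1) \<noteq> 0 \<or> base_change c E D (sg k 1) \<noteq> 0"
  shows "\<exists>e\<in>idx. e i = 0 \<and> (\<forall>l. l \<noteq> i \<longrightarrow> e l \<noteq> 0) \<and>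
    base_change c E D e \<in> acl (base_change c E D ` {e' \<in> idx. e' i = 0 \<and> e' \<noteq> e})"
proof -
  define p where "p = base_change c E D"
  define f where "f = (\<lambda>a b. p (ix i j 0 a b))"
  define s where "s = (\<lambda>y z l. if l = j then y else if l = k then z else (0 :: complex))"
  define ch where "ch = (\<lambda>y z l. E l + s y z l *s D l)"
  have ijk: "i \<noteq> j" "i \<noteq> k" "j \<noteq> k" "j \<noteq> i" "k \<noteq> i" "k \<noteq> j" using d by (auto simp: distinct3_def)
  have d2: "distinct3 j i k" "distinct3 k i j" using d by (auto simp: distinct3_def)
  have s: "s y z i = 0" "s y z j = y" "s y z k = z" for y z using ijk by (auto simp: s_def)
  have chnz: "nz (ch y z)" for y z using affine_nz[OF det] by (simp add: nz_def ch_def)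
  have chi: "ch y z i = E i" "ch y z j = E j + y *s D j" "ch y z k = E k + z *s D k" for y z
    by (simp_all add: ch_def s)
  define S where "S = {(y, z). pt (ch y z) \<in> Om}"
  have "inj (\<lambda>(y, z). pt (ch y z))"
  proof (rule injI, clarify)
    fix y z y' z' assume eq: "pt (ch y z) = pt (ch y' z')"
    from fun_cong[OF eq, of j] fun_cong[OF eq, of k]
    have "abs_p1 (E j + y *s D j) = abs_p1 (E j + y' *s D j)" "abs_p1 (E k + z *s D k) = abs_p1 (E k + z' *s D k)"
      by (simp_all add: pt_def chi)
    then show "y = y' \<and> z = z'" using abs_p1_affine_inj[OF det] by blast
  qed
  moreover have "(\<lambda>(y, z). pt (ch y z)) ` S \<subseteq> {x \<in> Om. x i = pt E i}"
    by (auto simp: S_def pt_def chi)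
  ultimately have finS: "finite S"
    using fin by (meson finite_imageD finite_subset inj_on_subset subset_UNIV)
  have "ch 0 0 = E" by (auto simp: ch_def s_def fun_eq_iff)
  then have S0: "(0, 0) \<in> S" using E by (simp add: S_def)
  have fj: "form c ((ch y z)(j := \<alpha> *s E j + \<beta> *s D j)) =
      (f 0 0 + f 0 1 * z + f 0 2 * z\<^sup>2) * \<alpha>\<^sup>2 + (f 1 0 + f 1 1 * z + f 1 2 * z\<^sup>2) * (\<alpha> * \<beta>) +
      (f 2 0 + f 2 1 * z + f 2 2 * z\<^sup>2) * \<beta>\<^sup>2" for y z \<alpha> \<beta>
    unfolding ch_def form_chart[OF d2(1)]
    by (simp add: sum_atMost_2 s ix_swap[OF d] f_def p_def algebra_simps)
  have fk: "form c ((ch y z)(k := \<alpha> *s E k + \<beta> *s D k)) =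
      (f 0 0 + f 1 0 * y + f 2 0 * y\<^sup>2) * \<alpha>\<^sup>2 + (f 0 1 + f 1 1 * y + f 2 1 * y\<^sup>2) * (\<alpha> * \<beta>) +
      (f 0 2 + f 1 2 * y + f 2 2 * y\<^sup>2) * \<beta>\<^sup>2" for y z \<alpha> \<beta>
    unfolding ch_def form_chart[OF d2(2)]
    by (simp add: sum_atMost_2 s ix_swap[OF d] f_def p_def algebra_simps)
  have "\<exists>a\<in>{1,2}. \<exists>b\<in>{1,2}. f a b \<in> acl ((\<lambda>(a, b). f a b) ` ({..2} \<times> {..2} - {(a, b)}))"
  proof (rule biquadratic_orbit_infinite)
    show "f 1 0 \<noteq> 0 \<or> f 0 1 \<noteq> 0" "f 2 0 \<noteq> 0" "f 0 2 \<noteq> 0"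
      using nz1 nz2 unfolding f_def p_def ix_sg[OF d] by simp_all
    show "finite S" "(0, 0) \<in> S" by fact+
  next
    fix y z assume yz: "(y, z) \<in> S" and A: "f 2 0 + f 2 1 * z + f 2 2 * z\<^sup>2 \<noteq> 0"
    have upd: "(ch y z)(j := E j + y' *s D j) = ch y' z" for y'
      by (auto simp: fun_eq_iff ch_def s_def ijk)
    have "pt (ch y z) \<in> Om" using yz by (simp add: S_def)
    from other_closed_affine[OF sub cl chnz this det chi(2) fj A]
    show "(- y - (f 1 0 + f 1 1 * z + f 1 2 * z\<^sup>2) / (f 2 0 + f 2 1 * z + f 2 2 * z\<^sup>2), z) \<in> S"
      unfolding upd by (simp add: S_def)
  next
    fix y z assume yz: "(y, z) \<in> S" and A: "f 0 2 + f 1 2 * y + f 2 2 * y\<^sup>2 \<noteq> 0"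
    have upd: "(ch y z)(k := E k + z' *s D k) = ch y z'" for z'
      by (auto simp: fun_eq_iff ch_def s_def ijk)
    have "pt (ch y z) \<in> Om" using yz by (simp add: S_def)
    from other_closed_affine[OF sub cl chnz this det chi(3) fk A]
    show "(y, - z - (f 0 1 + f 1 1 * y + f 2 1 * y\<^sup>2) / (f 0 2 + f 1 2 * y + f 2 2 * y\<^sup>2)) \<in> S"
      unfolding upd by (simp add: S_def)
  qed
  then obtain a b where ab: "a \<in> {1, 2}" "b \<in> {1, 2}"
    "f a b \<in> acl ((\<lambda>(a, b). f a b) ` ({..2} \<times> {..2} - {(a, b)}))" by blast
  define e where "e = ix i j 0 a b"
  have "e \<in> idx" unfolding e_def using ab(1,2) by (intro ix_idx) auto
  moreover have "e i = 0" "\<forall>l. l \<noteq> i \<longrightarrow> e l \<noteq> 0" using ab(1,2) ijk by (auto simp: e_def ix_def)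
  moreover have "(\<lambda>(a, b). f a b) ` ({..2} \<times> {..2} - {(a, b)}) \<subseteq> p ` {e' \<in> idx. e' i = 0 \<and> e' \<noteq> e}"
  proof (rule image_subsetI)
    fix q :: "nat \<times> nat" assume "q \<in> {..2} \<times> {..2} - {(a, b)}"
    then obtain a' b' where q: "q = (a', b')" and ab': "a' \<le> 2" "b' \<le> 2" and ne: "(a', b') \<noteq> (a, b)"
      by (cases q) auto
    have "ix i j 0 a' b' \<in> {e' \<in> idx. e' i = 0 \<and> e' \<noteq> e}"
      using ab' ne ix_inj[OF d, of 0 a' b' 0 a b] by (auto simp: e_def ix_idx ix_eval[OF d])
    then show "(case q of (a, b) \<Rightarrow> f a b) \<in> p ` {e' \<in> idx. e' i = 0 \<and> e' \<noteq> e}"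
      unfolding q f_def by simp
  qed
  then have "p e \<in> acl (p ` {e' \<in> idx. e' i = 0 \<and> e' \<noteq> e})"
    using ab(3) acl_mono unfolding e_def f_def by blast
  ultimately show ?thesis unfolding p_def by blast
qed

text \<open>If all three fibres are finite, the constant coefficient vanishes, the linear
  coefficients indexed by \<open>Z\<close> vanish, and each fibre in \<open>F\<close>, being smooth
  at the point, yields a dependent interior coefficient. These are at least four conditions against
  three parameters.\<close>

lemma some_fibre_infinite:
  assumes c: "generic c" and sub: "Om \<subseteq> surf c" and cl: "other_closed c Om" and x: "x \<in> Om"
  shows "\<exists>i. infinite {y \<in> Om. y i = x i}"
proof (rule ccontr)
  assume "\<not> ?thesis"
  then have fin: "finite {y \<in> Om. y i = x i}" for i by blast
  obtain E t where E: "\<And>l. E l \<noteq> 0" "\<And>l. abs_p1 (E l) = x l" "\<And>l j. E l $ j \<in> acl {t l}"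
    using p1_rep_acl[of "x l" for l] by metis
  have ptE: "pt E = x" "nz E" using E by (auto simp: pt_def nz_def)
  then have formE: "form c E = 0" using x sub pt_in_surf by blast
  \<comment> \<open>A rational second vector off the surface adds no parameter and makes the pure
    square coefficients nonzero.\<close>
  have "\<exists>d. (\<forall>j S. d $ j \<in> acl S) \<and> form c (E(l := d)) \<noteq> 0 \<and> det2 (E l) d \<noteq> 0" for l
    using rational_nonroot[where q = "\<lambda>u. form c (E(l := u))" and e = "E l", OF form_slot]
      no_vertical_line[OF c ptE(2), of l] formE E(1) by auto
  then obtain D where D: "\<And>l j S. D l $ j \<in> acl S" "\<And>l. form c (E(l := D l)) \<noteq> 0" "\<And>l. det2 (E l) (D l) \<noteq> 0"
    by metis
  define p where "p = base_change c E D"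
  have axis: "form c (E(l := \<alpha> *s E l + \<beta> *s D l)) = p (sg l 0) * \<alpha>\<^sup>2 + p (sg l 1) * (\<alpha> * \<beta>) + p (sg l 2) * \<beta>\<^sup>2"
    for l \<alpha> \<beta>
  proof -
    obtain j k where "distinct3 l j k" using distinct3_exists by blast
    then show ?thesis using form_chart_axis ix_sg unfolding p_def by simp
  qed
  have p2: "p (sg l 2) \<noteq> 0" for l using axis[of l 0 1] D(2)[of l] by simp
  have p0: "p (sg l 0) = 0" for l using axis[of l 1 0] formE by simp
  define Z where "Z = {l. p (sg l 1) = 0}"
  define F where "F = {i. \<exists>l. l \<noteq> i \<and> l \<notin> Z}"
  define good where "good = (\<lambda>i e. e i = 0 \<and> (\<forall>l. l \<noteq> i \<longrightarrow> e l \<noteq> 0) \<and>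
    p e \<in> acl (p ` {e' \<in> idx. e' i = 0 \<and> e' \<noteq> e}))"
  have "\<exists>e\<in>idx. good i e" if i: "i \<in> F" for i
  proof -
    obtain j where j: "j \<noteq> i" "j \<notin> Z" using i unfolding F_def by blast
    obtain k where k: "distinct3 i j k" using distinct3_third j(1) by metis
    show ?thesis
      unfolding good_def p_def
    proof (rule face_dependent[OF k sub cl D(3)])
      show "pt E \<in> Om" "finite {y \<in> Om. y i = pt E i}" using ptE x fin by simp_all
      show "base_change c E D (sg j 2) \<noteq> 0" "base_change c E D (sg k 2) \<noteq> 0" using p2 by (simp_all add: p_def)
      show "base_change c E D (sg j 1) \<noteq> 0 \<or> base_change c E D (sg k 1) \<noteq> 0" using j(2) by (simp add: Z_def p_def)
    qed
  qed
  then have "\<forall>i\<in>F. \<exists>e. e \<in> idx \<and> good i e" by blast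
  from bchoice[OF this] obtain r where r': "\<And>i. i \<in> F \<Longrightarrow> r i \<in> idx \<and> good i (r i)" by blast
  have r: "\<And>i. i \<in> F \<Longrightarrow> r i \<in> idx" "\<And>i. i \<in> F \<Longrightarrow> r i i = 0"
    "\<And>i l. i \<in> F \<Longrightarrow> l \<noteq> i \<Longrightarrow> r i l \<noteq> 0"
    "\<And>i. i \<in> F \<Longrightarrow> p (r i) \<in> acl (p ` {e' \<in> idx. e' i = 0 \<and> e' \<noteq> r i})"
    using r' by (auto simp: good_def)
  define A where "A = (\<lambda>l. sg l 1) ` Z"
  define R where "R = insert (\<lambda>_. 0) (A \<union> r ` F)"
  have sg_nz: "sg l 1 l = 1" "m \<noteq> l \<Longrightarrow> sg l 1 m = 0" for l m by (simp_all add: sg_def)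
  have "inj_on (\<lambda>l. sg l 1) Z" by (rule inj_onI) (metis sg_nz zero_neq_one)
  then have cA: "card A = card Z" by (simp add: A_def card_image)
  have "inj_on r F" by (rule inj_onI) (metis r(2,3))
  then have cF: "card (r ` F) = card F" by (rule card_image)
  have disj: "A \<inter> r ` F = {}"
  proof -
    have "sg l 1 \<noteq> r i" if "i \<in> F" for i l
    proof
      assume eq: "sg l 1 = r i"
      obtain j k where jk: "distinct3 i j k" using distinct3_exists by blast
      then have "r i j \<noteq> 0" "r i k \<noteq> 0" "j \<noteq> k" using r(3)[OF that] by (auto simp: distinct3_def)
      then show False unfolding eq[symmetric] by (metis sg_nz(2))
    qed
    then show ?thesis by (auto simp: A_def)
  qed
  have zero: "(\<lambda>_. 0) \<notin> A \<union> r ` F"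
  proof -
    have "(\<lambda>_. 0) \<noteq> sg l 1" for l using fun_cong[of "\<lambda>_. 0" "sg l 1" l] by (auto simp: sg_def)
    moreover have "(\<lambda>_. 0) \<noteq> r i" if "i \<in> F" for i
    proof
      assume eq: "(\<lambda>_. 0) = r i"
      obtain j k where "distinct3 i j k" using distinct3_exists by blast
      then show False using r(3)[OF that, of j] fun_cong[OF eq, of j] by (auto simp: distinct3_def)
    qed
    ultimately show ?thesis by (auto simp: A_def)
  qed
  have "finite A" "finite (r ` F)" by (simp_all add: A_def)
  then have "card R = Suc (card Z + card F)"
    unfolding R_def using zero disj by (simp add: card_Un_disjoint cA cF)
  \<comment> \<open>A fibre \<open>i\<close> is outside \<open>F\<close> only if both linear
    coefficients of the other directions vanish. Then either all three vanish, or the one at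
    \<open>i\<close> does not and puts the other two fibres into \<open>F\<close>.\<close>
  moreover have "3 \<le> card Z + card F"
  proof (cases "F = UNIV")
    case False
    then obtain i where "i \<notin> F" by blast
    then have *: "l \<in> Z" if "l \<noteq> i" for l using that by (auto simp: F_def)
    show ?thesis
    proof (cases "i \<in> Z")
      case True
      then have "l \<in> Z" for l using * by (cases "l = i") auto
      then have "Z = UNIV" by blast
      then show ?thesis by simp
    next
      case False
      then have "Z = UNIV - {i}" using * by blast
      moreover have "UNIV - {i} \<subseteq> F" using False by (auto simp: F_def intro!: exI[of _ i])
      then have "card (UNIV - {i}) \<le> card F" by (intro card_mono) auto
      ultimately show ?thesis by simp
    qed
  qed simp
  moreover have "card R \<le> card (range t)"
  proof (rule generic_count[OF c])
    show "det2 (E l) (D l) \<noteq> 0" for l by (rule D(3))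
    show "E l $ j \<in> acl (range t)" for l j
      using subsetD[OF acl_mono E(3)] by blast
    show "D l $ j \<in> acl (range t)" for l j by (rule D(1))
    show "finite (range t)" by simp
    show "R \<subseteq> idx" using r(1) by (auto simp: R_def A_def idx_def sg_def)
    have small: "p e \<in> acl W" if "e = (\<lambda>_. 0) \<or> e \<in> A" for e W
      using that p0[of 0] by (auto simp: A_def Z_def sg_def)
    \<comment> \<open>The dependences are not circular: for i' different from i the exponent
      \<open>r i'\<close> is nonzero at \<open>i\<close>, so it is not on the face over which
      \<open>r i\<close> depends.\<close>
    have "p (r i) \<in> acl (range t \<union> p ` (idx - R))" if i: "i \<in> F" for i
    proof -
      have "p e' \<in> acl (range t \<union> p ` (idx - R))" if e': "e' \<in> idx" "e' i = 0" "e' \<noteq> r i" for e'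
      proof (cases "e' \<in> R")
        case True
        have "e' \<notin> r ` F"
        proof
          assume "e' \<in> r ` F"
          then obtain i' where "i' \<in> F" "e' = r i'" by blast
          then show False using e'(2,3) r(3)[of i' i] by metis
        qed
        then show ?thesis using True small by (auto simp: R_def)
      next
        case False
        then show ?thesis using e'(1) by (intro acl.base) blast
      qed
      then have "p ` {e' \<in> idx. e' i = 0 \<and> e' \<noteq> r i} \<subseteq> acl (range t \<union> p ` (idx - R))" by blast
      from subsetD[OF acl_minimal[OF this] r(4)[OF i]] show ?thesis .
    qed
    then have "p ` R \<subseteq> acl (range t \<union> p ` (idx - R))"
      using small unfolding R_def by blast
    then show "base_change c E D ` R \<subseteq> acl (range t \<union> base_change c E D ` (idx - R))" by (simp add: p_def)
  qed
  moreover have "card (range t) \<le> card (UNIV :: 3 set)" by (rule card_image_le) simp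
  ultimately show False by simp
qed

section \<open>Fibres as plane curves: irreducibility and common zeros of faces\<close>

lemma eval2_sum: "eval2 (sum f A) y z = (\<Sum>i\<in>A. eval2 (f i) y z)"
  by (induction A rule: infinite_finite_induct) auto

lemma eval2_monom: "eval2 (monom c a) y z = poly c z * y ^ a"
  by (simp add: eval2_def poly_monom poly_power)

lemma eval2_power: "eval2 (F ^ n) y z = eval2 F y z ^ n"
  by (simp add: eval2_def)

lemma eval2_prod: "eval2 (prod f A) y z = (\<Prod>i\<in>A. eval2 (f i) y z)"
  by (induction A rule: infinite_finite_induct) (auto simp: eval2_def)

lemma poly_eval_eval2:
  "\<exists>G. \<forall>y z. poly_eval (\<lambda>v. eval2 (\<theta> v) y z) Q = eval2 G y z"
proof (intro exI allI)
  fix y z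
  show "poly_eval (\<lambda>v. eval2 (\<theta> v) y z) Q = eval2 (\<Sum>m\<in>Poly_Mapping.keys Q.
      [:[:Poly_Mapping.lookup Q m:]:] * (\<Prod>v\<in>Poly_Mapping.keys m. \<theta> v ^ Poly_Mapping.lookup m v)) y z"
    by (simp add: poly_eval_def monom_eval_def eval2_sum eval2_prod eval2_power)
qed

definition bipoly :: "(nat \<Rightarrow> nat \<Rightarrow> complex) \<Rightarrow> complex poly poly" where
  "bipoly f = (\<Sum>a\<le>2. monom (\<Sum>b\<le>2. monom (f a b) b) a)"

lemma coeff_bipoly: "coeff (coeff (bipoly f) a) b = (if a \<le> 2 \<and> b \<le> 2 then f a b else 0)"
  by (auto simp: bipoly_def coeff_sum)

lemma eval2_bipoly: "eval2 (bipoly f) y z = (\<Sum>a\<le>2. \<Sum>b\<le>2. f a b * y ^ a * z ^ b)"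
  by (simp add: bipoly_def eval2_sum eval2_monom poly_sum poly_monom sum_distrib_left sum_distrib_right mult_ac)

lemma degree_bipoly: "degree (bipoly f) \<le> 2" "inner_degree (bipoly f) \<le> 2"
proof -
  show "degree (bipoly f) \<le> 2"
    by (rule degree_le) (simp add: poly_eq_iff coeff_bipoly)
  have "degree (coeff (bipoly f) i) \<le> 2" for i
    by (rule degree_le) (simp add: coeff_bipoly)
  then show "inner_degree (bipoly f) \<le> 2" by (rule inner_degree_le)
qed

lemma coeff_mult2:
  "coeff (coeff (F * G :: complex poly poly) a) b =
    (\<Sum>s\<le>a. \<Sum>t\<le>b. coeff (coeff F s) t * coeff (coeff G (a - s)) (b - t))"
  by (simp add: coeff_mult coeff_sum)

definition coeff_set :: "complex poly poly \<Rightarrow> (nat \<times> nat) set \<Rightarrow> complex set" where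
  "coeff_set F I = (\<lambda>(a, b). coeff (coeff F a) b) ` I"

lemma card_coeff_set: "finite I \<Longrightarrow> card (coeff_set F I) \<le> card I"
  unfolding coeff_set_def by (rule card_image_le)

lemma coeff_mult2_acl:
  assumes "\<And>a b. coeff (coeff F a) b \<in> acl S" "\<And>a b. coeff (coeff G a) b \<in> acl S"
  shows "coeff (coeff (F * G) a) b \<in> acl S"
  unfolding coeff_mult2 by (intro acl_sum acl.mult assms)

lemma card_face:
  assumes "distinct3 i j k" "N \<subseteq> {..2 :: nat} \<times> {..2 :: nat}"
  shows "card ((\<lambda>(a, b). ix i j n a b) ` N) = card N"
  using ix_inj[OF assms(1)] by (intro card_image inj_onI) fastforce

text \<open>Two factors with bidegrees adding up to at most (2,2), neither of them (0,0), have at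
  most 8 coefficients together. Normalising one leaves 7, the fibre parameter \<open>t\<close> makes
  8, and these cannot account for the nine coefficients of the face.\<close>

lemma fibre_irreducible:
  assumes c: "generic c" and d: "distinct3 i j k"
    and det: "\<And>l. det2 (E l) (D l) \<noteq> 0"
    and ED: "\<And>l m. E l $ m \<in> acl {t}" "\<And>l m. D l $ m \<in> acl {t}"
  shows "irreducible (bipoly (\<lambda>a b. base_change c E D (ix i j 0 a b)))"
proof -
  define p where "p = base_change c E D"
  define f where "f = bipoly (\<lambda>a b. p (ix i j 0 a b))"
  have f: "coeff (coeff f a) b = p (ix i j 0 a b)" if "a \<le> 2" "b \<le> 2" for a b
    using that by (simp add: f_def coeff_bipoly)
  have count: "card N \<le> card (insert t T)"
    if T: "finite T" and N: "N \<subseteq> {..2} \<times> {..2}"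
      and sub: "\<And>a b. (a, b) \<in> N \<Longrightarrow> coeff (coeff f a) b \<in> acl (insert t T)" for T N
  proof -
    let ?R = "(\<lambda>(a, b). ix i j 0 a b) ` N"
    have "card ?R \<le> card (insert t T)"
    proof (rule generic_count[OF c det])
      have mono: "acl {t} \<subseteq> acl (insert t T)" by (rule acl_mono) auto
      show "E l $ m \<in> acl (insert t T)" "D l $ m \<in> acl (insert t T)" for l m using ED mono by blast+
      show "finite (insert t T)" using T by simp
      show "?R \<subseteq> idx" using N by (auto simp: ix_idx)
      have sub1: "acl (insert t T) \<subseteq> acl (insert t T \<union> base_change c E D ` (idx - ?R))" by (rule acl_mono) auto
      have sub2: "p (ix i j 0 a b) \<in> acl (insert t T)" if "(a, b) \<in> N" for a b
        using sub[OF that] f[of a b] N that by auto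
      have "p e \<in> acl (insert t T \<union> base_change c E D ` (idx - ?R))" if e: "e \<in> ?R" for e
      proof -
        obtain a b where "e = ix i j 0 a b" "(a, b) \<in> N" using e by auto
        then show ?thesis using sub1 sub2 by blast
      qed
      then show "base_change c E D ` ?R \<subseteq> acl (insert t T \<union> base_change c E D ` (idx - ?R))"
        unfolding p_def by (rule image_subsetI)
    qed
    then show ?thesis using card_face[OF d N, of 0] by simp
  qed
  have f0: "f \<noteq> 0"
  proof
    assume "f = 0"
    then have "card ({..2 :: nat} \<times> {..2 :: nat}) \<le> card (insert t {})" by (intro count) auto
    then show False by simp
  qed
  have "\<not> f dvd 1"
  proof
    assume "f dvd 1"
    then have "degree f = 0" by (metis degree_1 dvd_imp_degree_le le_zero_eq one_neq_zero)
    obtain g where "1 = f * g" using \<open>f dvd 1\<close> by (auto elim: dvdE)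
    then have "inner_degree f + inner_degree g \<le> inner_degree (1 :: complex poly poly)"
      using inner_degree_mult[of f g] by (metis mult_zero_left mult_zero_right zero_neq_one)
    also have "inner_degree (1 :: complex poly poly) \<le> 0"
      by (rule inner_degree_le) (simp add: one_pCons coeff_pCons split: nat.split)
    finally have "inner_degree f = 0" by simp
    then have zero: "coeff (coeff f a) b = 0" if "(a, b) \<noteq> (0, 0)" for a b
      using that \<open>degree f = 0\<close> degree_coeff_le_inner[of f a] by (cases a) (auto simp: coeff_eq_0)
    \<comment> \<open>A unit has a constant term only: eight vanishing coefficients against one
      parameter.\<close>
    have "card ({..2 :: nat} \<times> {..2 :: nat} - {(0, 0)}) \<le> card (insert t {})"
      by (rule count) (use zero in auto)
    then show False by (simp add: card_Diff_subset)
  qed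
  moreover have "q dvd 1 \<or> r dvd 1" if qr: "f = q * r" for q r
  proof (rule ccontr)
    assume neg: "\<not> (q dvd 1 \<or> r dvd 1)"
    have q0: "q \<noteq> 0" "r \<noteq> 0" using f0 qr by auto
    define dq iq dr ir where "dq = degree q" and "iq = inner_degree q" and "dr = degree r" and "ir = inner_degree r"
    have "dq + dr \<le> 2" "iq + ir \<le> 2"
      using degree_bipoly[of "\<lambda>a b. p (ix i j 0 a b)"] inner_degree_mult[OF q0] degree_mult_eq[OF q0]
      by (simp_all add: f_def[symmetric] qr dq_def iq_def dr_def ir_def)
    moreover have "\<not> (dq = 0 \<and> iq = 0)" "\<not> (dr = 0 \<and> ir = 0)"
      using neg is_unit_bidegree_0 q0 unfolding dq_def iq_def dr_def ir_def by blast+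
    ultimately have arith: "(dq + 1) * (iq + 1) + (dr + 1) * (ir + 1) \<le> 8"
    proof -
      assume a: "dq + dr \<le> 2" "iq + ir \<le> 2" "\<not> (dq = 0 \<and> iq = 0)" "\<not> (dr = 0 \<and> ir = 0)"
      then have "dq \<in> {0, 1, 2}" "iq \<in> {0, 1, 2}" "dr \<in> {0, 1, 2}" "ir \<in> {0, 1, 2}" by auto
      then show ?thesis using a by auto
    qed
    \<comment> \<open>Scaling the factors inversely makes one coefficient of \<open>q'\<close> equal
      to 1; without this the count would only be 9 against 9.\<close>
    obtain a0 where "coeff (coeff q a0) iq \<noteq> 0" using inner_degree_attained[OF q0(1)] by (auto simp: iq_def)
    define lam where "lam = coeff (coeff q a0) iq"
    have lam: "lam \<noteq> 0" by (simp add: lam_def) fact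
    have "a0 \<le> dq" unfolding dq_def by (rule le_degree) (use \<open>coeff (coeff q a0) iq \<noteq> 0\<close> in auto)
    define q' where "q' = smult [:inverse lam:] q"
    define r' where "r' = smult [:lam:] r"
    have f': "f = q' * r'" using lam by (simp add: qr q'_def r'_def one_pCons[symmetric])
    have cq: "coeff (coeff q' a) b = inverse lam * coeff (coeff q a) b"
      and cr: "coeff (coeff r' a) b = lam * coeff (coeff r a) b" for a b
      by (simp_all add: q'_def r'_def)
    define T where "T = coeff_set q' ({..dq} \<times> {..iq} - {(a0, iq)}) \<union> coeff_set r' ({..dr} \<times> {..ir})"
    have Tacl: "coeff_set q' ({..dq} \<times> {..iq} - {(a0, iq)}) \<subseteq> acl (insert t T)"
      "coeff_set r' ({..dr} \<times> {..ir}) \<subseteq> acl (insert t T)"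
      using acl_subset[of "insert t T"] by (auto simp: T_def)
    have cq_acl: "coeff (coeff q' a) b \<in> acl (insert t T)" for a b
    proof -
      consider "(a, b) = (a0, iq)" | "(a, b) \<in> {..dq} \<times> {..iq} - {(a0, iq)}" | "a > dq \<or> b > iq"
        by (cases "a \<le> dq \<and> b \<le> iq"; cases "(a, b) = (a0, iq)") auto
      then show ?thesis
      proof cases
        case 1
        then show ?thesis using lam by (simp add: cq lam_def acl.one)
      next
        case 2
        have "coeff (coeff q' a) b \<in> coeff_set q' ({..dq} \<times> {..iq} - {(a0, iq)})"
          unfolding coeff_set_def by (rule image_eqI[OF _ 2]) simp
        then show ?thesis using Tacl(1) by blast
      next
        case 3
        then have "coeff (coeff q a) b = 0"
          using degree_coeff_le_inner[of q a] by (auto simp: dq_def iq_def coeff_eq_0)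
        then show ?thesis by (simp add: cq)
      qed
    qed
    have cr_acl: "coeff (coeff r' a) b \<in> acl (insert t T)" for a b
    proof (cases "(a, b) \<in> {..dr} \<times> {..ir}")
      case True
      have "coeff (coeff r' a) b \<in> coeff_set r' ({..dr} \<times> {..ir})"
        unfolding coeff_set_def by (rule image_eqI[OF _ True]) simp
      then show ?thesis using Tacl(2) by blast
    next
      case False
      then have "coeff (coeff r a) b = 0"
        using degree_coeff_le_inner[of r a] by (auto simp: dr_def ir_def coeff_eq_0)
      then show ?thesis by (simp add: cr)
    qed
    have "card ({..2 :: nat} \<times> {..2 :: nat}) \<le> card (insert t T)"
    proof (rule count)
      show "finite T" by (simp add: T_def coeff_set_def)
      show "coeff (coeff f a) b \<in> acl (insert t T)" for a b
        unfolding f' by (rule coeff_mult2_acl[OF cq_acl cr_acl])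
    qed simp
    moreover have "card (insert t T) \<le> Suc (card T)" by (simp add: card_insert_if T_def coeff_set_def)
    moreover have "card T \<le> card ({..dq} \<times> {..iq} - {(a0, iq)}) + card ({..dr} \<times> {..ir})"
      unfolding T_def by (rule order_trans[OF card_Un_le]) (intro add_mono card_coeff_set; simp)
    moreover have "card ({..dq} \<times> {..iq} - {(a0, iq)}) = (dq + 1) * (iq + 1) - 1"
      using \<open>a0 \<le> dq\<close> by (subst card_Diff_singleton) auto
    ultimately show False using arith by simp
  qed
  ultimately have "irreducible f" using f0 unfolding Factorial_Ring.irreducible_def by blast
  then show ?thesis by (simp add: f_def p_def)
qed

lemma cofactor_bound:
  assumes "\<not> (x = 0 \<and> y = 0)" "x \<le> 2" "y \<le> 2"
  shows "Suc (2 - x) * Suc (2 - y) \<le> 6"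
  using le_2_cases[OF assms(2)] le_2_cases[OF assms(3)] assms(1) by auto

text \<open>Infinitely many common zeros force the irreducible \<open>f\<close> to divide
  \<open>h\<close>. The cofactor has at most 6 coefficients, so the 18 coefficients of two faces
  depend, besides the third face, on 9 + 6 coefficients, the fibre parameter and the ratio of the
  weights, 17 numbers in all.\<close>

lemma no_common_fibre:
  assumes c: "generic c" and d: "distinct3 i j k"
    and det: "\<And>l. det2 (E l) (D l) \<noteq> 0"
    and ED: "\<And>l m. E l $ m \<in> acl {t}" "\<And>l m. D l $ m \<in> acl {t}"
    and w: "w1 \<noteq> 0 \<or> w2 \<noteq> 0"
  shows "finite {(y, z). eval2 (bipoly (\<lambda>a b. base_change c E D (ix i j 0 a b))) y z = 0 \<and>
    eval2 (bipoly (\<lambda>a b. w1 * base_change c E D (ix i j 1 a b) + w2 * base_change c E D (ix i j 2 a b))) y z = 0}"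
proof (rule ccontr)
  define p where "p = base_change c E D"
  define f where "f = bipoly (\<lambda>a b. p (ix i j 0 a b))"
  define h where "h = bipoly (\<lambda>a b. w1 * p (ix i j 1 a b) + w2 * p (ix i j 2 a b))"
  assume "\<not> ?thesis"
  then have inf: "infinite {(y, z). eval2 f y z = 0 \<and> eval2 h y z = 0}" by (simp add: f_def h_def p_def)
  have irr: "irreducible f" unfolding f_def p_def by (rule fibre_irreducible[OF c d det ED])
  have "f dvd h" by (rule irreducible_dvd_of_infinite_zeros[OF irr inf])
  then obtain r where r: "h = f * r" by (auto elim: dvdE)
  have f0: "f \<noteq> 0" "\<not> f dvd 1" using irr unfolding Factorial_Ring.irreducible_def by blast+
  \<comment> \<open>The face \<open>n\<close> has nonzero weight and is solved for; the face
    \<open>n'\<close> stays free. After division by \<open>wn\<close> only the ratio of the weights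
    is left as a parameter.\<close>
  define n n' wn wn' where "n = (if w1 \<noteq> 0 then 1 else 2 :: nat)" and "n' = (if w1 \<noteq> 0 then 2 else 1 :: nat)"
    and "wn = (if w1 \<noteq> 0 then w1 else w2)" and "wn' = (if w1 \<noteq> 0 then w2 else w1)"
  have wn: "wn \<noteq> 0" using w by (auto simp: wn_def)
  have n: "n \<le> 2" "n' \<le> 2" "n \<noteq> n'" "n \<noteq> 0" "n' \<noteq> 0" by (auto simp: n_def n'_def)
  have h: "coeff (coeff h a) b = wn * p (ix i j n a b) + wn' * p (ix i j n' a b)" if "a \<le> 2" "b \<le> 2" for a b
    using that by (auto simp: h_def coeff_bipoly n_def n'_def wn_def wn'_def)
  define r' where "r' = smult [:inverse wn:] r"
  have cr: "coeff (coeff r' a) b = inverse wn * coeff (coeff r a) b" for a b by (simp add: r'_def)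
  define I where "I = {..2 - degree f} \<times> {..2 - inner_degree f}"
  have rI: "coeff (coeff r a) b = 0" if "(a, b) \<notin> I" for a b
  proof (cases "r = 0")
    case False
    have "degree h \<le> 2" "inner_degree h \<le> 2" unfolding h_def by (rule degree_bipoly)+
    then have "degree f + degree r \<le> 2" "inner_degree f + inner_degree r \<le> 2"
      using inner_degree_mult[OF f0(1) False] degree_mult_eq[OF f0(1) False] unfolding r by linarith+
    then have "a > degree r \<or> b > inner_degree r" using that by (auto simp: I_def)
    then show ?thesis using degree_coeff_le_inner[of r a] by (auto simp: coeff_eq_0)
  qed simp
  have cardI: "card I \<le> 6"
  proof -
    have "\<not> (degree f = 0 \<and> inner_degree f = 0)" using f0 is_unit_bidegree_0 by blast
    moreover have "degree f \<le> 2" "inner_degree f \<le> 2" unfolding f_def by (rule degree_bipoly)+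
    ultimately have "Suc (2 - degree f) * Suc (2 - inner_degree f) \<le> 6"
      by (intro cofactor_bound) 
    then show ?thesis by (simp add: I_def)
  qed
  let ?N = "{..2 :: nat} \<times> {..2 :: nat}"
  define T where "T = {t, wn' / wn} \<union> (coeff_set f ?N \<union> coeff_set r' I)"
  define R where "R = (\<lambda>(a, b). ix i j 0 a b) ` ?N \<union> (\<lambda>(a, b). ix i j n a b) ` ?N"
  have "card R = card ((\<lambda>(a, b). ix i j 0 a b) ` ?N) + card ((\<lambda>(a, b). ix i j n a b) ` ?N)"
    unfolding R_def
  proof (rule card_Un_disjoint)
    show "(\<lambda>(a, b). ix i j 0 a b) ` ?N \<inter> (\<lambda>(a, b). ix i j n a b) ` ?N = {}"
      using ix_inj[OF d] n(4) by fastforce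
  qed auto
  then have "card R = 18" using card_face[OF d, of ?N] by simp
  moreover have "card R \<le> card T"
  proof (rule generic_count[OF c det])
    have mono: "acl {t} \<subseteq> acl T" by (rule acl_mono) (auto simp: T_def)
    show "E l $ m \<in> acl T" "D l $ m \<in> acl T" for l m using ED mono by blast+
    show "finite T" by (simp add: T_def coeff_set_def I_def)
    show "R \<subseteq> idx" using n by (auto simp: R_def ix_idx)
    let ?S = "T \<union> p ` (idx - R)"
    have S: "coeff_set f ?N \<subseteq> acl ?S" "coeff_set r' I \<subseteq> acl ?S" "wn' / wn \<in> acl ?S"
      using acl_subset[of ?S] by (auto simp: T_def)
    have fN: "coeff (coeff f a) b \<in> acl ?S" for a b
    proof (cases "(a, b) \<in> ?N")
      case True
      have "coeff (coeff f a) b \<in> coeff_set f ?N"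
        unfolding coeff_set_def by (rule image_eqI[OF _ True]) simp
      then show ?thesis using S(1) by blast
    next
      case False
      then have "coeff (coeff f a) b = 0" by (auto simp: f_def coeff_bipoly)
      then show ?thesis by simp
    qed
    have rN: "coeff (coeff r' a) b \<in> acl ?S" for a b
    proof (cases "(a, b) \<in> I")
      case True
      have "coeff (coeff r' a) b \<in> coeff_set r' I"
        unfolding coeff_set_def by (rule image_eqI[OF _ True]) simp
      then show ?thesis using S(2) by blast
    qed (simp add: cr rI)
    have p0: "p (ix i j 0 a b) \<in> acl ?S" if "a \<le> 2" "b \<le> 2" for a b
      using fN[of a b] that by (simp add: f_def coeff_bipoly)
    have pn: "p (ix i j n a b) \<in> acl ?S" if ab: "a \<le> 2" "b \<le> 2" for a b
    proof -
      have "ix i j n' a b \<in> idx - R"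
        using ab n ix_inj[OF d, of n' a b] by (auto simp: R_def ix_idx)
      then have "p (ix i j n' a b) \<in> acl ?S" by (intro acl.base) blast
      moreover have e1: "coeff (coeff (f * r') a) b = inverse wn * coeff (coeff h a) b"
        unfolding r r'_def mult_smult_right by simp
      have "x = inverse wn * (wn * x + wn' * y) - wn' / wn * y" for x y
        using wn by (simp add: distrib_left divide_inverse)
      then have "p (ix i j n a b) = coeff (coeff (f * r') a) b - wn' / wn * p (ix i j n' a b)"
        unfolding e1 h[OF ab] .
      ultimately show ?thesis
        using coeff_mult2_acl[OF fN rN, of a b] S(3) by (simp only: acl.diff acl.mult)
    qed
    show "base_change c E D ` R \<subseteq> acl (T \<union> base_change c E D ` (idx - R))"
      using p0 pn unfolding p_def[symmetric] by (auto simp: R_def)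
  qed
  moreover have "card T \<le> 2 + (9 + 6)"
  proof -
    have "card {t, wn' / wn} \<le> 2" using card_insert_le_m1[of 2 "{wn' / wn}" t] by simp
    moreover have "card (coeff_set f ?N) \<le> 9" using card_coeff_set[of ?N f] by simp
    moreover have "card (coeff_set r' I) \<le> 6"
      using card_coeff_set[of I r'] cardI by (simp add: I_def)
    ultimately show ?thesis
      unfolding T_def by (intro order_trans[OF card_Un_le add_mono] order_trans[OF card_Un_le add_mono])
  qed
  ultimately show False by simp
qed

subsection \<open>Vanishing on orbits\<close>

definition chart :: "(3 \<Rightarrow> complex ^ 2) \<Rightarrow> (3 \<Rightarrow> complex ^ 2) \<Rightarrow> 3 \<Rightarrow> 3 \<Rightarrow> complex \<Rightarrow> complex \<Rightarrow> 3 \<Rightarrow> complex ^ 2" where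
  "chart E D j k y z = (\<lambda>l. E l + (if l = j then y else if l = k then z else 0) *s D l)"

lemma chart_eval:
  assumes "distinct3 i j k"
  shows "chart E D j k y z i = E i" "chart E D j k y z j = E j + y *s D j" "chart E D j k y z k = E k + z *s D k"
  using assms by (auto simp: chart_def distinct3_def)

lemma nz_chart: "(\<And>l. det2 (E l) (D l) \<noteq> 0) \<Longrightarrow> nz (chart E D j k y z)"
  using affine_nz by (simp add: nz_def chart_def)

lemma form_chart_fibre:
  assumes d: "distinct3 i j k"
  shows "form c ((chart E D j k y z)(i := \<alpha> *s E i + \<beta> *s D i)) =
    eval2 (bipoly (\<lambda>a b. base_change c E D (ix i j 0 a b))) y z * \<alpha>\<^sup>2 +
    eval2 (bipoly (\<lambda>a b. base_change c E D (ix i j 1 a b))) y z * (\<alpha> * \<beta>) +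
    eval2 (bipoly (\<lambda>a b. base_change c E D (ix i j 2 a b))) y z * \<beta>\<^sup>2"
proof -
  have jk: "j \<noteq> k" "k \<noteq> j" using d by (auto simp: distinct3_def)
  have "form c ((chart E D j k y z)(i := \<alpha> *s E i + \<beta> *s D i)) =
      (\<Sum>n\<le>2. eval2 (bipoly (\<lambda>a b. base_change c E D (ix i j n a b))) y z * (\<beta> ^ n * \<alpha> ^ (2 - n)))"
    using form_chart[OF d, of c E "\<lambda>l. if l = j then y else if l = k then z else 0" D \<alpha> \<beta>]
    unfolding chart_def eval2_bipoly by (simp add: jk)
  then show ?thesis by (simp add: sum_atMost_2 mult_ac)
qed

lemma form_chart_0:
  assumes "distinct3 i j k"
  shows "form c (chart E D j k y z) = eval2 (bipoly (\<lambda>a b. base_change c E D (ix i j 0 a b))) y z"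
proof -
  have "(chart E D j k y z)(i := 1 *s E i + 0 *s D i) = chart E D j k y z"
    using chart_eval(1)[OF assms, of E D y z] by (auto simp: fun_eq_iff)
  then show ?thesis using form_chart_fibre[OF assms, of c E D y z 1 0] by simp
qed

lemma det2_nz_imp: "det2 u v \<noteq> 0 \<Longrightarrow> u \<noteq> 0 \<and> v \<noteq> 0"
  by auto

text \<open>What the chart misses of a fibre lies on the two lines where a coordinate is that of
  \<open>D\<close>, and each of these meets the surface in finitely many points.\<close>

lemma chart_cover:
  assumes c: "generic c" and d: "distinct3 i j k" and det: "\<And>l. det2 (E l) (D l) \<noteq> 0"
    and W: "infinite W" "W \<subseteq> {x \<in> surf c. x i = abs_p1 (E i)}"
  shows "infinite {(y, z). pt (chart E D j k y z) \<in> W}"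
proof
  assume fin: "finite {(y, z). pt (chart E D j k y z) \<in> W}"
  have ij: "i \<noteq> j" "i \<noteq> k" using d by (auto simp: distinct3_def)
  define L where "L = (\<lambda>m. {x \<in> surf c. x i = abs_p1 (E i) \<and> x m = abs_p1 (D m)})"
  have "finite (L j)" "finite (L k)" unfolding L_def using line_finite[OF c] ij by blast+
  then have "infinite (W - (L j \<union> L k))" using W(1) by (metis Diff_infinite_finite finite_Un)
  moreover have "W - (L j \<union> L k) \<subseteq> (\<lambda>(y, z). pt (chart E D j k y z)) ` {(y, z). pt (chart E D j k y z) \<in> W}"
  proof
    fix x assume x: "x \<in> W - (L j \<union> L k)"
    have "\<exists>s. x m = abs_p1 (E m + s *s D m)" if "x m \<noteq> abs_p1 (D m)" for m
    proof -
      obtain u where u: "u \<noteq> 0" "abs_p1 u = x m" using p1_rep by blast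
      have "D m \<noteq> 0" using det2_nz_imp[OF det] by blast
      then have "det2 u (D m) \<noteq> 0" using abs_p1_eq_iff[OF u(1), of "D m"] that u(2) by auto
      then show ?thesis using abs_p1_affine_surj[OF det u(1)] u(2) by metis
    qed
    moreover have "x j \<noteq> abs_p1 (D j)" "x k \<noteq> abs_p1 (D k)" using x W(2) by (auto simp: L_def)
    ultimately obtain y z where yz: "x j = abs_p1 (E j + y *s D j)" "x k = abs_p1 (E k + z *s D k)" by metis
    have xeq: "x = pt (chart E D j k y z)"
    proof
      fix l
      have "l \<in> {i, j, k}" using UNIV_3_distinct[OF d] by blast
      then show "x l = pt (chart E D j k y z) l"
        using x W(2) yz chart_eval[OF d, of E D y z] by (auto simp: pt_def)
    qed
    then show "x \<in> (\<lambda>(y, z). pt (chart E D j k y z)) ` {(y, z). pt (chart E D j k y z) \<in> W}"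
      using x by (intro image_eqI[of _ _ "(y, z)"]) auto
  qed
  ultimately show False using fin finite_subset by blast
qed

text \<open>The fibre is irreducible, so infinitely many zeros make its equation divide
  \<open>Q\<close> in a chart. The chart has to be adapted to \<open>x\<close>, since the conclusion
  is wanted at every point of the fibre.\<close>

lemma fibre_vanishing:
  assumes c: "generic c" and Q: "multihomogeneous dg Q"
    and inf: "infinite {x \<in> surf c. x i = a \<and> vanishes_at Q x}"
    and x: "x \<in> surf c" "x i = a"
  shows "vanishes_at Q x"
proof -
  obtain j k where d: "distinct3 i j k" using distinct3_exists by blast
  obtain e t where e: "e \<noteq> 0" "abs_p1 e = a" "\<And>m. e $ m \<in> acl {t}" using p1_rep_acl by blast
  obtain v where v: "nz v" "pt v = x" using pt_rep by blast
  define u where "u = v(i := e)"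
  have u: "nz u" "pt u = x" using v x(2) e by (auto simp: u_def nz_upd pt_upd)
  have "\<exists>m. det2 (u l) (ax m) \<noteq> 0" for l using ax_independent u(1) by (simp add: nz_def)
  then obtain m where m: "\<And>l. det2 (u l) (ax (m l)) \<noteq> 0" by metis
  define D where "D = (\<lambda>l. ax (m l))"
  \<comment> \<open>\<open>D l\<close> represents a point other than the coordinate of
    \<open>x\<close>, so \<open>x\<close> lies in the chart; \<open>ax (m l + 1)\<close> is the
    other axis vector, addition being modulo 2. Only the vector on the factor \<open>i\<close> costs
    a parameter.\<close>
  define E where "E = (\<lambda>l. if l = i then e else ax (m l + 1))"
  have det: "det2 (E l) (D l) \<noteq> 0" for l
    using m[of i] two_cases[of "m l"] by (auto simp: E_def D_def u_def det2_def)
  have ED: "E l $ r \<in> acl {t}" "D l $ r \<in> acl {t}" for l r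
    by (auto simp: E_def D_def e(3) simp del: ax_nth)
  have Ei: "abs_p1 (E i) = a" using e(2) by (simp add: E_def)
  let ?f = "bipoly (\<lambda>a b. base_change c E D (ix i j 0 a b))"
  let ?ch = "chart E D j k"
  define \<theta> where "\<theta> = (\<lambda>(l, r). [:[:E l $ r:]:] +
    (if l = j then [:0, [:D l $ r:]:] else if l = k then [:[:0, D l $ r:]:] else 0))"
  have th: "(\<lambda>v. eval2 (\<theta> v) y z) = coord_fun (?ch y z)" for y z
    by (auto simp: fun_eq_iff \<theta>_def chart_def eval2_def)
  obtain G where G: "\<And>y z. poly_eval (coord_fun (?ch y z)) Q = eval2 G y z"
    using poly_eval_eval2[of \<theta> Q] unfolding th by blast
  have chnz: "nz (?ch y z)" for y z by (rule nz_chart[OF det])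
  have zero_f: "pt (?ch y z) \<in> surf c \<longleftrightarrow> eval2 ?f y z = 0" for y z
    using pt_in_surf[OF chnz] form_chart_0[OF d] by simp
  have zero_G: "vanishes_at Q (pt (?ch y z)) \<longleftrightarrow> eval2 G y z = 0" for y z
    using vanishes_at_iff[OF Q, of "?ch y z"] chnz G by (simp add: hom_coords_iff)
  have irr: "irreducible ?f" by (rule fibre_irreducible[OF c d det ED])
  have "infinite {(y, z). pt (?ch y z) \<in> {x \<in> surf c. x i = a \<and> vanishes_at Q x}}"
    by (rule chart_cover[OF c d det inf]) (use Ei in auto)
  moreover have "{(y, z). pt (?ch y z) \<in> {x \<in> surf c. x i = a \<and> vanishes_at Q x}}
      \<subseteq> {(y, z). eval2 ?f y z = 0 \<and> eval2 G y z = 0}"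
    using zero_f zero_G by auto
  ultimately have "infinite {(y, z). eval2 ?f y z = 0 \<and> eval2 G y z = 0}" using finite_subset by blast
  then have "?f dvd G" by (rule irreducible_dvd_of_infinite_zeros[OF irr])
  then obtain g where g: "G = ?f * g" by (auto elim: dvdE)
  have "\<exists>s. x l = abs_p1 (E l + s *s D l)" for l
    using abs_p1_affine_surj[OF det, of "u l" l] m[of l] u by (auto simp: D_def nz_def pt_def)
  then obtain y z where yz: "x j = abs_p1 (E j + y *s D j)" "x k = abs_p1 (E k + z *s D k)" by metis
  have "x = pt (?ch y z)"
  proof
    fix l
    have "l \<in> {i, j, k}" using UNIV_3_distinct[OF d] by blast
    then show "x l = pt (?ch y z) l" using x yz Ei chart_eval[OF d, of E D y z] by (auto simp: pt_def)
  qed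
  then show ?thesis using x(1) zero_f[of y z] zero_G[of y z] g by simp
qed

text \<open>Over a point of the fibre the equation is f1 \<alpha> \<beta> + f2 \<beta>^2, so the
  second root solves f1 \<alpha> + f2 \<beta> = 0. A constant second root is thus a fixed linear
  relation between the faces 1 and 2, which \<open>no_common_fibre\<close> allows at finitely many
  points only.\<close>

lemma no_constant_other:
  assumes c: "generic c"
  shows "finite {x \<in> surf c. x i = a \<and> (\<exists>v w. nz v \<and> pt v = x \<and> other c i v w \<and> abs_p1 w = a')}"
    (is "finite ?W")
proof (rule ccontr)
  assume inf: "infinite ?W"
  obtain j k where d: "distinct3 i j k" using distinct3_exists by blast
  obtain e t where e: "e \<noteq> 0" "abs_p1 e = a" "\<And>m. e $ m \<in> acl {t}" using p1_rep_acl by blast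
  obtain w0 where w0: "w0 \<noteq> 0" "abs_p1 w0 = a'" using p1_rep by blast
  obtain m where m: "det2 e (ax m) \<noteq> 0" using ax_independent[OF e(1)] by blast
  define D where "D = (\<lambda>l. if l = i then ax m else ax 0)"
  define E where "E = (\<lambda>l. if l = i then e else ax 1)"
  have det: "det2 (E l) (D l) \<noteq> 0" for l
    using m by (auto simp: E_def D_def det2_def[of "ax 1"])
  have ED: "E l $ r \<in> acl {t}" "D l $ r \<in> acl {t}" for l r
    by (auto simp: E_def D_def e(3) simp del: ax_nth)
  have Ei: "abs_p1 (E i) = a" using e(2) by (simp add: E_def)
  let ?ch = "chart E D j k"
  let ?f = "\<lambda>n. eval2 (bipoly (\<lambda>a b. base_change c E D (ix i j n a b)))"
  define \<Delta> where "\<Delta> = det2 (E i) (D i)"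
  define \<alpha>0 \<beta>0 where "\<alpha>0 = det2 w0 (D i) / \<Delta>" and "\<beta>0 = det2 (E i) w0 / \<Delta>"
  have w0eq: "w0 = \<alpha>0 *s E i + \<beta>0 *s D i"
    using det2_expand[OF det[of i], of w0] by (simp add: \<alpha>0_def \<beta>0_def \<Delta>_def)
  then have nz0: "\<alpha>0 \<noteq> 0 \<or> \<beta>0 \<noteq> 0" using w0(1) by auto
  have inf2: "infinite {(y, z). pt (?ch y z) \<in> ?W}"
    by (rule chart_cover[OF c d det inf]) (use Ei in auto)
  have sub: "{(y, z). pt (?ch y z) \<in> ?W} \<subseteq> {(y, z). ?f 0 y z = 0 \<and>
      eval2 (bipoly (\<lambda>a b. \<alpha>0 * base_change c E D (ix i j 1 a b) + \<beta>0 * base_change c E D (ix i j 2 a b))) y z = 0}"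
  proof clarify
    fix y z v w assume s: "pt (?ch y z) \<in> surf c" and v: "nz v" "pt v = pt (?ch y z)" "other c i v w" "a' = abs_p1 w"
    have "other c i (?ch y z) w0"
      using other_transfer[OF v(1) nz_chart[OF det] v(2) w0(1) _ v(3)] w0(2) v(4) by simp
    then obtain K where K: "\<And>u. form c ((?ch y z)(i := u)) = K * det2 (E i) u * det2 w0 u"
      by (auto simp: other_def chart_eval[OF d])
    have dets: "det2 (E i) (\<alpha> *s E i + \<beta> *s D i) = \<beta> * \<Delta>"
      "det2 w0 (\<alpha> *s E i + \<beta> *s D i) = (\<alpha>0 * \<beta> - \<beta>0 * \<alpha>) * \<Delta>" for \<alpha> \<beta>
      unfolding w0eq \<Delta>_def by (simp_all add: det2_add det2_swap[of "D i" "E i"] algebra_simps)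
    have eq: "?f 0 y z * \<alpha>\<^sup>2 + ?f 1 y z * (\<alpha> * \<beta>) + ?f 2 y z * \<beta>\<^sup>2 = K * (\<beta> * \<Delta>) * ((\<alpha>0 * \<beta> - \<beta>0 * \<alpha>) * \<Delta>)"
      for \<alpha> \<beta>
      using form_chart_fibre[OF d, of c E D y z \<alpha> \<beta>] K[of "\<alpha> *s E i + \<beta> *s D i"] unfolding dets by simp
    have f0: "?f 0 y z = 0" using eq[of 1 0] by simp
    moreover have f2: "?f 2 y z = K * \<Delta> * (\<alpha>0 * \<Delta>)" using eq[of 0 1] by simp
    moreover have "?f 1 y z = - (K * \<Delta> * (\<beta>0 * \<Delta>))"
    proof -
      have "?f 1 y z = K * \<Delta> * ((\<alpha>0 - \<beta>0) * \<Delta>) - ?f 2 y z"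
        using eq[of 1 1] f0 by (simp add: eq_diff_eq)
      then show ?thesis unfolding f2 by (simp add: algebra_simps)
    qed
    ultimately have "\<alpha>0 * ?f 1 y z + \<beta>0 * ?f 2 y z = 0" by simp
    moreover have "eval2 (bipoly (\<lambda>a b. \<alpha>0 * base_change c E D (ix i j 1 a b) + \<beta>0 * base_change c E D (ix i j 2 a b))) y z =
        \<alpha>0 * ?f 1 y z + \<beta>0 * ?f 2 y z"
      unfolding eval2_bipoly by (simp add: sum.distrib sum_distrib_left algebra_simps)
    ultimately show "?f 0 y z = 0 \<and>
        eval2 (bipoly (\<lambda>a b. \<alpha>0 * base_change c E D (ix i j 1 a b) + \<beta>0 * base_change c E D (ix i j 2 a b))) y z = 0"
      using f0 by simp
  qed
  show False using finite_subset[OF sub no_common_fibre[OF c d det ED nz0]] inf2 by simp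
qed

theorem orbit_vanishing:
  assumes c: "generic c" and sub: "Om \<subseteq> surf c" and ne: "Om \<noteq> {}" and cl: "other_closed c Om"
    and Q: "multihomogeneous dg Q" "\<And>x. x \<in> Om \<Longrightarrow> vanishes_at Q x" and x: "x \<in> surf c"
  shows "vanishes_at Q x"
proof (rule ccontr)
  assume nQ: "\<not> vanishes_at Q x"
  define B where "B = (\<lambda>i. {a. infinite {y \<in> Om. y i = a}})"
  have fibre: "vanishes_at Q y" if "a \<in> B i" "y \<in> surf c" "y i = a" for a i y
  proof (rule fibre_vanishing[OF c Q(1) _ that(2,3)])
    have "{y \<in> Om. y i = a} \<subseteq> {x \<in> surf c. x i = a \<and> vanishes_at Q x}" using sub Q(2) by blast
    then show "infinite {x \<in> surf c. x i = a \<and> vanishes_at Q x}"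
      using that(1) finite_subset unfolding B_def by blast
  qed
  \<comment> \<open>Every fibre in the direction \<open>i\<close> meets the fibre of
    \<open>x\<close> in the direction \<open>j\<close>. Infinitely many of them inside the zero set
    of \<open>Q\<close> would give infinitely many zeros on that fibre, hence a zero at
    \<open>x\<close>.\<close>
  have finB: "finite (B i)" for i
  proof (rule ccontr)
    assume inf: "infinite (B i)"
    obtain j k where "distinct3 i j k" using distinct3_exists by blast
    then have ij: "i \<noteq> j" by (simp add: distinct3_def)
    have "B i \<subseteq> (\<lambda>y. y i) ` {y \<in> surf c. y j = x j \<and> vanishes_at Q y}"
    proof
      fix a assume a: "a \<in> B i"
      obtain y where "y \<in> surf c" "y i = a" "y j = x j" using line_nonempty[OF ij] by blast
      then show "a \<in> (\<lambda>y. y i) ` {y \<in> surf c. y j = x j \<and> vanishes_at Q y}"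
        using fibre[OF a] by (intro image_eqI[of _ _ y]) auto
    qed
    then have "infinite {y \<in> surf c. y j = x j \<and> vanishes_at Q y}"
      using inf finite_surj by blast
    then show False using fibre_vanishing[OF c Q(1) _ x refl] nQ by blast
  qed
  obtain x0 where "x0 \<in> Om" using ne by blast
  then obtain i where i: "infinite {y \<in> Om. y i = x0 i}" using some_fibre_infinite[OF c sub cl] by blast
  define a where "a = x0 i"
  \<comment> \<open>The finitely many points of the fibre with another coordinate in some
    \<open>B l\<close>. A point outside \<open>N\<close> keeps these coordinates under the
    involution of the direction \<open>i\<close>, so for its image the infinite fibre must be the
    one in the direction \<open>i\<close>.\<close>
  define N where "N = (\<Union>l\<in>UNIV - {i}. \<Union>b\<in>B l. {y \<in> surf c. y i = a \<and> y l = b})"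
  have "finite N"
    unfolding N_def
  proof (intro finite_UN_I)
    fix l b assume "l \<in> UNIV - {i}"
    then show "finite {y \<in> surf c. y i = a \<and> y l = b}" by (intro line_finite[OF c]) auto
  qed (use finB in auto)
  define W where "W = {y \<in> Om. y i = a} - N"
  have infW: "infinite W" unfolding W_def a_def using i \<open>finite N\<close> by (rule Diff_infinite_finite[rotated])
  have "\<exists>a'\<in>B i. \<exists>v w. nz v \<and> pt v = y \<and> other c i v w \<and> abs_p1 w = a'" if y: "y \<in> W" for y
  proof -
    obtain v where v: "nz v" "pt v = y" using pt_rep by blast
    have yO: "y \<in> Om" "y i = a" "y \<notin> N" using y by (auto simp: W_def)
    then have "form c v = 0" using v sub pt_in_surf by blast
    then obtain w where w: "other c i v w" using other_exists[OF c v(1)] by blast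
    define y' where "y' = pt (v(i := w))"
    have y': "y' \<in> Om" using cl v w yO(1) unfolding other_closed_def y'_def by blast
    then obtain l where l: "y' l \<in> B l" using some_fibre_infinite[OF c sub cl y'] unfolding B_def by blast
    have "l = i"
    proof (rule ccontr)
      assume "l \<noteq> i"
      then have "y l \<in> B l" using l v(2) by (simp add: y'_def pt_upd)
      then have "y \<in> N" unfolding N_def using \<open>l \<noteq> i\<close> yO sub by blast
      then show False using yO(3) by simp
    qed
    then have "abs_p1 w \<in> B i" using l by (simp add: y'_def pt_upd)
    then show ?thesis using v w by blast
  qed
  note W = this
  have "W \<subseteq> (\<Union>a'\<in>B i. {y \<in> surf c. y i = a \<and> (\<exists>v w. nz v \<and> pt v = y \<and> other c i v w \<and> abs_p1 w = a')})"
  proof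
    fix y assume y: "y \<in> W"
    then have "y \<in> surf c \<and> y i = a" using sub by (auto simp: W_def)
    with W[OF y] show "y \<in> (\<Union>a'\<in>B i. {y \<in> surf c. y i = a \<and> (\<exists>v w. nz v \<and> pt v = y \<and> other c i v w \<and> abs_p1 w = a')})"
      by (elim bexE) (intro UN_I, assumption, simp)
  qed
  moreover have "finite (\<Union>a'\<in>B i. {y \<in> surf c. y i = a \<and> (\<exists>v w. nz v \<and> pt v = y \<and> other c i v w \<and> abs_p1 w = a')})"
    by (intro finite_UN_I finB no_constant_other[OF c])
  ultimately show False using infW finite_subset by blast
qed

subsection \<open>The involutions as automorphisms\<close>

lemma multihomogeneous_one: "multihomogeneous (\<lambda>_. 0) 1"
  by (auto simp: multihomogeneous_def multidegree_def)

lemma multihomogeneous_const: "multihomogeneous (\<lambda>_. 0) (Poly_Mapping.single 0 c)"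
  by (auto simp: multihomogeneous_def multidegree_def)

lemma multihomogeneous_pvar: "multihomogeneous (\<lambda>l. if l = i then 1 else 0) (pvar (i, j))"
proof -
  have "multidegree (Poly_Mapping.single (i, j) 1) = (\<lambda>l. if l = i then 1 else 0)"
    using two_cases[of j] by (auto simp: multidegree_def sum_UNIV_2 lookup_single when_def fun_eq_iff)
  then show ?thesis by (simp add: multihomogeneous_def pvar_def)
qed

lemma multihomogeneous_power: "multihomogeneous d p \<Longrightarrow> multihomogeneous (\<lambda>l. n * d l) (p ^ n)"
proof (induction n)
  case (Suc n)
  then show ?case using multihomogeneous_mult[of d p "\<lambda>l. n * d l" "p ^ n"] by simp
qed (simp add: multihomogeneous_one)

lemma multihomogeneous_prod:
  "(\<And>a. a \<in> A \<Longrightarrow> multihomogeneous (d a) (f a)) \<Longrightarrow> multihomogeneous (\<lambda>l. \<Sum>a\<in>A. d a l) (prod f A)"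
proof (induction A rule: infinite_finite_induct)
  case (insert x F)
  then show ?case using multihomogeneous_mult[of "d x" "f x"] by simp
qed (simp_all add: multihomogeneous_one)

lemma multihomogeneous_sum:
  assumes "\<And>a. a \<in> A \<Longrightarrow> multihomogeneous d (f a)"
  shows "multihomogeneous d (sum f A)"
  using assms
proof (induction A rule: infinite_finite_induct)
  case (insert x F)
  then have "multihomogeneous d (f x)" "multihomogeneous d (sum f F)" by auto
  then show ?case
    using keys_add[of "f x" "sum f F"] insert.hyps unfolding multihomogeneous_def by (simp, blast)
qed (simp_all add: multihomogeneous_def)

lemma multihomogeneous_uminus: "multihomogeneous d p \<Longrightarrow> multihomogeneous d (- p)"
  by (simp add: multihomogeneous_def)

lemma multihomogeneous_diff:
  "multihomogeneous d p \<Longrightarrow> multihomogeneous d q \<Longrightarrow> multihomogeneous d (p - q)"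
  using keys_diff[of p q] unfolding multihomogeneous_def by blast

section \<open>Substitution into one factor and morphisms given by it\<close>

definition eval_pair :: "(2 \<Rightarrow> (3 \<times> 2) cpoly) \<Rightarrow> (3 \<Rightarrow> complex ^ 2) \<Rightarrow> complex ^ 2" where
  "eval_pair G v = (\<chi> j. poly_eval (coord_fun v) (G j))"

definition subst_slot :: "3 \<Rightarrow> (2 \<Rightarrow> (3 \<times> 2) cpoly) \<Rightarrow> (3 \<times> 2) cpoly \<Rightarrow> (3 \<times> 2) cpoly" where
  "subst_slot i G Q = (\<Sum>m\<in>Poly_Mapping.keys Q. Poly_Mapping.single 0 (Poly_Mapping.lookup Q m) *
     (\<Prod>z\<in>UNIV. (if fst z = i then G (snd z) else pvar z) ^ Poly_Mapping.lookup m z))"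

lemma poly_eval_const: "poly_eval a (Poly_Mapping.single 0 c) = c"
  by (simp add: poly_eval_single monom_eval_def)

lemma poly_eval_subst_slot:
  "poly_eval (coord_fun v) (subst_slot i G Q) = poly_eval (coord_fun (v(i := eval_pair G v))) Q"
proof -
  have "poly_eval (coord_fun v) (\<Prod>z\<in>UNIV. (if fst z = i then G (snd z) else pvar z) ^ Poly_Mapping.lookup m z) =
      monom_eval (coord_fun (v(i := eval_pair G v))) m" for m
    unfolding poly_eval_prod poly_eval_power
    by (subst monom_eval_superset[of UNIV]) (auto simp: eval_pair_def intro!: prod.cong)
  then show ?thesis
    by (simp add: subst_slot_def poly_eval_sum poly_eval_mult poly_eval_const poly_eval_def[of _ Q])
qed

lemma multihomogeneous_subst_slot:
  assumes G: "\<And>j. multihomogeneous e (G j)" and Q: "multihomogeneous d Q"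
  shows "multihomogeneous (\<lambda>l. \<Sum>i'\<in>UNIV. d i' * (if i' = i then e l else if l = i' then 1 else 0)) (subst_slot i G Q)"
  unfolding subst_slot_def
proof (rule multihomogeneous_sum)
  fix m assume m: "m \<in> Poly_Mapping.keys Q"
  define g where "g = (\<lambda>i' l. if i' = i then e l else if l = i' then 1 else 0 :: nat)"
  have "multihomogeneous (g (fst z)) (if fst z = i then G (snd z) else pvar z)" for z
    using G multihomogeneous_pvar[of "fst z" "snd z"] by (simp add: g_def)
  then have "multihomogeneous (\<lambda>l. \<Sum>z\<in>UNIV. Poly_Mapping.lookup m z * g (fst z) l)
      (\<Prod>z\<in>UNIV. (if fst z = i then G (snd z) else pvar z) ^ Poly_Mapping.lookup m z)"
    by (intro multihomogeneous_prod multihomogeneous_power)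
  moreover have "(\<Sum>z\<in>UNIV. Poly_Mapping.lookup m z * g (fst z) l) = (\<Sum>i'\<in>UNIV. d i' * g i' l)" for l
  proof -
    have dm: "d = multidegree m" using Q m by (auto simp: multihomogeneous_def)
    have "(\<Sum>z\<in>UNIV \<times> UNIV. Poly_Mapping.lookup m z * g (fst z) l) =
        (\<Sum>i'\<in>UNIV. \<Sum>j\<in>UNIV. Poly_Mapping.lookup m (i', j) * g i' l)"
      by (subst sum.cartesian_product) (simp add: split_def)
    then show ?thesis by (simp add: dm multidegree_def sum_distrib_right)
  qed
  ultimately have "multihomogeneous (\<lambda>l. \<Sum>i'\<in>UNIV. d i' * g i' l)
      (\<Prod>z\<in>UNIV. (if fst z = i then G (snd z) else pvar z) ^ Poly_Mapping.lookup m z)"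
    by simp
  from multihomogeneous_mult[OF multihomogeneous_const this]
  show "multihomogeneous (\<lambda>l. \<Sum>i'\<in>UNIV. d i' * (if i' = i then e l else if l = i' then 1 else 0))
      (Poly_Mapping.single 0 (Poly_Mapping.lookup Q m) *
       (\<Prod>z\<in>UNIV. (if fst z = i then G (snd z) else pvar z) ^ Poly_Mapping.lookup m z))"
    by (simp add: g_def)
qed

lemma openin_nonvanishing:
  assumes "multihomogeneous d Q"
  shows "openin (zariski_on X) {y \<in> X. \<not> vanishes_at Q y}"
proof -
  have "algebraic_set (zero_locus {Q})" using assms unfolding algebraic_set_def by blast
  moreover have "- {y. \<not> vanishes_at Q y} = zero_locus {Q}" by (auto simp: zero_locus_def)
  ultimately have "openin zariski {y. \<not> vanishes_at Q y}" by (simp add: openin_zariski)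
  then show ?thesis
    unfolding openin_subtopology by (intro exI[of _ "{y. \<not> vanishes_at Q y}"]) auto
qed

text \<open>Pull-back by \<open>subst_slot\<close> keeps multihomogeneity and equality of
  multidegrees. It therefore transports nonvanishing loci, which gives continuity, as well as the
  quotients that define regular functions.\<close>

lemma morphism_of_local_slot_change:
  assumes fX: "\<And>x. x \<in> X \<Longrightarrow> f x \<in> X"
    and loc: "\<And>x. x \<in> X \<Longrightarrow> \<exists>V G e. openin (zariski_on X) V \<and> x \<in> V \<and> (\<forall>j. multihomogeneous e (G j)) \<and>
      (\<forall>v. nz v \<longrightarrow> pt v \<in> V \<longrightarrow> eval_pair G v \<noteq> 0 \<and> f (pt v) = pt (v(i := eval_pair G v)))"
  shows "variety_morphism X X f"
proof -
  have cont: "openin (zariski_on X) {x \<in> X. f x \<in> U}" if U: "openin (zariski_on X) U" for U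
  proof (subst openin_subopen, intro ballI)
    fix x assume "x \<in> {x \<in> X. f x \<in> U}"
    then have x: "x \<in> X" "f x \<in> U" by auto
    obtain T where T: "openin zariski T" "U = T \<inter> X" using U by (auto simp: openin_subtopology)
    then obtain S where S: "\<forall>p\<in>S. \<exists>d. multihomogeneous d p" "- T = zero_locus S"
      by (auto simp: openin_zariski algebraic_set_def)
    have "f x \<notin> zero_locus S" using x T S(2) by blast
    then obtain Q d where Q: "Q \<in> S" "\<not> vanishes_at Q (f x)" "multihomogeneous d Q"
      using S(1) by (auto simp: zero_locus_def)
    obtain V G e where V: "openin (zariski_on X) V" "x \<in> V" "\<And>j. multihomogeneous e (G j)"
      "\<And>v. nz v \<Longrightarrow> pt v \<in> V \<Longrightarrow> eval_pair G v \<noteq> 0 \<and> f (pt v) = pt (v(i := eval_pair G v))"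
      using loc[OF x(1)] by blast
    let ?Q = "subst_slot i G Q"
    obtain e' where hQ: "multihomogeneous e' ?Q" using multihomogeneous_subst_slot[where G = G and i = i, OF V(3) Q(3)] by blast
    have iff: "vanishes_at ?Q y \<longleftrightarrow> vanishes_at Q (f y)" if "y \<in> V" for y
    proof -
      obtain v where v: "nz v" "pt v = y" using pt_rep by blast
      then have g: "eval_pair G v \<noteq> 0" "f y = pt (v(i := eval_pair G v))" using V(4)[of v] that by auto
      then have "v(i := eval_pair G v) \<in> hom_coords (f y)" "v \<in> hom_coords y"
        using v nz_upd by (simp_all add: hom_coords_iff)
      then show ?thesis
        using vanishes_at_iff[OF hQ] vanishes_at_iff[OF Q(3)] by (simp add: poly_eval_subst_slot)
    qed
    have "openin (zariski_on X) (V \<inter> {y \<in> X. \<not> vanishes_at ?Q y})"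
      by (rule openin_Int[OF V(1) openin_nonvanishing[OF hQ]])
    moreover have "x \<in> V \<inter> {y \<in> X. \<not> vanishes_at ?Q y}" using V(2) x(1) Q(2) iff by simp
    moreover have "V \<inter> {y \<in> X. \<not> vanishes_at ?Q y} \<subseteq> {x \<in> X. f x \<in> U}"
    proof
      fix y assume y: "y \<in> V \<inter> {y \<in> X. \<not> vanishes_at ?Q y}"
      then have "f y \<notin> zero_locus S" using iff Q(1) by (auto simp: zero_locus_def)
      then have "f y \<in> T" using S(2) by blast
      then show "y \<in> {x \<in> X. f x \<in> U}" using y fX T(2) by auto
    qed
    ultimately show "\<exists>T. openin (zariski_on X) T \<and> x \<in> T \<and> T \<subseteq> {x \<in> X. f x \<in> U}" by blast
  qed
  show ?thesis
    unfolding variety_morphism_def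
  proof (intro conjI allI impI)
    show "continuous_map (zariski_on X) (zariski_on X) f"
      using fX cont by (auto simp: continuous_map_def)
    fix U h assume U: "openin (zariski_on X) U" and h: "regular_on X U h"
    show "regular_on X {x \<in> X. f x \<in> U} (h \<circ> f)"
      unfolding regular_on_def
    proof
      fix x assume "x \<in> {x \<in> X. f x \<in> U}"
      then have x: "x \<in> X" "f x \<in> U" by auto
      obtain W d p q where W: "openin (zariski_on X) W" "f x \<in> W" "W \<subseteq> U"
        "multihomogeneous d p" "multihomogeneous d q"
        "\<And>y v. y \<in> W \<Longrightarrow> v \<in> hom_coords y \<Longrightarrow> poly_eval (coord_fun v) q \<noteq> 0 \<and>
           h y = poly_eval (coord_fun v) p / poly_eval (coord_fun v) q"
        using h x(2) unfolding regular_on_def by meson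
      obtain V G e where V: "openin (zariski_on X) V" "x \<in> V" "\<And>j. multihomogeneous e (G j)"
        "\<And>v. nz v \<Longrightarrow> pt v \<in> V \<Longrightarrow> eval_pair G v \<noteq> 0 \<and> f (pt v) = pt (v(i := eval_pair G v))"
        using loc[OF x(1)] by blast
      define V' where "V' = V \<inter> {y \<in> X. f y \<in> W}"
      define e' where "e' = (\<lambda>l. \<Sum>i'\<in>UNIV. d i' * (if i' = i then e l else if l = i' then 1 else 0))"
      have "openin (zariski_on X) V'" unfolding V'_def by (rule openin_Int[OF V(1) cont[OF W(1)]])
      moreover have "x \<in> V'" using V(2) x(1) W(2) by (simp add: V'_def)
      moreover have "V' \<subseteq> {x \<in> X. f x \<in> U}" using W(3) by (auto simp: V'_def)
      moreover have "multihomogeneous e' (subst_slot i G p)" "multihomogeneous e' (subst_slot i G q)"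
        unfolding e'_def by (rule multihomogeneous_subst_slot[OF V(3) W(4)] multihomogeneous_subst_slot[OF V(3) W(5)])+
      moreover have "\<forall>y\<in>V'. \<forall>v\<in>hom_coords y. poly_eval (coord_fun v) (subst_slot i G q) \<noteq> 0 \<and>
          (h \<circ> f) y = poly_eval (coord_fun v) (subst_slot i G p) / poly_eval (coord_fun v) (subst_slot i G q)"
      proof (intro ballI)
        fix y v assume y: "y \<in> V'" and v: "v \<in> hom_coords y"
        then have v': "nz v" "pt v = y" by (simp_all add: hom_coords_iff)
        then have g: "eval_pair G v \<noteq> 0" "f y = pt (v(i := eval_pair G v))" using V(4)[of v] y by (auto simp: V'_def)
        then have "v(i := eval_pair G v) \<in> hom_coords (f y)" using v' nz_upd by (simp add: hom_coords_iff)
        moreover have "f y \<in> W" using y by (simp add: V'_def)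
        ultimately show "poly_eval (coord_fun v) (subst_slot i G q) \<noteq> 0 \<and>
            (h \<circ> f) y = poly_eval (coord_fun v) (subst_slot i G p) / poly_eval (coord_fun v) (subst_slot i G q)"
          using W(6)[of "f y" "v(i := eval_pair G v)"] unfolding poly_eval_subst_slot comp_def by blast
      qed
      ultimately show "\<exists>V. openin (zariski_on X) V \<and> x \<in> V \<and> V \<subseteq> {x \<in> X. f x \<in> U} \<and>
          (\<exists>d p q. multihomogeneous d p \<and> multihomogeneous d q \<and>
            (\<forall>y\<in>V. \<forall>v\<in>hom_coords y. poly_eval (coord_fun v) q \<noteq> 0 \<and>
              (h \<circ> f) y = poly_eval (coord_fun v) p / poly_eval (coord_fun v) q))"
        by blast
    qed
  qed
qed

text \<open>If \<open>w\<close> and \<open>w'\<close> were independent, comparing the two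
  factorisations at \<open>w\<close> and at \<open>w'\<close> would make both proportional to
  \<open>v i\<close>.\<close>

lemma other_unique:
  assumes "nz v" "other c i v w" "other c i v w'"
  shows "abs_p1 w = abs_p1 w'"
proof -
  obtain k k' where k: "w \<noteq> 0" "w' \<noteq> 0" "k \<noteq> 0" "k' \<noteq> 0"
    "\<And>u. k * det2 (v i) u * det2 w u = k' * det2 (v i) u * det2 w' u"
    using assms(2,3) unfolding other_def by metis
  have vi: "v i \<noteq> 0" using assms(1) by (simp add: nz_def)
  have "det2 w w' = 0"
  proof (rule ccontr)
    assume ne: "det2 w w' \<noteq> 0"
    then have "det2 w' w \<noteq> 0" using det2_swap[of w w'] by simp
    then have "det2 (v i) w = 0" "det2 (v i) w' = 0" using k(5)[of w] k(5)[of w'] k(3,4) ne by auto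
    then obtain a b where "w = a *s v i" "w' = b *s v i" using det2_eq_0_imp vi by metis
    then show False using ne by simp
  qed
  then show ?thesis using abs_p1_eq_iff k(1,2) by blast
qed

lemma other_sym:
  assumes "nz v" "other c i v w"
  shows "other c i (v(i := w)) (v i)"
proof -
  obtain k where "w \<noteq> 0" "k \<noteq> 0" "\<And>u. form c (v(i := u)) = k * det2 (v i) u * det2 w u"
    using assms(2) by (auto simp: other_def)
  then show ?thesis
    using assms(1) unfolding other_def by (auto simp: nz_def intro!: exI[of _ k])
qed

text \<open>The choice is harmless: by \<open>involution_eq\<close> all admissible \<open>v\<close>
  and \<open>w\<close> lead to the same point.\<close>

definition involution :: "((3 \<Rightarrow> nat) \<Rightarrow> complex) \<Rightarrow> 3 \<Rightarrow> point \<Rightarrow> point" where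
  "involution c i x = (SOME y. \<exists>v w. nz v \<and> pt v = x \<and> other c i v w \<and> y = pt (v(i := w)))"

lemma involution_eq:
  assumes v: "nz v" "other c i v w"
  shows "involution c i (pt v) = pt (v(i := w))"
  unfolding involution_def
proof (rule some_equality)
  show "\<exists>v' w'. nz v' \<and> pt v' = pt v \<and> other c i v' w' \<and> pt (v(i := w)) = pt (v'(i := w'))"
    using v by blast
  fix y assume "\<exists>v' w'. nz v' \<and> pt v' = pt v \<and> other c i v' w' \<and> y = pt (v'(i := w'))"
  then obtain v' w' where v': "nz v'" "pt v' = pt v" "other c i v' w'" "y = pt (v'(i := w'))" by blast
  have "w' \<noteq> 0" using v'(3) by (simp add: other_def)
  then have "other c i v w'" using other_transfer[OF v'(1) v(1) v'(2) _ refl v'(3)] by simp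
  then have "abs_p1 w' = abs_p1 w" using other_unique[OF v(1)] v(2) by metis
  then show "y = pt (v(i := w))" using v'(2,4) by (simp add: pt_upd)
qed

lemma involution_surf:
  assumes c: "generic c" and x: "x \<in> surf c"
  shows "involution c i x \<in> surf c" "involution c i (involution c i x) = x"
proof -
  obtain v where v: "nz v" "pt v = x" using pt_rep by blast
  then have "form c v = 0" using x pt_in_surf by blast
  then obtain w where w: "other c i v w" using other_exists[OF c v(1)] by blast
  then have w0: "w \<noteq> 0" and "form c (v(i := w)) = 0" by (auto simp: other_def)
  then have nz: "nz (v(i := w))" and "pt (v(i := w)) \<in> surf c"
    using v(1) pt_in_surf nz_upd by blast+
  then show "involution c i x \<in> surf c" using involution_eq[OF v(1) w] v(2) by simp
  have "involution c i (pt (v(i := w))) = pt ((v(i := w))(i := v i))"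
    by (rule involution_eq[OF nz other_sym[OF v(1) w]])
  then show "involution c i (involution c i x) = x" using involution_eq[OF v(1) w] v(2) by simp
qed

section \<open>The involutions in homogeneous polynomials\<close>

definition slot_poly :: "(3 \<times> 2) cpoly \<Rightarrow> 3 \<Rightarrow> nat \<Rightarrow> (3 \<times> 2) cpoly" where
  "slot_poly P i a = (\<Sum>e\<in>{e \<in> idx. e i = a}. Poly_Mapping.single 0 (cf P e) *
     (\<Prod>l\<in>UNIV - {i}. pvar (l, 0) ^ e l * pvar (l, 1) ^ (2 - e l)))"

lemma poly_eval_slot_poly: "poly_eval (coord_fun v) (slot_poly P i a) = slot (cf P) v i a"
  by (simp add: slot_poly_def slot_def poly_eval_sum poly_eval_mult poly_eval_const poly_eval_prod poly_eval_power)

lemma multihomogeneous_slot_poly: "multihomogeneous (\<lambda>l. if l = i then 0 else 2) (slot_poly P i a)"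
  unfolding slot_poly_def
proof (rule multihomogeneous_sum)
  fix e assume e: "e \<in> {e \<in> idx. e i = a}"
  have "multihomogeneous (\<lambda>m. e l * (if m = l then 1 else 0) + (2 - e l) * (if m = l then 1 else 0))
      (pvar (l, 0) ^ e l * pvar (l, 1) ^ (2 - e l))" for l
    by (intro multihomogeneous_mult multihomogeneous_power multihomogeneous_pvar)
  then have h: "multihomogeneous (\<lambda>m. \<Sum>l\<in>UNIV - {i}. e l * (if m = l then 1 else 0) + (2 - e l) * (if m = l then 1 else 0))
      (\<Prod>l\<in>UNIV - {i}. pvar (l, 0) ^ e l * pvar (l, 1) ^ (2 - e l))"
    by (rule multihomogeneous_prod)
  have "(\<Sum>l\<in>UNIV - {i}. e l * (if m = l then 1 else 0) + (2 - e l) * (if m = l then 1 else 0)) =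
      (if m = i then 0 else 2)" for m
  proof -
    have "e l \<le> 2" for l using e by (simp add: idx_def)
    then have "(\<Sum>l\<in>UNIV - {i}. e l * (if m = l then 1 else 0) + (2 - e l) * (if m = l then 1 else 0)) =
        (\<Sum>l\<in>UNIV - {i}. if m = l then 2 else 0)" by (intro sum.cong) auto
    then show ?thesis by simp
  qed
  with multihomogeneous_mult[OF multihomogeneous_const h]
  show "multihomogeneous (\<lambda>l. if l = i then 0 else 2)
      (Poly_Mapping.single 0 (cf P e) * (\<Prod>l\<in>UNIV - {i}. pvar (l, 0) ^ e l * pvar (l, 1) ^ (2 - e l)))"
    by simp
qed

text \<open>With \<open>A X^2 + B X W + C W^2\<close> the equation in the \<open>i\<close>-th factor, the second root is
  \<open>(- B w - A x : A w)\<close> where \<open>w \<noteq> 0\<close> and \<open>(C x : - B x - C w)\<close> where \<open>x \<noteq> 0\<close>.\<close>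

definition swap_poly :: "(3 \<times> 2) cpoly \<Rightarrow> 3 \<Rightarrow> 2 \<Rightarrow> 2 \<Rightarrow> (3 \<times> 2) cpoly" where
  "swap_poly P i m j = (if m = 1
     then (if j = 0 then - (slot_poly P i 1 * pvar (i, 1)) - slot_poly P i 2 * pvar (i, 0)
           else slot_poly P i 2 * pvar (i, 1))
     else (if j = 0 then slot_poly P i 0 * pvar (i, 0)
           else - (slot_poly P i 1 * pvar (i, 0)) - slot_poly P i 0 * pvar (i, 1)))"

lemma multihomogeneous_swap_poly: "multihomogeneous (\<lambda>l. if l = i then 1 else 2) (swap_poly P i m j)"
proof -
  have "multihomogeneous (\<lambda>l. (if l = i then 0 else 2) + (if l = i then 1 else 0)) (slot_poly P i a * pvar (i, r))" for a r
    by (intro multihomogeneous_mult multihomogeneous_slot_poly multihomogeneous_pvar)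
  moreover have "(\<lambda>l. (if l = i then 0 else 2) + (if l = i then 1 else 0)) = (\<lambda>l. if l = i then 1 else 2 :: nat)"
    by auto
  ultimately have "multihomogeneous (\<lambda>l. if l = i then 1 else 2) (slot_poly P i a * pvar (i, r))" for a r
    by metis
  then show ?thesis
    unfolding swap_poly_def by (auto intro!: multihomogeneous_diff multihomogeneous_uminus)
qed

text \<open>The equation is multiplied by the square of the nonzero coordinate. The root relation at
  \<open>v i\<close> then produces the coefficient missing from the formula, \<open>C\<close> for
  \<open>m = 1\<close> and \<open>A\<close> for \<open>m = 0\<close>.\<close>

lemma other_swap_poly:
  assumes c: "generic (cf P)" and v: "nz v" "form (cf P) v = 0" and m: "v i $ m \<noteq> 0"
  shows "other (cf P) i v (eval_pair (swap_poly P i m) v)"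
proof -
  define A B C where "A = slot (cf P) v i 2" and "B = slot (cf P) v i 1" and "C = slot (cf P) v i 0"
  define x w where "x = v i $ 0" and "w = v i $ 1"
  have q: "form (cf P) (v(i := u)) = C * (u $ 1)\<^sup>2 + B * (u $ 0 * u $ 1) + A * (u $ 0)\<^sup>2" for u
    by (simp add: form_slot A_def B_def C_def)
  have root: "C * w\<^sup>2 + B * (x * w) + A * x\<^sup>2 = 0" using q[of "v i"] v(2) by (simp add: x_def w_def)
  define g where "g = eval_pair (swap_poly P i m) v"
  have prod: "det2 (v i) u * det2 g u =
      x * g $ 0 * (u $ 1)\<^sup>2 - (x * g $ 1 + w * g $ 0) * (u $ 0 * u $ 1) + w * g $ 1 * (u $ 0)\<^sup>2" for u
    unfolding det2_def x_def w_def by (simp add: power2_eq_square algebra_simps)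
  have "(v i $ m)\<^sup>2 * form (cf P) (v(i := u)) = det2 (v i) u * det2 g u" for u
  proof (cases "m = 1")
    case True
    have g: "g $ 0 = - (B * w) - A * x" "g $ 1 = A * w"
      by (simp_all add: g_def eval_pair_def swap_poly_def True poly_eval_diff poly_eval_minus poly_eval_mult
          poly_eval_slot_poly A_def B_def x_def w_def)
    have "x * (- (B * w) - A * x) = C * w\<^sup>2"
    proof -
      have "x * (- (B * w) - A * x) = C * w\<^sup>2 - (C * w\<^sup>2 + B * (x * w) + A * x\<^sup>2)"
        by (simp add: power2_eq_square algebra_simps)
      then show ?thesis using root by simp
    qed
    moreover have "x * g $ 1 + w * g $ 0 = - (B * w\<^sup>2)" "w * g $ 1 = A * w\<^sup>2"
      by (simp_all add: g power2_eq_square algebra_simps)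
    ultimately have "det2 (v i) u * det2 g u =
        C * w\<^sup>2 * (u $ 1)\<^sup>2 - (- (B * w\<^sup>2)) * (u $ 0 * u $ 1) + A * w\<^sup>2 * (u $ 0)\<^sup>2"
      unfolding prod g by simp
    then show ?thesis unfolding q True w_def[symmetric] by (simp add: algebra_simps)
  next
    case False
    then have m0: "m = 0" using two_cases by blast
    have g: "g $ 0 = C * x" "g $ 1 = - (B * x) - C * w"
      by (simp_all add: g_def eval_pair_def swap_poly_def m0 poly_eval_diff poly_eval_minus poly_eval_mult
          poly_eval_slot_poly B_def C_def x_def w_def)
    have "w * (- (B * x) - C * w) = A * x\<^sup>2"
    proof -
      have "w * (- (B * x) - C * w) = A * x\<^sup>2 - (C * w\<^sup>2 + B * (x * w) + A * x\<^sup>2)"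
        by (simp add: power2_eq_square algebra_simps)
      then show ?thesis using root by simp
    qed
    moreover have "x * g $ 1 + w * g $ 0 = - (B * x\<^sup>2)" "x * g $ 0 = C * x\<^sup>2"
      by (simp_all add: g power2_eq_square algebra_simps)
    ultimately have "det2 (v i) u * det2 g u =
        C * x\<^sup>2 * (u $ 1)\<^sup>2 - (- (B * x\<^sup>2)) * (u $ 0 * u $ 1) + A * x\<^sup>2 * (u $ 0)\<^sup>2"
      unfolding prod g by simp
    then show ?thesis unfolding q m0 x_def[symmetric] by (simp add: algebra_simps)
  qed
  then have eq: "form (cf P) (v(i := u)) = inverse ((v i $ m)\<^sup>2) * det2 (v i) u * det2 g u" for u
    using m by (simp add: field_simps)
  have "g \<noteq> 0"
  proof
    assume "g = 0"
    then have "form (cf P) (v(i := u)) = 0" for u using eq by simp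
    from this[of "ax 0"] this[of "ax 1"] this[of "ax 0 + ax 1"]
    have "A = 0" "B = 0" "C = 0" by (simp_all add: q)
    then show False using no_vertical_line[OF c v(1), of i] by (simp add: A_def B_def C_def)
  qed
  then show ?thesis
    using eq m unfolding other_def g_def[symmetric] by (intro conjI exI[of _ "inverse ((v i $ m)\<^sup>2)"]) auto
qed

text \<open>The two formulas apply on the open sets where the coordinate \<open>m\<close> of the
  factor \<open>i\<close> is nonzero, and these cover the surface.\<close>

lemma variety_morphism_involution:
  assumes c: "generic (cf P)"
  shows "variety_morphism (surf (cf P)) (surf (cf P)) (involution (cf P) i)"
proof (rule morphism_of_local_slot_change[where i = i])
  let ?X = "surf (cf P)"
  show "involution (cf P) i x \<in> ?X" if "x \<in> ?X" for x using involution_surf(1)[OF c that] .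
  fix x assume x: "x \<in> ?X"
  obtain v0 where v0: "nz v0" "pt v0 = x" using pt_rep by blast
  obtain m where m: "v0 i $ m \<noteq> 0" using v0(1) unfolding nz_def by (metis vec2_eq_iff zero_index)
  have nv: "vanishes_at (pvar (i, m)) (pt v) \<longleftrightarrow> v i $ m = 0" if "nz v" for v
    using vanishes_at_iff[OF multihomogeneous_pvar, of v "pt v" i m] that by (simp add: hom_coords_iff)
  let ?V = "{y \<in> ?X. \<not> vanishes_at (pvar (i, m)) y}"
  have "openin (zariski_on ?X) ?V" by (rule openin_nonvanishing[OF multihomogeneous_pvar])
  moreover have "x \<in> ?V" using x nv[OF v0(1)] m v0(2) by simp
  moreover have "eval_pair (swap_poly P i m) v \<noteq> 0 \<and> involution (cf P) i (pt v) = pt (v(i := eval_pair (swap_poly P i m) v))"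
    if v: "nz v" "pt v \<in> ?V" for v
  proof -
    have "form (cf P) v = 0" "v i $ m \<noteq> 0" using v nv pt_in_surf by auto
    then have o: "other (cf P) i v (eval_pair (swap_poly P i m) v)" by (intro other_swap_poly[OF c v(1)])
    then show ?thesis using involution_eq[OF v(1) o] by (simp add: other_def)
  qed
  ultimately show "\<exists>V G e. openin (zariski_on ?X) V \<and> x \<in> V \<and> (\<forall>j. multihomogeneous e (G j)) \<and>
      (\<forall>v. nz v \<longrightarrow> pt v \<in> V \<longrightarrow> eval_pair G v \<noteq> 0 \<and> involution (cf P) i (pt v) = pt (v(i := eval_pair G v)))"
    using multihomogeneous_swap_poly by blast
qed

text \<open>Elements of \<open>Bij\<close> are extensional, hence the restriction. The map is its
  own inverse, so a single morphism property serves both directions.\<close>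

lemma involution_in_Aut:
  assumes c: "generic (cf P)"
  shows "restrict (involution (cf P) i) (surf (cf P)) \<in> carrier (Aut (surf (cf P)))"
proof -
  let ?X = "surf (cf P)" and ?s = "restrict (involution (cf P) i) (surf (cf P))"
  have s: "?s x \<in> ?X" "?s (?s x) = x" if "x \<in> ?X" for x
    using involution_surf[OF c that] that by simp_all
  have bij: "bij_betw ?s ?X ?X" by (rule bij_betwI[of _ _ _ ?s]) (use s in auto)
  have mor: "variety_morphism ?X ?X ?s"
    by (rule variety_morphism_cong[OF _ variety_morphism_involution[OF c]]) simp
  moreover have "variety_morphism ?X ?X (inv_into ?X ?s)"
  proof (rule variety_morphism_cong[OF _ mor])
    fix x assume x: "x \<in> ?X"
    show "?s x = inv_into ?X ?s x"
      by (rule inv_into_f_eq[symmetric]) (use bij s[OF x] in \<open>auto simp: bij_betw_def\<close>)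
  qed
  ultimately show ?thesis using bij by (simp add: Aut_def Bij_def)
qed

text \<open>Links group orbits to the sets studied above: composing with an involution stays in the
  group, so an orbit is stable under all three.\<close>

lemma orbit_other_closed:
  assumes c: "generic (cf P)" and x: "x \<in> surf (cf P)"
    and Om: "Om = orbit (Aut (surf (cf P))) (\<lambda>f. f) x"
  shows "Om \<subseteq> surf (cf P)" "x \<in> Om" "other_closed (cf P) Om"
proof -
  let ?X = "surf (cf P)"
  interpret A: group "Aut ?X" by (rule group_Aut)
  have Om': "Om = {f x |f. f \<in> carrier (Aut ?X)}" by (simp add: Om orbit_def)
  have fX: "f y \<in> ?X" if "f \<in> carrier (Aut ?X)" "y \<in> ?X" for f y
    using that by (auto simp: Aut_def Bij_def bij_betw_def)
  show "Om \<subseteq> ?X" using fX x by (auto simp: Om')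
  have "(\<lambda>y\<in>?X. y) \<in> carrier (Aut ?X)"
    using A.one_closed by (simp add: Aut_def BijGroup_def)
  then show "x \<in> Om" unfolding Om' using x by (intro CollectI exI[of _ "\<lambda>y\<in>?X. y"]) simp
  show "other_closed (cf P) Om"
    unfolding other_closed_def
  proof (intro allI impI)
    fix v i w assume v: "nz v" "pt v \<in> Om" and w: "other (cf P) i v w"
    obtain f where f: "f \<in> carrier (Aut ?X)" "pt v = f x" using v(2) by (auto simp: Om')
    let ?s = "restrict (involution (cf P) i) ?X"
    have "?s \<otimes>\<^bsub>Aut ?X\<^esub> f \<in> carrier (Aut ?X)" by (rule A.m_closed[OF involution_in_Aut[OF c] f(1)])
    moreover have "?s \<otimes>\<^bsub>Aut ?X\<^esub> f = compose ?X ?s f"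
      using involution_in_Aut[OF c, of i] f(1) by (simp add: Aut_def BijGroup_def)
    moreover have "compose ?X ?s f x = pt (v(i := w))"
      using x fX[OF f(1) x] involution_eq[OF v(1) w] f(2) by (simp add: compose_def)
    ultimately show "pt (v(i := w)) \<in> Om" unfolding Om' by (metis (mono_tags, lifting) mem_Collect_eq)
  qed
qed

theorem theoremA:
  shows "very_general_wehler (\<lambda>X.
    (\<forall>\<Omega> \<in> orbits (Aut X) X (\<lambda>f. f). zariski_dense_in \<Omega> X) \<and>
    \<not> (\<exists>\<Omega> \<in> orbits (Aut X) X (\<lambda>f. f). finite \<Omega>))"
proof (rule very_general_wehlerI)
  fix P assume P: "P \<in> sections_L" and c: "generic (cf P)"
  let ?X = "surf (cf P)"
  have "zariski_dense_in Om ?X \<and> infinite Om" if Om: "Om \<in> orbits (Aut ?X) ?X (\<lambda>f. f)" for Om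
  proof
    obtain x where x: "x \<in> ?X" "Om = orbit (Aut ?X) (\<lambda>f. f) x" using Om by (auto simp: orbits_def)
    note O = orbit_other_closed[OF c x]
    show "infinite Om"
      using some_fibre_infinite[OF c O(1) O(3) O(2)] finite_subset[of "{y \<in> Om. y _ = _}" Om] by auto
    \<comment> \<open>A neighbourhood of \<open>y\<close> missing the orbit is the complement in the
      surface of a zero locus containing the orbit; by \<open>orbit_vanishing\<close> every
      polynomial defining that locus also vanishes at \<open>y\<close>.\<close>
    have "y \<in> zariski_on ?X closure_of Om" if y: "y \<in> ?X" for y
      unfolding in_closure_of
    proof (intro conjI allI impI)
      show "y \<in> topspace (zariski_on ?X)" using y by simp
      fix T assume T: "y \<in> T \<and> openin (zariski_on ?X) T"
      then obtain T' where T': "openin zariski T'" "T = T' \<inter> ?X" by (auto simp: openin_subtopology)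
      then obtain S where S: "\<forall>p\<in>S. \<exists>d. multihomogeneous d p" "- T' = zero_locus S"
        by (auto simp: openin_zariski algebraic_set_def)
      show "\<exists>z. z \<in> Om \<and> z \<in> T"
      proof (rule ccontr)
        assume "\<not> ?thesis"
        then have Om: "Om \<subseteq> zero_locus S" using O(1) T'(2) S(2) by blast
        have "vanishes_at Q y" if "Q \<in> S" for Q
        proof -
          obtain d where "multihomogeneous d Q" using S(1) \<open>Q \<in> S\<close> by blast
          moreover have "vanishes_at Q z" if "z \<in> Om" for z
            using Om that \<open>Q \<in> S\<close> by (auto simp: zero_locus_def)
          moreover have "Om \<noteq> {}" using O(2) by blast
          ultimately show ?thesis using orbit_vanishing[OF c O(1) _ O(3) _ _ y] by blast
        qed
        then have "y \<in> zero_locus S" by (simp add: zero_locus_def)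
        then show False using T T'(2) S(2) by blast
      qed
    qed
    moreover have "zariski_on ?X closure_of Om \<subseteq> ?X"
      using closure_of_subset_topspace[of "zariski_on ?X" Om] by simp
    ultimately show "zariski_dense_in Om ?X" unfolding zariski_dense_in_def by blast
  qed
  then show "(\<forall>\<Omega> \<in> orbits (Aut {x. vanishes_at P x}) {x. vanishes_at P x} (\<lambda>f. f).
        zariski_dense_in \<Omega> {x. vanishes_at P x}) \<and>
      \<not> (\<exists>\<Omega> \<in> orbits (Aut {x. vanishes_at P x}) {x. vanishes_at P x} (\<lambda>f. f). finite \<Omega>)"
    unfolding vanishes_at_surf[OF P] by blast
qed

end
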